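(* Let $r\geq 3$, $k\geq 1$, $p\geq 0$, $\ell_1,\dots,\ell_k\geq 5$ be integers, and if $p\geq 1$ let $t_1,\dots,t_p\geq 2$ be integers. Let $s\geq r$ be an integer and $t=\sum_{i=1}^k\lfloor\frac{\ell_i+1}{2}\rfloor+p-1$. For each $i\in[k]$ let $Q_i\in\{P_{\ell_i}^r,C_{\ell_i}^r\}$ (chosen independently). Let $n\to\infty$. (i) If $s\leq t+r-1$, then $$\mathrm{ex}_r(n,K_s^{(r)},Q_1\cup\cdots\cup Q_k\cup S^r_{t_1}\cup\cdots\cup S^r_{t_p})=(1+o(1))\,\mathcal{N}(K_s^{(r)},S_{n,t}^r)=\binom{t}{s-r+1}\frac{n^{r-1}}{(r-1)!}+o(n^{r-1}).$$ (ii) If $s\geq t+r$, then $\mathrm{ex}_r(n,K_s^{(r)},Q_1\cup\cdots\cup Q_k\cup S^r_{t_1}\cup\cdots\cup S^r_{t_p})=o(n^{r-1})$.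
   Context: An $r$-graph is a hypergraph all of whose hyperedges have exactly $r$ vertices. $K_s^{(r)}$ is the complete $r$-graph on $s$ vertices. $P_\ell$, $C_\ell$, $S_\ell$ are the path, cycle and star with $\ell$ edges. For a graph $F$, the $r$-expansion $F^r$ is obtained from $F$ by adding $r-2$ new vertices to each edge, all new vertices distinct from each other and from $V(F)$. $\cup$ denotes vertex-disjoint union (when $p=0$ there are no star components). $S_{n,t}^r$ is the $n$-vertex $r$-graph whose hyperedges are all $r$-sets intersecting a fixed set of $t$ vertices. $\mathcal{N}(\mathcal{G}_1,\mathcal{G}_2)$ is the number of copies of $\mathcal{G}_1$ in $\mathcal{G}_2$. $\mathrm{ex}_r(n,\mathcal{H},\mathcal{F})$ is the maximum number of copies of $\mathcal{H}$ in an $n$-vertex $r$-graph containing no copy of $\mathcal{F}$. *)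

theory Defs
  imports Complex_Main "HOL-Library.Landau_Symbols"
begin

text \<open>A hypergraph is a pair (vertex set, set of hyperedges).\<close>

type_synonym 'a hypergraph = "'a set \<times> 'a set set"

abbreviation verts :: "'a hypergraph \<Rightarrow> 'a set" where
  "verts G \<equiv> fst G"

abbreviation hedges :: "'a hypergraph \<Rightarrow> 'a set set" where
  "hedges G \<equiv> snd G"

definition is_rgraph :: "nat \<Rightarrow> 'a hypergraph \<Rightarrow> bool" where
  "is_rgraph r G \<longleftrightarrow> finite (verts G) \<and> (\<forall>e\<in>hedges G. e \<subseteq> verts G \<and> card e = r)"

definition subhypergraph :: "'a hypergraph \<Rightarrow> 'a hypergraph \<Rightarrow> bool" where
  "subhypergraph G' G \<longleftrightarrow> verts G' \<subseteq> verts G \<and> hedges G' \<subseteq> hedges G"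

definition hg_isomorphic :: "'a hypergraph \<Rightarrow> 'b hypergraph \<Rightarrow> bool" where
  "hg_isomorphic H G \<longleftrightarrow>
     (\<exists>f. bij_betw f (verts H) (verts G) \<and> hedges G = (\<lambda>e. f ` e) ` hedges H)"

text \<open>Copies are unlabelled: they are subhypergraphs, not embeddings.\<close>

definition copies :: "'a hypergraph \<Rightarrow> 'b hypergraph \<Rightarrow> 'b hypergraph set" where
  "copies H G = {G'. subhypergraph G' G \<and> hg_isomorphic H G'}"

definition num_copies :: "'a hypergraph \<Rightarrow> 'b hypergraph \<Rightarrow> nat" where
  "num_copies H G = card (copies H G)"

definition hg_free :: "'a hypergraph \<Rightarrow> 'b hypergraph \<Rightarrow> bool" where
  "hg_free F G \<longleftrightarrow> copies F G = {}"

definition ex_counts :: "nat \<Rightarrow> nat \<Rightarrow> 'a hypergraph \<Rightarrow> 'b hypergraph \<Rightarrow> nat set" where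
  "ex_counts r n H F =
     {num_copies H G | G :: nat hypergraph. is_rgraph r G \<and> card (verts G) = n \<and> hg_free F G}"

text \<open>The host graphs have natural numbers as vertices, which loses nothing up to isomorphism.
  The maximum is taken over a finite set (lemma \<open>finite_ex_counts\<close>), which is nonempty
  as soon as \<open>F\<close> has a hyperedge (lemma \<open>ex_counts_nonempty\<close>).\<close>

definition ex_num :: "nat \<Rightarrow> nat \<Rightarrow> 'a hypergraph \<Rightarrow> 'b hypergraph \<Rightarrow> nat" where
  "ex_num r n H F = Max (ex_counts r n H F)"

definition complete_rgraph :: "nat \<Rightarrow> nat \<Rightarrow> nat hypergraph" where
  "complete_rgraph r s = ({..<s}, {e. e \<subseteq> {..<s} \<and> card e = r})"

text \<open>Paths, cycles and stars are parametrized by their number of edges.\<close>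

definition path_graph :: "nat \<Rightarrow> nat hypergraph" where
  "path_graph l = ({..l}, {{i, i + 1} | i. i < l})"

definition cycle_graph :: "nat \<Rightarrow> nat hypergraph" where
  "cycle_graph l = ({..<l}, {{i, (i + 1) mod l} | i. i < l})"

definition star_graph :: "nat \<Rightarrow> nat hypergraph" where
  "star_graph l = ({..l}, {{0, i} | i. 1 \<le> i \<and> i \<le> l})"

text \<open>The new vertices of the edge \<open>e\<close> are \<open>Inr (e, j)\<close> for \<open>j < r - 2\<close>.\<close>

definition expansion :: "nat \<Rightarrow> 'a hypergraph \<Rightarrow> ('a + 'a set \<times> nat) hypergraph" where
  "expansion r F =
     (Inl ` verts F \<union> Inr ` (hedges F \<times> {..<r - 2}),
      (\<lambda>e. Inl ` e \<union> Inr ` ({e} \<times> {..<r - 2})) ` hedges F)"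

text \<open>Vertex-disjoint union: the vertices of the \<open>i\<close>-th list entry are tagged with \<open>i\<close>.\<close>

definition disjoint_union :: "'a hypergraph list \<Rightarrow> (nat \<times> 'a) hypergraph" where
  "disjoint_union Hs =
     (\<Union>i<length Hs. Pair i ` verts (Hs ! i),
      \<Union>i<length Hs. (\<lambda>e. Pair i ` e) ` hedges (Hs ! i))"

text \<open>All \<open>r\<close>-subsets of an \<open>n\<close>-set meeting a fixed \<open>t\<close>-set; meaningful for \<open>t \<le> n\<close>.\<close>

definition S_graph :: "nat \<Rightarrow> nat \<Rightarrow> nat \<Rightarrow> nat hypergraph" where
  "S_graph r n t = ({..<n}, {e. e \<subseteq> {..<n} \<and> card e = r \<and> e \<inter> {..<t} \<noteq> {}})"

lemma finite_ex_counts: "finite (ex_counts r n H F)"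
proof (rule finite_subset)
  show "ex_counts r n H F \<subseteq> {..2 ^ n * 2 ^ 2 ^ n}"
  proof
    fix m assume "m \<in> ex_counts r n H F"
    then obtain G :: "nat hypergraph" where G: "is_rgraph r G" "card (verts G) = n"
      and m: "m = num_copies H G"
      unfolding ex_counts_def by blast
    have fin: "finite (verts G)" using G unfolding is_rgraph_def by blast
    have "copies H G \<subseteq> Pow (verts G) \<times> Pow (Pow (verts G))"
    proof
      fix x assume "x \<in> copies H G"
      then have "fst x \<subseteq> verts G" "snd x \<subseteq> hedges G"
        unfolding copies_def subhypergraph_def by auto
      moreover have "hedges G \<subseteq> Pow (verts G)" using G unfolding is_rgraph_def by blast
      ultimately show "x \<in> Pow (verts G) \<times> Pow (Pow (verts G))"
        by (cases x) auto
    qed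
    then have "card (copies H G) \<le> card (Pow (verts G) \<times> Pow (Pow (verts G)))"
      using fin by (intro card_mono) auto
    also have "\<dots> = 2 ^ n * 2 ^ 2 ^ n"
      using fin G by (simp add: card_cartesian_product card_Pow)
    finally show "m \<in> {..2 ^ n * 2 ^ 2 ^ n}" by (simp add: m num_copies_def)
  qed
qed simp

lemma ex_counts_nonempty:
  assumes "hedges F \<noteq> {}"
  shows "ex_counts r n H F \<noteq> {}"
proof -
  have "hg_free F (({..<n}, {}) :: nat hypergraph)"
    using assms unfolding hg_free_def copies_def subhypergraph_def hg_isomorphic_def by auto
  moreover have "is_rgraph r (({..<n}, {}) :: nat hypergraph)"
    unfolding is_rgraph_def by simp
  ultimately have "num_copies H (({..<n}, {}) :: nat hypergraph) \<in> ex_counts r n H F"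
    unfolding ex_counts_def
    by (intro CollectI exI[of _ "({..<n}, {}) :: nat hypergraph"]) simp
  then show ?thesis by blast
qed

end

theory Submission imports Defs "HOL-Library.FuncSet" begin

text \<open>
  Repeatedly discarding the \<open>s\<close>-cliques through an \<open>(r - 1)\<close>-set that lies in few of the remaining ones
  loses at most \<open>(t choose (s - r + 1)) * (n choose (r - 1))\<close> cliques, and the \<open>r\<close>-sets of the surviving
  cliques form an \<open>r\<close>-graph in which every \<open>(r - 1)\<close>-set contained in an edge has at least \<open>t + 1\<close>
  extensions. If few \<open>(r - 1)\<close>-sets survive, a second round with a large threshold either discards
  everything, so that few cliques survived, or gives an \<open>r\<close>-graph in which every such set has many
  extensions; there any expansion can be embedded greedily.

  If a positive proportion of the \<open>(r - 1)\<close>-sets survives, one finds a large complete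
  \<open>(r - 1)\<close>-partite system of them, a set \<open>C\<close> of vertices extending all of its members, and for each
  member \<open>T\<close> a list of \<open>q = t + 1 - card C\<close> further extensions such that disjoint members have disjoint
  lists. The forbidden hypergraph then embeds. Its cover number is \<open>t + 1\<close>, which settles \<open>q = 0\<close>; for
  \<open>q = 1\<close> the vertices in \<open>C\<close> cover everything except one edge or two disjoint edges; for \<open>q \<ge> 2\<close> a
  path or cycle needs at most one vertex from \<open>C\<close>, and when \<open>C\<close> is too small even for this, \<open>q\<close> is
  large and only odd cycles with \<open>r = 3\<close> are not immediate. The lower bound is the cover number again.
\<close>

section \<open>Sampling complete multipartite systems\<close>

text \<open>More than \<open>t choose (s - r + 1)\<close> cliques over an \<open>(r - 1)\<close>-set
  \<open>T\<close> force more than \<open>t\<close> extensions, because \<open>S - T\<close> is an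
  \<open>(s - r + 1)\<close>-set of extensions for each clique \<open>S\<close>; this is the origin
  of the leading coefficient. The obstacle is that \<open>t + 1\<close> is a constant, so edges
  cannot be completed greedily: the same few vertices may extend all \<open>(r - 1)\<close>-sets, as
  in \<open>S_graph\<close>, or the extensions may vary with the set. A block separates the two
  effects, constants against lists. Constants then play the vertices of a partial cover of a
  component, and distinct representatives of the lists complete the edges that are left. A path or
  cycle with \<open>l\<close> edges has cover number \<open>(l + 1) div 2\<close>, since a vertex
  lies in at most two edges; a star has cover number 1. For \<open>l \<ge> 5\<close> the former is
  at least 3, so \<open>t + 1 \<ge> 3 * k\<close>, and fewer than \<open>k\<close> constants leave
  lists of size \<open>q \<ge> 2 * k + 1\<close>. Odd cycles resist for \<open>r = 3\<close> because
  a block has only two classes, and a cycle whose vertices alternate between two classes is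
  even.\<close>

lemma power_mean:
  fixes f :: "'a \<Rightarrow> real"
  assumes "finite A" "\<And>x. x \<in> A \<Longrightarrow> 0 \<le> f x"
  shows "card A * (sum f A / card A) ^ k \<le> (\<Sum>x\<in>A. f x ^ k)"
proof -
  define a where "a = sum f A / card A"
  have a0: "a \<ge> 0" unfolding a_def using assms by (simp add: sum_nonneg)
  have pos: "0 \<le> (\<Sum>x\<in>A. f x ^ k)" using assms by (intro sum_nonneg) auto
  show ?thesis
  proof (cases "a = 0")
    case True
    then show ?thesis using pos unfolding a_def[symmetric] by (cases "k = 0") (auto simp: power_0_left)
  next
    case False
    then have a: "a > 0" using a0 by simp
    then have cA: "card A > 0" by (auto simp: a_def intro!: Nat.gr0I)
    \<comment> \<open>The left side is the tangent of the \<open>k\<close>-th power at the mean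
      \<open>a\<close>. Summed over \<open>A\<close>, its linear terms cancel.\<close>
    have "a ^ k * (1 + real k * (f x / a - 1)) \<le> f x ^ k" if "x \<in> A" for x
    proof -
      have "1 + real k * (f x / a - 1) \<le> (1 + (f x / a - 1)) ^ k"
        using assms(2)[OF that] a by (intro Bernoulli_inequality) auto
      also have "\<dots> = f x ^ k / a ^ k" by (simp add: power_divide)
      finally show ?thesis using a by (simp add: field_simps)
    qed
    then have "(\<Sum>x\<in>A. a ^ k * (1 + real k * (f x / a - 1))) \<le> (\<Sum>x\<in>A. f x ^ k)"
      by (rule sum_mono)
    also have "(\<Sum>x\<in>A. a ^ k * (1 + real k * (f x / a - 1)))
        = a ^ k * (card A + real k * (sum f A / a - card A))"
      by (simp add: sum_distrib_left[symmetric] sum.distrib sum_subtractf sum_divide_distrib)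
    also have "sum f A / a = card A" using a cA unfolding a_def by (auto simp: field_simps)
    finally show ?thesis unfolding a_def by (simp add: mult.commute)
  qed
qed

text \<open>Lists rather than functions, because the induction on \<open>d\<close> strips the first
  coordinate as a \<open>Cons\<close> and \<open>listset\<close> recurses in the same way.
  \<open>card_multipartite_maps\<close> translates the outcome to functions.\<close>

definition tuples :: "'a set \<Rightarrow> nat \<Rightarrow> 'a list set" where
  "tuples V d = {xs. set xs \<subseteq> V \<and> length xs = d}"

lemma finite_tuples: "finite V \<Longrightarrow> finite (tuples V d)"
  unfolding tuples_def by (rule finite_lists_length_eq)

lemma card_tuples: "finite V \<Longrightarrow> card (tuples V d) = card V ^ d"
  unfolding tuples_def by (rule card_lists_length_eq)

lemma tuples_0: "tuples V 0 = {[]}"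
  unfolding tuples_def by auto

lemma tuples_Suc: "tuples V (Suc d) = (\<lambda>(x, xs). x # xs) ` (V \<times> tuples V d)"
  unfolding tuples_def by (auto simp: length_Suc_conv image_iff)

lemma listset_tuples: "Y \<in> tuples (tuples V m) d \<Longrightarrow> listset (map set Y) \<subseteq> tuples V d"
proof (induction d arbitrary: Y)
  case 0
  then show ?case by (auto simp: tuples_0)
next
  case (Suc d)
  then obtain y Y' where Y: "Y = y # Y'" "y \<in> tuples V m" "Y' \<in> tuples (tuples V m) d"
    by (auto simp: tuples_Suc)
  then show ?case using Suc.IH[OF Y(3)]
    by (fastforce simp: set_Cons_def tuples_def)
qed

text \<open>The induction fixes the \<open>m\<close> choices in the first coordinate and applies the power mean
  inequality twice.\<close>

lemma card_complete_multipartite: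
  assumes "finite V" "V \<noteq> {}" "D \<subseteq> tuples V d"
  shows "real (card {Y \<in> tuples (tuples V m) d. listset (map set Y) \<subseteq> D})
    \<ge> real (card V) ^ (d * m) * (real (card D) / real (card V) ^ d) ^ (m ^ d)"
  using assms(3)
proof (induction d arbitrary: D)
  case 0
  then have "D = {} \<or> D = {[]}" by (auto simp: tuples_0)
  moreover have "{Y \<in> tuples (tuples V m) 0. listset (map set Y) \<subseteq> D} = (if D = {} then {} else {[]})"
    using 0 by (auto simp: tuples_0)
  ultimately show ?case by auto
next
  case (Suc d)
  let ?n = "real (card V)"
  have n: "?n > 0" using assms by (simp add: card_gt_0_iff)
  define Dy where "Dy y = {T \<in> tuples V d. \<forall>a\<in>set y. a # T \<in> D}" for y
  define N where "N T = {a \<in> V. a # T \<in> D}" for T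
  define H where "H D = {Y \<in> tuples (tuples V m) d. listset (map set Y) \<subseteq> D}" for D
  have ft: "finite (tuples V d)" "finite (tuples V m)" using assms finite_tuples by auto
  have fH: "finite (H D)" for D unfolding H_def using finite_tuples[OF ft(2)] by simp
  \<comment> \<open>Once the first row \<open>y\<close> is fixed, a problem of dimension
    \<open>d\<close> remains for \<open>Dy y\<close>, the tails that continue every entry of
    \<open>y\<close>.\<close>
  have eq: "{Y \<in> tuples (tuples V m) (Suc d). listset (map set Y) \<subseteq> D}
      = (\<lambda>(y, Y). y # Y) ` (SIGMA y:tuples V m. H (Dy y))" (is "?L = ?R")
  proof
    show "?L \<subseteq> ?R"
    proof
      fix Z assume Z: "Z \<in> ?L"
      then obtain y Y where yY: "Z = y # Y" "y \<in> tuples V m" "Y \<in> tuples (tuples V m) d"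
        by (auto simp: tuples_Suc)
      have "listset (map set Y) \<subseteq> Dy y"
        using Z listset_tuples[OF yY(3)] unfolding Dy_def yY(1) by (auto simp: set_Cons_def)
      then show "Z \<in> ?R" using yY by (auto simp: H_def image_iff)
    qed
    show "?R \<subseteq> ?L"
      by (auto simp: tuples_Suc H_def Dy_def set_Cons_def) blast
  qed
  have "card ?L = card (SIGMA y:tuples V m. H (Dy y))"
    unfolding eq by (rule card_image) (auto simp: inj_on_def)
  also have "\<dots> = (\<Sum>y\<in>tuples V m. card (H (Dy y)))"
    using ft fH by simp
  finally have c1: "real (card ?L) = (\<Sum>y\<in>tuples V m. real (card (H (Dy y))))" by simp
  have "(\<Sum>y\<in>tuples V m. ?n ^ (d * m) * (real (card (Dy y)) / ?n ^ d) ^ (m ^ d)) \<le> real (card ?L)"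
    unfolding c1 using Suc.IH unfolding H_def[symmetric]
    by (intro sum_mono) (auto simp: Dy_def)
  \<comment> \<open>First use of convexity, with exponent \<open>m ^ d\<close>: the induction
    hypothesis for the sets \<open>Dy y\<close> is averaged over \<open>y\<close>.\<close>
  then have m: "?n ^ (d * m) * (?n ^ m *
        ((\<Sum>y\<in>tuples V m. real (card (Dy y))) / ?n ^ d / ?n ^ m) ^ (m ^ d)) \<le> real (card ?L)"
  proof (rule order_trans[rotated])
    show "?n ^ (d * m) * (?n ^ m * ((\<Sum>y\<in>tuples V m. real (card (Dy y))) / ?n ^ d / ?n ^ m) ^ (m ^ d))
      \<le> (\<Sum>y\<in>tuples V m. ?n ^ (d * m) * (real (card (Dy y)) / ?n ^ d) ^ (m ^ d))"
      using power_mean[OF ft(2), of "\<lambda>y. real (card (Dy y)) / ?n ^ d" "m ^ d"]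
      unfolding sum_distrib_left[symmetric] card_tuples[OF assms(1)] of_nat_power sum_divide_distrib[symmetric]
      by (intro mult_left_mono) auto
  qed
  \<comment> \<open>Double counting of pairs of a row and a tail: the rows that fit a tail
    \<open>T\<close> are the words of length \<open>m\<close> over its admissible heads
    \<open>N T\<close>. The power that arises calls for convexity a second time, now over
    \<open>T\<close>.\<close>
  have e1: "(\<Sum>y\<in>tuples V m. card (Dy y)) = (\<Sum>T\<in>tuples V d. card (N T) ^ m)"
  proof -
    have "(\<Sum>y\<in>tuples V m. card (Dy y)) = card (SIGMA y:tuples V m. Dy y)"
      using ft by (simp add: Dy_def)
    also have "\<dots> = card (SIGMA T:tuples V d. tuples (N T) m)"
      by (rule bij_betw_same_card[of prod.swap])
        (auto simp: bij_betw_def inj_on_def Dy_def N_def tuples_def image_iff)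
    also have "\<dots> = (\<Sum>T\<in>tuples V d. card (N T) ^ m)"
    proof -
      have "finite (N T)" for T unfolding N_def using assms by simp
      then show ?thesis using ft by (simp add: card_tuples finite_tuples)
    qed
    finally show ?thesis .
  qed
  have e2: "(\<Sum>T\<in>tuples V d. real (card (N T)) ^ m) \<ge> ?n ^ d * (real (card D) / ?n ^ d) ^ m"
  proof -
    have "card (SIGMA T:tuples V d. N T) = card D"
    proof -
      have "(\<lambda>(T, a). a # T) ` (SIGMA T:tuples V d. N T) = D"
        using Suc.prems by (fastforce simp: N_def tuples_Suc image_iff)
      moreover have "inj_on (\<lambda>(T, a). a # T) (SIGMA T:tuples V d. N T)" by (auto simp: inj_on_def)
      ultimately show ?thesis using card_image by metis
    qed
    then have "(\<Sum>T\<in>tuples V d. card (N T)) = card D" using ft assms by (simp add: N_def)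
    then have "(\<Sum>T\<in>tuples V d. real (card (N T))) = real (card D)"
      by (metis of_nat_sum)
    then show ?thesis using power_mean[of "tuples V d" "\<lambda>T. real (card (N T))" m] ft
      by (simp add: card_tuples assms)
  qed
  have s: "(\<Sum>y\<in>tuples V m. real (card (Dy y))) \<ge> ?n ^ d * (real (card D) / ?n ^ d) ^ m"
    using e2 arg_cong[OF e1, of real] by simp
  have "(real (card D) / ?n ^ Suc d) ^ (m ^ Suc d) = ((real (card D) / ?n ^ d / ?n) ^ m) ^ (m ^ d)"
    by (simp add: power_mult mult.commute)
  also have "(real (card D) / ?n ^ d / ?n) ^ m = (?n ^ d * (real (card D) / ?n ^ d) ^ m) / ?n ^ d / ?n ^ m"
    using n by (simp add: power_divide power_mult_distrib)
  finally have "?n ^ (Suc d * m) * (real (card D) / ?n ^ Suc d) ^ (m ^ Suc d)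
      = ?n ^ (d * m) * (?n ^ m * ((?n ^ d * (real (card D) / ?n ^ d) ^ m) / ?n ^ d / ?n ^ m) ^ (m ^ d))"
    by (simp add: power_add)
  also have "\<dots> \<le> ?n ^ (d * m) * (?n ^ m *
        ((\<Sum>y\<in>tuples V m. real (card (Dy y))) / ?n ^ d / ?n ^ m) ^ (m ^ d))"
    using s n by (intro mult_left_mono power_mono divide_right_mono) auto
  finally show ?case using m by linarith
qed

text \<open>A union bound by conditioning on the coordinates outside \<open>J\<close>. Both kinds of
  bad maps in \<open>block_sampling\<close> are estimated with it, \<open>J\<close> being a single
  cell or a whole transversal.\<close>

lemma card_fiber_bound:
  assumes "finite I" "J \<subseteq> I" "finite V" "Bad \<subseteq> I \<rightarrow>\<^sub>E V"
    and "\<And>\<psi>. real (card ((\<lambda>\<phi>. restrict \<phi> J) ` {\<phi> \<in> Bad. restrict \<phi> (I - J) = \<psi>})) \<le> b"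
  shows "real (card Bad) \<le> b * real (card V) ^ card (I - J)"
proof -
  let ?F = "\<lambda>\<psi>. (\<lambda>\<phi>. restrict \<phi> J) ` {\<phi> \<in> Bad. restrict \<phi> (I - J) = \<psi>}"
  let ?S = "SIGMA \<psi>:(I - J) \<rightarrow>\<^sub>E V. ?F \<psi>"
  have fB: "finite Bad" using assms by (meson finite_PiE finite_subset)
  have fS: "finite ?S" using assms fB by (intro finite_SigmaI finite_PiE) auto
  have inj: "inj_on (\<lambda>\<phi>. (restrict \<phi> (I - J), restrict \<phi> J)) Bad"
  proof (rule inj_onI)
    fix f g assume "f \<in> Bad" "g \<in> Bad"
      and eq: "(restrict f (I - J), restrict f J) = (restrict g (I - J), restrict g J)"
    then have ex: "f \<in> I \<rightarrow>\<^sub>E V" "g \<in> I \<rightarrow>\<^sub>E V" using assms by auto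
    show "f = g"
    proof (rule PiE_ext[OF ex])
      fix x assume "x \<in> I"
      then show "f x = g x" using eq by (metis DiffI prod.inject restrict_apply')
    qed
  qed
  have sub: "(\<lambda>\<phi>. (restrict \<phi> (I - J), restrict \<phi> J)) ` Bad \<subseteq> ?S"
    using assms(4) by (auto simp: PiE_iff extensional_def split: if_splits)
  have "card Bad \<le> card ?S" by (rule card_inj_on_le[OF inj sub fS])
  also have "\<dots> = (\<Sum>\<psi>\<in>(I - J) \<rightarrow>\<^sub>E V. card (?F \<psi>))"
    using assms fB by (intro card_SigmaI finite_PiE) auto
  finally have "real (card Bad) \<le> (\<Sum>\<psi>\<in>(I - J) \<rightarrow>\<^sub>E V. real (card (?F \<psi>)))"
    unfolding of_nat_sum[symmetric] of_nat_le_iff .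
  also have "\<dots> \<le> (\<Sum>\<psi>\<in>(I - J) \<rightarrow>\<^sub>E V. b)" by (intro sum_mono assms(5))
  also have "\<dots> = b * real (card V) ^ card (I - J)"
    using assms by (simp add: card_PiE)
  finally show ?thesis .
qed

lemma listset_nth: "length xs = length As \<Longrightarrow> (\<And>i. i < length As \<Longrightarrow> xs ! i \<in> As ! i) \<Longrightarrow> xs \<in> listset As"
proof (induction As arbitrary: xs)
  case (Cons A As)
  then obtain x ys where xs: "xs = x # ys" by (cases xs) auto
  have "x \<in> A" using Cons.prems(2)[of 0] xs by simp
  moreover have "ys \<in> listset As"
    using Cons.prems(1) Cons.prems(2)[of "Suc i" for i] xs by (intro Cons.IH) auto
  ultimately show ?case using xs by (auto simp: set_Cons_def)
qed simp

text \<open>The list count in a form in which single cells can be fixed and varied, as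
  \<open>card_fiber_bound\<close> requires.\<close>

lemma card_multipartite_maps:
  assumes V: "finite V" "V \<noteq> {}" and D: "D \<subseteq> {..<d} \<rightarrow>\<^sub>E V"
    and I: "I = {..<d} \<times> {..<m}"
  shows "real (card {\<phi> \<in> I \<rightarrow>\<^sub>E V. \<forall>g\<in>{..<d} \<rightarrow>\<^sub>E {..<m}. (\<lambda>i\<in>{..<d}. \<phi> (i, g i)) \<in> D})
    \<ge> real (card V) ^ (d * m) * (real (card D) / real (card V) ^ d) ^ (m ^ d)" (is "real (card ?A) \<ge> _")
proof -
  define Dl where "Dl = {xs \<in> tuples V d. (\<lambda>i\<in>{..<d}. xs ! i) \<in> D}"
  define Y0 where "Y0 = {Y \<in> tuples (tuples V m) d. listset (map set Y) \<subseteq> Dl}"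
  have len: "length Y = d" "\<And>i. i < d \<Longrightarrow> length (Y ! i) = m" "\<And>i. i < d \<Longrightarrow> set (Y ! i) \<subseteq> V"
    if "Y \<in> Y0" for Y
  proof -
    have *: "length Y = d" "set Y \<subseteq> tuples V m" using that unfolding Y0_def tuples_def[of _ d] by auto
    then have "Y ! i \<in> tuples V m" if "i < d" for i using that nth_mem by blast
    then show "length Y = d" "\<And>i. i < d \<Longrightarrow> length (Y ! i) = m" "\<And>i. i < d \<Longrightarrow> set (Y ! i) \<subseteq> V"
      using * unfolding tuples_def by auto
  qed
  have fA: "finite ?A"
    using finite_PiE[of I "\<lambda>_. V"] V unfolding I by simp
  have "card D \<le> card Dl"
  proof (rule card_inj_on_le[of "\<lambda>f. map f [0..<d]"])
    show "inj_on (\<lambda>f. map f [0..<d]) D"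
    proof (rule inj_onI)
      fix f g assume fg: "f \<in> D" "g \<in> D" "map f [0..<d] = map g [0..<d]"
      then have "f \<in> {..<d} \<rightarrow>\<^sub>E V" "g \<in> {..<d} \<rightarrow>\<^sub>E V" using D by auto
      then show "f = g" using fg(3) by (intro PiE_ext) auto
    qed
    show "(\<lambda>f. map f [0..<d]) ` D \<subseteq> Dl"
    proof
      fix xs assume "xs \<in> (\<lambda>f. map f [0..<d]) ` D"
      then obtain f where f: "f \<in> D" "xs = map f [0..<d]" by blast
      have fE: "f \<in> {..<d} \<rightarrow>\<^sub>E V" using f D by auto
      have eq: "(\<lambda>i\<in>{..<d}. xs ! i) = f" unfolding f(2) by (rule ext) (simp add: restrict_def PiE_arb[OF fE])
      have "xs \<in> tuples V d" unfolding tuples_def f(2) using PiE_mem[OF fE] by auto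
      then show "xs \<in> Dl" unfolding Dl_def using eq f(1) by simp
    qed
    show "finite Dl" unfolding Dl_def using finite_tuples[OF V(1)] by simp
  qed
  then have "real (card V) ^ (d * m) * (real (card D) / real (card V) ^ d) ^ (m ^ d)
    \<le> real (card V) ^ (d * m) * (real (card Dl) / real (card V) ^ d) ^ (m ^ d)"
    by (intro mult_left_mono power_mono divide_right_mono) auto
  also have "\<dots> \<le> real (card Y0)"
    unfolding Y0_def by (rule card_complete_multipartite[OF V]) (auto simp: Dl_def)
  also have "card Y0 \<le> card ?A"
  proof (rule card_inj_on_le[of "\<lambda>Y. \<lambda>(i, a)\<in>I. Y ! i ! a"])
    show "inj_on (\<lambda>Y. \<lambda>(i, a)\<in>I. Y ! i ! a) Y0"
    proof (rule inj_onI)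
      fix Y Z assume YZ: "Y \<in> Y0" "Z \<in> Y0" and eq: "(\<lambda>(i, a)\<in>I. Y ! i ! a) = (\<lambda>(i, a)\<in>I. Z ! i ! a)"
      note l = len[OF YZ(1)] len[OF YZ(2)]
      show "Y = Z"
      proof (rule nth_equalityI)
        fix i assume i: "i < length Y"
        show "Y ! i = Z ! i"
        proof (rule nth_equalityI)
          fix a assume a: "a < length (Y ! i)"
          show "Y ! i ! a = Z ! i ! a" using fun_cong[OF eq, of "(i, a)"] i a l by (auto simp: I)
        qed (use l i in auto)
      qed (use l in auto)
    qed
    show "(\<lambda>Y. \<lambda>(i, a)\<in>I. Y ! i ! a) ` Y0 \<subseteq> ?A"
    proof (rule image_subsetI)
      fix Y assume Y: "Y \<in> Y0"
      note l = len[OF Y]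
      have 1: "(\<lambda>i\<in>{..<d}. (\<lambda>(i, a)\<in>I. Y ! i ! a) (i, g i)) \<in> D" if g: "g \<in> {..<d} \<rightarrow>\<^sub>E {..<m}" for g
      proof -
        have "map (\<lambda>i. Y ! i ! g i) [0..<d] \<in> listset (map set Y)"
          using l g by (intro listset_nth) (auto simp: PiE_iff Pi_iff)
        then have "(\<lambda>i\<in>{..<d}. map (\<lambda>i. Y ! i ! g i) [0..<d] ! i) \<in> D"
          using Y unfolding Y0_def Dl_def by auto
        moreover have "(\<lambda>i\<in>{..<d}. map (\<lambda>i. Y ! i ! g i) [0..<d] ! i) = (\<lambda>i\<in>{..<d}. (\<lambda>(i, a)\<in>I. Y ! i ! a) (i, g i))"
          using g by (intro restrict_ext) (auto simp: I PiE_iff)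
        ultimately show ?thesis by simp
      qed
      have 2: "(\<lambda>(i, a)\<in>I. Y ! i ! a) \<in> I \<rightarrow>\<^sub>E V"
      proof (rule PiE_I)
        fix p assume p: "p \<in> I"
        then have "Y ! fst p ! snd p \<in> set (Y ! fst p)" using l by (intro nth_mem) (auto simp: I)
        then show "(\<lambda>(i, a)\<in>I. Y ! i ! a) p \<in> V" using l(3)[of "fst p"] p by (auto simp: I)
      qed (simp add: restrict_def)
      show "(\<lambda>(i, a)\<in>I. Y ! i ! a) \<in> ?A" by (intro CollectI conjI ballI 1 2)
    qed
  qed (rule fA)
  finally show ?thesis by simp
qed


text \<open>A first-moment argument written as counting. With \<open>n = card V\<close>, at least
  \<open>c * n ^ (d * m)\<close> maps have all transversals in \<open>D\<close>. A collision at a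
  cell costs a factor \<open>n\<close> and is negligible. Meeting lists of disjoint transversals
  cost only a factor \<open>\<eta>\<close>, which is why no vertex may occur in the lists of more
  than \<open>\<eta> * n ^ d\<close> members of \<open>D\<close>.\<close>

lemma block_sampling:
  fixes \<delta> :: real and d m t :: nat
  assumes \<delta>: "\<delta> > 0" and d: "d \<ge> 1" and m: "m \<ge> 1"
  shows "\<exists>\<eta>>0. \<exists>n0. \<forall>(V :: 'a set) D (L :: 'a set \<Rightarrow> 'a set) (C :: 'a set). finite V \<longrightarrow> card V \<ge> n0 \<longrightarrow> D \<subseteq> {..<d} \<rightarrow>\<^sub>E V \<longrightarrow>
     real (card D) \<ge> \<delta> * real (card V) ^ d \<longrightarrow>
     (\<forall>f\<in>D. finite (L (f ` {..<d})) \<and> card (L (f ` {..<d})) \<le> t + 1 \<and> L (f ` {..<d}) \<inter> f ` {..<d} = {}) \<longrightarrow>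
     finite C \<longrightarrow> card C \<le> t + 1 \<longrightarrow>
     (\<forall>z. real (card {f \<in> D. z \<in> L (f ` {..<d})}) \<le> \<eta> * real (card V) ^ d) \<longrightarrow>
     (\<exists>\<phi>. inj_on \<phi> ({..<d} \<times> {..<m}) \<and> \<phi> ` ({..<d} \<times> {..<m}) \<inter> C = {} \<and>
       (\<forall>g\<in>{..<d} \<rightarrow>\<^sub>E {..<m}. (\<lambda>i\<in>{..<d}. \<phi> (i, g i)) \<in> D \<and>
          \<phi> ` ({..<d} \<times> {..<m}) \<inter> L ((\<lambda>i. \<phi> (i, g i)) ` {..<d}) = {}) \<and>
       (\<forall>g\<in>{..<d} \<rightarrow>\<^sub>E {..<m}. \<forall>h\<in>{..<d} \<rightarrow>\<^sub>E {..<m}. (\<forall>i<d. g i \<noteq> h i) \<longrightarrow>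
          L ((\<lambda>i. \<phi> (i, g i)) ` {..<d}) \<inter> L ((\<lambda>i. \<phi> (i, h i)) ` {..<d}) = {}))"
proof -
  define I where "I = {..<d} \<times> {..<m}"
  define G where "G = {..<d} \<rightarrow>\<^sub>E {..<m}"
  define c where "c = \<delta> ^ (m ^ d)"
  \<comment> \<open>\<open>K1\<close> bounds the forbidden values of one cell: constants, values of
    other cells, and lists of transversals avoiding the cell. \<open>K2\<close> bounds the number of
    pairs of transversals. \<open>\<eta>\<close> and \<open>n0\<close> are chosen so that each kind
    of bad map takes at most a quarter of the available maps.\<close>
  define K1 where "K1 = real ((t + 1) + card I + card G * (t + 1))"
  define K2 where "K2 = real (card G * card G)"
  define \<eta> where "\<eta> = c / (4 * (K2 + 1) * (real t + 1))"
  define n0 where "n0 = nat \<lceil>4 * (real (card I) * K1) / c\<rceil> + 1"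
  have c: "c > 0" unfolding c_def using \<delta> by simp
  have K: "K1 \<ge> 0" "K2 \<ge> 0" unfolding K1_def K2_def by auto
  have \<eta>: "\<eta> > 0" unfolding \<eta>_def using c K by simp
  have fI: "finite I" "finite G" unfolding I_def G_def by (auto intro: finite_PiE)
  have cI: "card I = d * m" unfolding I_def by simp
  have gI: "(i, g i) \<in> I" if "g \<in> G" "i < d" for g i using that unfolding I_def G_def by (auto simp: PiE_iff)
  show ?thesis
  proof (rule exI[of _ \<eta>], intro conjI \<eta>, rule exI[of _ n0], intro allI impI)
    fix V :: "'a set" and D and L :: "'a set \<Rightarrow> 'a set" and C :: "'a set"
    assume V: "finite V" "card V \<ge> n0" and D: "D \<subseteq> {..<d} \<rightarrow>\<^sub>E V"
      and cD: "real (card D) \<ge> \<delta> * real (card V) ^ d"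
      and L: "\<forall>f\<in>D. finite (L (f ` {..<d})) \<and> card (L (f ` {..<d})) \<le> t + 1 \<and> L (f ` {..<d}) \<inter> f ` {..<d} = {}"
      and C: "finite C" "card C \<le> t + 1"
      and spread: "\<forall>z. real (card {f \<in> D. z \<in> L (f ` {..<d})}) \<le> \<eta> * real (card V) ^ d"
    let ?n = "real (card V)"
    have n1: "card V \<ge> 1" using V unfolding n0_def by simp
    then have Vne: "V \<noteq> {}" by auto
    have n: "?n > 4 * (real (card I) * K1) / c" using V unfolding n0_def by linarith
    define T where "T \<phi> g = (\<lambda>i. \<phi> (i, g i)) ` {..<d}" for \<phi> :: "nat \<times> nat \<Rightarrow> 'a" and g
    define A where "A = {\<phi> \<in> I \<rightarrow>\<^sub>E V. \<forall>g\<in>G. (\<lambda>i\<in>{..<d}. \<phi> (i, g i)) \<in> D}"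
    have TD: "(\<lambda>i\<in>{..<d}. \<phi> (i, g i)) ` {..<d} = T \<phi> g" for \<phi> g unfolding T_def by auto
    have fA: "finite A" unfolding A_def using finite_PiE[of I "\<lambda>_. V"] fI V by simp
    have LT: "finite (L (T \<phi> g))" "card (L (T \<phi> g)) \<le> t + 1" "L (T \<phi> g) \<inter> T \<phi> g = {}"
      if "\<phi> \<in> A" "g \<in> G" for \<phi> g
      using L that TD[of \<phi> g] unfolding A_def by (metis (no_types, lifting) mem_Collect_eq)+
    have cA: "real (card A) \<ge> ?n ^ card I * c"
    proof -
      have "real (card A) \<ge> ?n ^ (d * m) * (real (card D) / ?n ^ d) ^ (m ^ d)"
        unfolding A_def G_def using card_multipartite_maps[OF V(1) Vne D I_def] .
      moreover have "(real (card D) / ?n ^ d) ^ (m ^ d) \<ge> c"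
        unfolding c_def using cD \<delta> n1 by (intro power_mono) (auto simp: field_simps)
      ultimately show ?thesis unfolding cI using mult_left_mono[of c _ "?n ^ (d * m)"]
        by (smt (verit) zero_le_power of_nat_0_le_iff)
    qed
    \<comment> \<open>Only transversals avoiding \<open>p\<close> are considered, as their lists
      stay fixed while the value at \<open>p\<close> varies. Those through \<open>p\<close> cause no
      collision: a list is disjoint from its own transversal by hypothesis.\<close>
    define B1 where "B1 p = {\<phi> \<in> A. \<phi> p \<in> C \<union> \<phi> ` (I - {p}) \<union> (\<Union>g\<in>{g\<in>G. (fst p, g (fst p)) \<noteq> p}. L (T \<phi> g))}" for p
    define B2 where "B2 gh = {\<phi> \<in> A. L (T \<phi> (fst gh)) \<inter> L (T \<phi> (snd gh)) \<noteq> {}}" for gh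
    define GG where "GG = {gh \<in> G \<times> G. \<forall>i<d. fst gh i \<noteq> snd gh i}"
    have AI: "A \<subseteq> I \<rightarrow>\<^sub>E V" unfolding A_def by auto
    have b1: "real (card (B1 p)) \<le> K1 * ?n ^ (card I - 1)" if p: "p \<in> I" for p
    proof -
      have "real (card (B1 p)) \<le> K1 * ?n ^ card (I - {p})"
      proof (rule card_fiber_bound[OF fI(1) _ V(1)])
        show "{p} \<subseteq> I" using p by simp
        show "B1 p \<subseteq> I \<rightarrow>\<^sub>E V" unfolding B1_def using AI by auto
        fix \<psi>
        let ?S = "{\<phi> \<in> B1 p. restrict \<phi> (I - {p}) = \<psi>}"
        show "real (card ((\<lambda>\<phi>. restrict \<phi> {p}) ` ?S)) \<le> K1"
        proof (cases "?S = {}")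
          case True
          show ?thesis unfolding True using K by simp
        next
          case False
          then obtain \<phi>0 where \<phi>0: "\<phi>0 \<in> ?S" by blast
          have ag: "\<phi> x = \<phi>0 x" if "\<phi> \<in> ?S" "x \<in> I - {p}" for \<phi> x
          proof -
            have "restrict \<phi> (I - {p}) x = restrict \<phi>0 (I - {p}) x" using that(1) \<phi>0 by simp
            then show ?thesis using that(2) by simp
          qed
          define G' where "G' = {g\<in>G. (fst p, g (fst p)) \<noteq> p}"
          define X where "X = C \<union> \<phi>0 ` (I - {p}) \<union> (\<Union>g\<in>G'. L (T \<phi>0 g))"
          have \<phi>0A: "\<phi>0 \<in> A" using \<phi>0 unfolding B1_def by auto
          have G'G: "G' \<subseteq> G" "finite G'" unfolding G'_def using fI by auto
          have "(\<lambda>\<phi>. restrict \<phi> {p}) ` ?S \<subseteq> (\<lambda>x. \<lambda>q\<in>{p}. x) ` X"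
          proof (rule image_subsetI)
            fix \<phi> assume \<phi>: "\<phi> \<in> ?S"
            have "T \<phi> g = T \<phi>0 g" if g: "g \<in> G'" for g
            proof -
              have "(i, g i) \<in> I - {p}" if "i < d" for i
                using gI[of g i] g that unfolding G'_def by auto
              then show ?thesis unfolding T_def using ag[OF \<phi>] by (intro image_cong) auto
            qed
            moreover have "\<phi> ` (I - {p}) = \<phi>0 ` (I - {p})" using ag[OF \<phi>] by (intro image_cong) auto
            ultimately have "\<phi> p \<in> X" using \<phi> unfolding B1_def X_def G'_def by auto
            then show "restrict \<phi> {p} \<in> (\<lambda>x. \<lambda>q\<in>{p}. x) ` X"
              by (intro image_eqI[of _ _ "\<phi> p"]) (auto simp: restrict_def)
          qed
          moreover have fX: "finite X" unfolding X_def using C fI G'G LT[OF \<phi>0A] by blast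
          ultimately have "card ((\<lambda>\<phi>. restrict \<phi> {p}) ` ?S) \<le> card ((\<lambda>x. \<lambda>q\<in>{p}. x) ` X)"
            by (intro card_mono finite_imageI)
          also have "\<dots> \<le> card X" using fX by (rule card_image_le)
          also have "\<dots> \<le> (card C + card (\<phi>0 ` (I - {p}))) + card (\<Union>g\<in>G'. L (T \<phi>0 g))"
            unfolding X_def by (meson add_le_mono1 card_Un_le order_trans)
          also have "card (\<phi>0 ` (I - {p})) \<le> card I"
            using fI card_image_le[of "I - {p}" \<phi>0] card_mono[of I "I - {p}"] by (meson Diff_subset finite_Diff order_trans)
          also have "card (\<Union>g\<in>G'. L (T \<phi>0 g)) \<le> (\<Sum>g\<in>G'. card (L (T \<phi>0 g)))"
            using G'G by (intro card_UN_le)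
          also have "\<dots> \<le> card G' * (t + 1)"
            using LT(2)[OF \<phi>0A] G'G(1) sum_bounded_above[of G' "\<lambda>g. card (L (T \<phi>0 g))" "t + 1"] by (simp add: subset_iff)
          also have "\<dots> \<le> card G * (t + 1)" using card_mono[OF fI(2) G'G(1)] by (rule mult_right_mono) simp
          finally show ?thesis unfolding K1_def using C(2) by linarith
        qed
      qed
      then show ?thesis using p fI by (simp add: card_Diff_singleton)
    qed
    \<comment> \<open>All cells off the transversal \<open>h\<close> are fixed, among them those of
      \<open>g\<close>, since the two differ in every class. So the list of \<open>g\<close> is a
      fixed set of at most \<open>t + 1\<close> vertices, each of which lies in few lists.\<close>
    have b2: "real (card (B2 gh)) \<le> (real t + 1) * \<eta> * ?n ^ card I" if gh: "gh \<in> GG" for gh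
    proof -
      obtain g h where gh': "gh = (g, h)" "g \<in> G" "h \<in> G" "\<And>i. i < d \<Longrightarrow> g i \<noteq> h i"
        using gh unfolding GG_def by auto
      define J where "J = (\<lambda>i. (i, h i)) ` {..<d}"
      have J: "J \<subseteq> I" "card J = d" unfolding J_def using gI gh' by (auto simp: card_image inj_on_def)
      have fJ: "finite J" unfolding J_def by simp
      have "real (card (B2 gh)) \<le> ((real t + 1) * (\<eta> * ?n ^ d)) * ?n ^ card (I - J)"
      proof (rule card_fiber_bound[OF fI(1) J(1) V(1)])
        show "B2 gh \<subseteq> I \<rightarrow>\<^sub>E V" unfolding B2_def using AI by auto
        fix \<psi>
        let ?S = "{\<phi> \<in> B2 gh. restrict \<phi> (I - J) = \<psi>}"
        show "real (card ((\<lambda>\<phi>. restrict \<phi> J) ` ?S)) \<le> (real t + 1) * (\<eta> * ?n ^ d)"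
        proof (cases "?S = {}")
          case True
          show ?thesis unfolding True using \<eta> by simp
        next
          case False
          then obtain \<phi>0 where \<phi>0: "\<phi>0 \<in> ?S" by blast
          have ag: "\<phi> x = \<phi>0 x" if "\<phi> \<in> ?S" "x \<in> I - J" for \<phi> x
          proof -
            have "restrict \<phi> (I - J) x = restrict \<phi>0 (I - J) x" using that(1) \<phi>0 by simp
            then show ?thesis using that(2) by simp
          qed
          have \<phi>0A: "\<phi>0 \<in> A" using \<phi>0 unfolding B2_def by auto
          define X where "X = (\<Union>z\<in>L (T \<phi>0 g). {f \<in> D. z \<in> L (f ` {..<d})})"
          have fD: "finite D" using D V finite_PiE[of "{..<d}" "\<lambda>_. V"] finite_subset by blast
          have fX: "finite X" unfolding X_def using fD LT[OF \<phi>0A gh'(2)] by simp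
          have "(\<lambda>\<phi>. restrict \<phi> J) ` ?S \<subseteq> (\<lambda>f. \<lambda>q\<in>J. f (fst q)) ` X"
          proof (rule image_subsetI)
            fix \<phi> assume \<phi>: "\<phi> \<in> ?S"
            then have \<phi>A: "\<phi> \<in> A" unfolding B2_def by auto
            have "(i, g i) \<in> I - J" if "i < d" for i
              using gI[of g i] gh' that unfolding J_def by auto
            then have "T \<phi> g = T \<phi>0 g" unfolding T_def using ag[OF \<phi>] by (intro image_cong) auto
            moreover have "L (T \<phi> g) \<inter> L (T \<phi> h) \<noteq> {}" using \<phi> unfolding B2_def gh' by auto
            ultimately obtain z where z: "z \<in> L (T \<phi>0 g)" "z \<in> L (T \<phi> h)" by auto
            have "(\<lambda>i\<in>{..<d}. \<phi> (i, h i)) \<in> D" using \<phi>A gh'(3) unfolding A_def by blast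
            then have 1: "(\<lambda>i\<in>{..<d}. \<phi> (i, h i)) \<in> X" unfolding X_def using z TD[of \<phi> h] by auto
            have 2: "restrict \<phi> J = (\<lambda>q\<in>J. (\<lambda>i\<in>{..<d}. \<phi> (i, h i)) (fst q))"
              unfolding J_def by (intro restrict_ext) auto
            show "restrict \<phi> J \<in> (\<lambda>f. \<lambda>q\<in>J. f (fst q)) ` X"
              using imageI[OF 1, of "\<lambda>f. \<lambda>q\<in>J. f (fst q)"] by (simp only: 2)
          qed
          then have "card ((\<lambda>\<phi>. restrict \<phi> J) ` ?S) \<le> card ((\<lambda>f. \<lambda>q\<in>J. f (fst q)) ` X)"
            using fX by (intro card_mono finite_imageI)
          also have "\<dots> \<le> card X" using fX by (rule card_image_le)
          also have "\<dots> \<le> (\<Sum>z\<in>L (T \<phi>0 g). card {f \<in> D. z \<in> L (f ` {..<d})})"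
            unfolding X_def using LT[OF \<phi>0A gh'(2)] by (intro card_UN_le) auto
          finally have "real (card ((\<lambda>\<phi>. restrict \<phi> J) ` ?S)) \<le> (\<Sum>z\<in>L (T \<phi>0 g). real (card {f \<in> D. z \<in> L (f ` {..<d})}))"
            unfolding of_nat_sum[symmetric] of_nat_le_iff .
          also have "\<dots> \<le> real (card (L (T \<phi>0 g))) * (\<eta> * ?n ^ d)"
            using spread by (intro sum_bounded_above) auto
          also have "\<dots> \<le> (real t + 1) * (\<eta> * ?n ^ d)"
            using LT(2)[OF \<phi>0A gh'(2)] \<eta> by (intro mult_right_mono) auto
          finally show ?thesis .
        qed
      qed
      also have "\<dots> = (real t + 1) * \<eta> * (?n ^ d * ?n ^ card (I - J))" by simp
      also have "?n ^ d * ?n ^ card (I - J) = ?n ^ card I"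
      proof -
        have "card (I - J) = card I - d" using J fJ by (simp add: card_Diff_subset)
        moreover have "d \<le> card I" using J fI card_mono by metis
        ultimately show ?thesis by (simp flip: power_add)
      qed
      finally show ?thesis .
    qed
    define Bad where "Bad = (\<Union>p\<in>I. B1 p) \<union> (\<Union>gh\<in>GG. B2 gh)"
    have fGG: "finite GG" unfolding GG_def using fI by auto
    have cGG: "real (card GG) \<le> K2"
      unfolding K2_def GG_def using fI card_mono[of "G \<times> G" "{gh \<in> G \<times> G. \<forall>i<d. fst gh i \<noteq> snd gh i}"]
      by (auto simp: card_cartesian_product simp flip: of_nat_mult)
    have cIpos: "card I \<ge> 1" unfolding cI using d m by (simp add: Suc_leI)
    have "card Bad \<le> card (\<Union>p\<in>I. B1 p) + card (\<Union>gh\<in>GG. B2 gh)" unfolding Bad_def by (rule card_Un_le)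
    also have "\<dots> \<le> (\<Sum>p\<in>I. card (B1 p)) + (\<Sum>gh\<in>GG. card (B2 gh))"
      using fI fGG by (intro add_mono card_UN_le) auto
    finally have "real (card Bad) \<le> (\<Sum>p\<in>I. real (card (B1 p))) + (\<Sum>gh\<in>GG. real (card (B2 gh)))"
      unfolding of_nat_sum[symmetric] of_nat_add[symmetric] of_nat_le_iff .
    also have "\<dots> \<le> real (card I) * (K1 * ?n ^ (card I - 1)) + real (card GG) * ((real t + 1) * \<eta> * ?n ^ card I)"
      using b1 b2 by (intro add_mono sum_bounded_above) auto
    also have "\<dots> < ?n ^ card I * c"
    proof -
      have "real (card I) * (K1 * ?n ^ (card I - 1)) = (real (card I) * K1) * ?n ^ (card I - 1)" by simp
      also have "\<dots> \<le> (c / 4 * ?n) * ?n ^ (card I - 1)"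
        using n c by (intro mult_right_mono) (auto simp: field_simps)
      also have "\<dots> = (?n ^ card I * c) / 4" 
      proof -
        have "(c / 4 * ?n) * ?n ^ (card I - 1) = (?n ^ (card I - 1) * ?n) * c / 4" by simp
        moreover have "?n ^ (card I - 1) * ?n = ?n ^ card I" using cIpos by (intro power_minus_mult) simp
        ultimately show ?thesis by (simp only:)
      qed
      finally have 1: "real (card I) * (K1 * ?n ^ (card I - 1)) \<le> (?n ^ card I * c) / 4" .
      have "real (card GG) * ((real t + 1) * \<eta>) \<le> (K2 + 1) * ((real t + 1) * \<eta>)"
        using cGG \<eta> by (intro mult_right_mono) auto
      also have "\<dots> = c / 4"
      proof -
        have "K2 + 1 \<noteq> 0" "real t + 1 \<noteq> 0" using K by linarith+
        moreover have "x * (y * (c / (4 * x * y))) = c / 4" if "x \<noteq> 0" "y \<noteq> 0" for x y :: real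
          using that by (simp add: field_simps)
        ultimately show ?thesis unfolding \<eta>_def by blast
      qed
      finally have "real (card GG) * ((real t + 1) * \<eta>) * ?n ^ card I \<le> c / 4 * ?n ^ card I"
        by (rule mult_right_mono) simp
      then have 2: "real (card GG) * ((real t + 1) * \<eta> * ?n ^ card I) \<le> (?n ^ card I * c) / 4"
        by (simp add: mult.commute mult.left_commute mult.assoc)
      have "?n ^ card I * c > 0" using c n1 by simp
      then show ?thesis using 1 2 by linarith
    qed
    also have "\<dots> \<le> real (card A)" by (rule cA)
    finally have "card Bad < card A" by simp
    moreover have "finite Bad"
      unfolding Bad_def B1_def B2_def using fI fGG fA by auto
    ultimately obtain \<phi> where \<phi>: "\<phi> \<in> A" "\<phi> \<notin> Bad"
      by (metis card_mono leD subsetI)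
    have nb1: "\<phi> p \<notin> C" "\<phi> p \<notin> \<phi> ` (I - {p})" "\<And>g. g \<in> G \<Longrightarrow> (fst p, g (fst p)) \<noteq> p \<Longrightarrow> \<phi> p \<notin> L (T \<phi> g)"
      if "p \<in> I" for p
      using \<phi> that unfolding Bad_def B1_def by auto
    have nb2: "L (T \<phi> g) \<inter> L (T \<phi> h) = {}" if "g \<in> G" "h \<in> G" "\<forall>i<d. g i \<noteq> h i" for g h
    proof -
      have "(g, h) \<in> GG" unfolding GG_def using that by simp
      then have "\<phi> \<notin> B2 (g, h)" using \<phi> unfolding Bad_def by blast
      then show ?thesis using \<phi>(1) unfolding B2_def by simp
    qed
    have nL: "\<phi> p \<notin> L (T \<phi> g)" if "p \<in> I" "g \<in> G" for p g
    proof (cases "(fst p, g (fst p)) = p")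
      case True
      then have "\<phi> p \<in> T \<phi> g" unfolding T_def using that(1) unfolding I_def by (intro image_eqI[of _ _ "fst p"]) auto
      then show ?thesis using LT(3)[OF \<phi>(1) that(2)] by blast
    qed (use nb1 that in auto)
    have inj: "inj_on \<phi> I"
    proof (rule inj_onI, rule ccontr)
      fix p q assume "p \<in> I" "q \<in> I" "\<phi> p = \<phi> q" "p \<noteq> q"
      then show False using nb1(2)[of p] by (metis DiffI imageI singletonD)
    qed
    have C0: "\<phi> ` I \<inter> C = {}" using nb1(1) by blast
    have D0: "(\<lambda>i\<in>{..<d}. \<phi> (i, g i)) \<in> D \<and> \<phi> ` I \<inter> L (T \<phi> g) = {}" if "g \<in> G" for g
      using \<phi>(1) nL that unfolding A_def by blast
    show "\<exists>\<phi>. inj_on \<phi> ({..<d} \<times> {..<m}) \<and> \<phi> ` ({..<d} \<times> {..<m}) \<inter> C = {} \<and>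
       (\<forall>g\<in>{..<d} \<rightarrow>\<^sub>E {..<m}. (\<lambda>i\<in>{..<d}. \<phi> (i, g i)) \<in> D \<and>
          \<phi> ` ({..<d} \<times> {..<m}) \<inter> L ((\<lambda>i. \<phi> (i, g i)) ` {..<d}) = {}) \<and>
       (\<forall>g\<in>{..<d} \<rightarrow>\<^sub>E {..<m}. \<forall>h\<in>{..<d} \<rightarrow>\<^sub>E {..<m}. (\<forall>i<d. g i \<noteq> h i) \<longrightarrow>
          L ((\<lambda>i. \<phi> (i, g i)) ` {..<d}) \<inter> L ((\<lambda>i. \<phi> (i, h i)) ` {..<d}) = {})"
      unfolding I_def[symmetric] G_def[symmetric] T_def[symmetric]
      by (intro exI[of _ \<phi>] conjI ballI impI inj C0 D0[THEN conjunct1] D0[THEN conjunct2] nb2)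
  qed
qed

section \<open>Blocks\<close>

text \<open>The usual \<open>d\<close>-shadow; \<open>finite T\<close> excludes infinite sets for
  \<open>d = 0\<close>, as their \<open>card\<close> is 0.\<close>

definition shade :: "nat \<Rightarrow> 'a set set \<Rightarrow> 'a set set" where
  "shade d K = {T. card T = d \<and> finite T \<and> (\<exists>S\<in>K. T \<subseteq> S)}"

text \<open>For an \<open>(r - 1)\<close>-set of an \<open>r\<close>-graph this is its link, and the
  cardinality is its codegree.\<close>

definition nbr :: "'a set set \<Rightarrow> 'a set \<Rightarrow> 'a set" where
  "nbr E T = {x. x \<notin> T \<and> insert x T \<in> E}"

definition transversal :: "nat \<Rightarrow> (nat \<Rightarrow> nat \<Rightarrow> 'a) \<Rightarrow> (nat \<Rightarrow> nat) \<Rightarrow> 'a set" where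
  "transversal d \<phi> g = (\<lambda>i. \<phi> i (g i)) ` {..<d}"

definition grid :: "nat \<Rightarrow> nat \<Rightarrow> (nat \<Rightarrow> nat \<Rightarrow> 'a) \<Rightarrow> 'a set" where
  "grid d m \<phi> = (\<lambda>(i, a). \<phi> i a) ` ({..<d} \<times> {..<m})"

text \<open>\<open>C\<close> holds the extensions common to all transversals; \<open>L\<close> gives
  each transversal, taken as a set, \<open>q\<close> further ones. Lists of transversals that share
  a grid vertex may overlap arbitrarily: disjointness is available only if the transversals differ
  in every class. Position functions are constrained on \<open>{..<d}\<close> only, so that
  applications need not make them extensional.\<close>

locale block =
  fixes E :: "'a set set" and d m :: nat and C :: "'a set" and q :: nat
    and \<phi> :: "nat \<Rightarrow> nat \<Rightarrow> 'a" and L :: "'a set \<Rightarrow> 'a set"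
  assumes inj: "inj_on (\<lambda>(i, a). \<phi> i a) ({..<d} \<times> {..<m})"
    and finC: "finite C"
    and gridC: "grid d m \<phi> \<inter> C = {}"
    and const_edge: "g \<in> {..<d} \<rightarrow> {..<m} \<Longrightarrow> c \<in> C \<Longrightarrow> insert c (transversal d \<phi> g) \<in> E"
    and list_edge: "g \<in> {..<d} \<rightarrow> {..<m} \<Longrightarrow> x \<in> L (transversal d \<phi> g) \<Longrightarrow> insert x (transversal d \<phi> g) \<in> E"
    and list_fin: "g \<in> {..<d} \<rightarrow> {..<m} \<Longrightarrow> finite (L (transversal d \<phi> g))"
    and list_card: "g \<in> {..<d} \<rightarrow> {..<m} \<Longrightarrow> card (L (transversal d \<phi> g)) = q"
    and list_C: "g \<in> {..<d} \<rightarrow> {..<m} \<Longrightarrow> L (transversal d \<phi> g) \<inter> C = {}"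
    and list_grid: "g \<in> {..<d} \<rightarrow> {..<m} \<Longrightarrow> L (transversal d \<phi> g) \<inter> grid d m \<phi> = {}"
    and list_disj: "g \<in> {..<d} \<rightarrow> {..<m} \<Longrightarrow> h \<in> {..<d} \<rightarrow> {..<m} \<Longrightarrow> (\<And>i. i < d \<Longrightarrow> g i \<noteq> h i) \<Longrightarrow>
       L (transversal d \<phi> g) \<inter> L (transversal d \<phi> h) = {}"

text \<open>Induction on the number of free list entries: a vertex that extends a positive proportion of
  the transversals is moved into \<open>C\<close>; if there is none, a random block has disjoint lists.\<close>

lemma block_exists_aux:
  fixes d m t q :: nat and \<delta> :: real
  assumes d: "d \<ge> 1" and m: "m \<ge> 1" and "\<delta> > 0"
  shows "\<exists>n0. \<forall>(V :: 'a set) E C. finite V \<longrightarrow> card V \<ge> n0 \<longrightarrow> (\<forall>e\<in>E. e \<subseteq> V) \<longrightarrow>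
     (\<forall>T\<in>shade d E. card (nbr E T) \<ge> t + 1) \<longrightarrow> finite C \<longrightarrow> card C + q = t + 1 \<longrightarrow>
     real (card {f \<in> {..<d} \<rightarrow>\<^sub>E V. inj_on f {..<d} \<and> f ` {..<d} \<in> shade d E \<and> C \<subseteq> nbr E (f ` {..<d})})
        \<ge> \<delta> * real (card V) ^ d \<longrightarrow>
     (\<exists>C q \<phi> L. card C + q = t + 1 \<and> block E d m C q \<phi> L)"
  using assms(3)
proof (induction q arbitrary: \<delta>)
  \<comment> \<open>One step for both cases of the induction: \<open>step\<close> stands for the
    induction hypothesis and is guarded by \<open>q > 0\<close>, hence vacuous for
    \<open>q = 0\<close>. It is called with the density \<open>\<eta>\<close> that
    \<open>block_sampling\<close> produces from \<open>\<delta>\<close>.\<close>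
  have main: "\<exists>n0. \<forall>(V :: 'a set) E C. finite V \<longrightarrow> card V \<ge> n0 \<longrightarrow> (\<forall>e\<in>E. e \<subseteq> V) \<longrightarrow>
     (\<forall>T\<in>shade d E. card (nbr E T) \<ge> t + 1) \<longrightarrow> finite C \<longrightarrow> card C + q = t + 1 \<longrightarrow>
     real (card {f \<in> {..<d} \<rightarrow>\<^sub>E V. inj_on f {..<d} \<and> f ` {..<d} \<in> shade d E \<and> C \<subseteq> nbr E (f ` {..<d})})
        \<ge> \<delta> * real (card V) ^ d \<longrightarrow>
     (\<exists>C q \<phi> L. card C + q = t + 1 \<and> block E d m C q \<phi> L)"
    if \<delta>: "\<delta> > 0" and step: "\<And>\<eta>. \<eta> > 0 \<Longrightarrow> \<exists>n0. \<forall>(V :: 'a set) E C. q > 0 \<longrightarrow> finite V \<longrightarrow> card V \<ge> n0 \<longrightarrow> (\<forall>e\<in>E. e \<subseteq> V) \<longrightarrow>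
     (\<forall>T\<in>shade d E. card (nbr E T) \<ge> t + 1) \<longrightarrow> finite C \<longrightarrow> card C + (q - 1) = t + 1 \<longrightarrow>
     real (card {f \<in> {..<d} \<rightarrow>\<^sub>E V. inj_on f {..<d} \<and> f ` {..<d} \<in> shade d E \<and> C \<subseteq> nbr E (f ` {..<d})})
        \<ge> \<eta> * real (card V) ^ d \<longrightarrow>
     (\<exists>C q \<phi> L. card C + q = t + 1 \<and> block E d m C q \<phi> L)" for q :: nat and \<delta> :: real
  proof -
    obtain \<eta> n0 where \<eta>: "\<eta> > 0" and samp: "\<forall>(V :: 'a set) D (L :: 'a set \<Rightarrow> 'a set) (C :: 'a set). finite V \<longrightarrow> card V \<ge> n0 \<longrightarrow> D \<subseteq> {..<d} \<rightarrow>\<^sub>E V \<longrightarrow>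
     real (card D) \<ge> \<delta> * real (card V) ^ d \<longrightarrow>
     (\<forall>f\<in>D. finite (L (f ` {..<d})) \<and> card (L (f ` {..<d})) \<le> t + 1 \<and> L (f ` {..<d}) \<inter> f ` {..<d} = {}) \<longrightarrow>
     finite C \<longrightarrow> card C \<le> t + 1 \<longrightarrow>
     (\<forall>z. real (card {f \<in> D. z \<in> L (f ` {..<d})}) \<le> \<eta> * real (card V) ^ d) \<longrightarrow>
     (\<exists>\<phi>. inj_on \<phi> ({..<d} \<times> {..<m}) \<and> \<phi> ` ({..<d} \<times> {..<m}) \<inter> C = {} \<and>
       (\<forall>g\<in>{..<d} \<rightarrow>\<^sub>E {..<m}. (\<lambda>i\<in>{..<d}. \<phi> (i, g i)) \<in> D \<and>
          \<phi> ` ({..<d} \<times> {..<m}) \<inter> L ((\<lambda>i. \<phi> (i, g i)) ` {..<d}) = {}) \<and>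
       (\<forall>g\<in>{..<d} \<rightarrow>\<^sub>E {..<m}. \<forall>h\<in>{..<d} \<rightarrow>\<^sub>E {..<m}. (\<forall>i<d. g i \<noteq> h i) \<longrightarrow>
          L ((\<lambda>i. \<phi> (i, g i)) ` {..<d}) \<inter> L ((\<lambda>i. \<phi> (i, h i)) ` {..<d}) = {}))"
      using block_sampling[OF \<delta> d m, of t, where ?'a = 'a] by (elim exE conjE) (rule that)
    obtain n1 where n1: "\<forall>(V :: 'a set) E C. q > 0 \<longrightarrow> finite V \<longrightarrow> card V \<ge> n1 \<longrightarrow> (\<forall>e\<in>E. e \<subseteq> V) \<longrightarrow>
     (\<forall>T\<in>shade d E. card (nbr E T) \<ge> t + 1) \<longrightarrow> finite C \<longrightarrow> card C + (q - 1) = t + 1 \<longrightarrow>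
     real (card {f \<in> {..<d} \<rightarrow>\<^sub>E V. inj_on f {..<d} \<and> f ` {..<d} \<in> shade d E \<and> C \<subseteq> nbr E (f ` {..<d})})
        \<ge> \<eta> * real (card V) ^ d \<longrightarrow>
     (\<exists>C q \<phi> L. card C + q = t + 1 \<and> block E d m C q \<phi> L)" 
      using step[OF \<eta>] by (elim exE) (rule that)
    show ?thesis
    proof (rule exI[of _ "max n0 n1"], intro allI impI)
      fix V :: "'a set" and E C
      assume V: "finite V" "card V \<ge> max n0 n1" and EV: "\<forall>e\<in>E. e \<subseteq> V"
        and full: "\<forall>T\<in>shade d E. card (nbr E T) \<ge> t + 1" and C: "finite C" "card C + q = t + 1"
        and big: "real (card {f \<in> {..<d} \<rightarrow>\<^sub>E V. inj_on f {..<d} \<and> f ` {..<d} \<in> shade d E \<and> C \<subseteq> nbr E (f ` {..<d})})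
        \<ge> \<delta> * real (card V) ^ d"
      define D where "D C = {f \<in> {..<d} \<rightarrow>\<^sub>E V. inj_on f {..<d} \<and> f ` {..<d} \<in> shade d E \<and> C \<subseteq> nbr E (f ` {..<d})}" for C
      have fD: "finite (D C)" for C unfolding D_def using finite_PiE[of "{..<d}" "\<lambda>_. V"] V by simp
      show "\<exists>C q \<phi> L. card C + q = t + 1 \<and> block E d m C q \<phi> L"
      proof (cases "q > 0 \<and> (\<exists>z. z \<notin> C \<and> real (card (D (insert z C))) \<ge> \<eta> * real (card V) ^ d)")
        case True
        then obtain z where z: "z \<notin> C" "real (card (D (insert z C))) \<ge> \<eta> * real (card V) ^ d" by blast
        have "card (insert z C) + (q - 1) = t + 1" using z C True by simp
        then show ?thesis
          using n1[rule_format, of V E "insert z C"] True z V EV full C unfolding D_def by simp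
      next
        case False
        have "\<exists>l. l \<subseteq> nbr E T - C \<and> card l = q \<and> finite l" if "T \<in> shade d E" "C \<subseteq> nbr E T" for T
        proof -
          have "card (nbr E T) \<ge> t + 1" using full that by blast
          then have "card (nbr E T - C) \<ge> q" using that C by (simp add: card_Diff_subset)
          then show ?thesis by (metis card.infinite finite_subset le_zero_eq obtain_subset_with_card_n finite.emptyI empty_subsetI card.empty)
        qed
        then obtain L where L: "\<And>T. T \<in> shade d E \<Longrightarrow> C \<subseteq> nbr E T \<Longrightarrow> L T \<subseteq> nbr E T - C \<and> card (L T) = q \<and> finite (L T)"
          by metis
        have LD: "L (f ` {..<d}) \<subseteq> nbr E (f ` {..<d}) - C" "card (L (f ` {..<d})) = q" "finite (L (f ` {..<d}))"
          if "f \<in> D C" for f using L that unfolding D_def by auto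
        have CD: "C \<subseteq> nbr E (f ` {..<d})" if "f \<in> D C" for f using that unfolding D_def by auto
        \<comment> \<open>Lists consist of extensions outside \<open>C\<close>, so whoever has
          \<open>z\<close> in its list belongs to \<open>D (insert z C)\<close>, and that set is
          small because no further constant could be found.\<close>
        have spread: "real (card {f \<in> D C. z \<in> L (f ` {..<d})}) \<le> \<eta> * real (card V) ^ d" for z
        proof (cases "q = 0 \<or> z \<in> C")
          case True
          then have "{f \<in> D C. z \<in> L (f ` {..<d})} = {}" using LD by (auto dest: card_0_eq)
          then show ?thesis using \<eta> by (simp only: card.empty) simp
        next
          case F: False
          have "{f \<in> D C. z \<in> L (f ` {..<d})} \<subseteq> D (insert z C)"
            using LD unfolding D_def by auto
          then have "card {f \<in> D C. z \<in> L (f ` {..<d})} \<le> card (D (insert z C))" using fD by (rule card_mono[rotated])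
          then show ?thesis using False F by (meson linorder_not_le of_nat_le_iff less_imp_le order_trans neq0_conv)
        qed
        have "\<exists>\<phi>. inj_on \<phi> ({..<d} \<times> {..<m}) \<and> \<phi> ` ({..<d} \<times> {..<m}) \<inter> C = {} \<and>
       (\<forall>g\<in>{..<d} \<rightarrow>\<^sub>E {..<m}. (\<lambda>i\<in>{..<d}. \<phi> (i, g i)) \<in> D C \<and>
          \<phi> ` ({..<d} \<times> {..<m}) \<inter> L ((\<lambda>i. \<phi> (i, g i)) ` {..<d}) = {}) \<and>
       (\<forall>g\<in>{..<d} \<rightarrow>\<^sub>E {..<m}. \<forall>h\<in>{..<d} \<rightarrow>\<^sub>E {..<m}. (\<forall>i<d. g i \<noteq> h i) \<longrightarrow>
          L ((\<lambda>i. \<phi> (i, g i)) ` {..<d}) \<inter> L ((\<lambda>i. \<phi> (i, h i)) ` {..<d}) = {})"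
        proof (rule samp[rule_format])
          show "finite V" "n0 \<le> card V" using V by auto
          show "D C \<subseteq> {..<d} \<rightarrow>\<^sub>E V" unfolding D_def by auto
          show "\<delta> * real (card V) ^ d \<le> real (card (D C))" using big unfolding D_def .
          show "finite (L (f ` {..<d})) \<and> card (L (f ` {..<d})) \<le> t + 1 \<and> L (f ` {..<d}) \<inter> f ` {..<d} = {}" if "f \<in> D C" for f
            using LD[OF that] C unfolding nbr_def by auto
          show "finite C" "card C \<le> t + 1" using C by auto
          show "real (card {f \<in> D C. z \<in> L (f ` {..<d})}) \<le> \<eta> * real (card V) ^ d" for z by (rule spread)
        qed
        then obtain \<phi> where \<phi>: "inj_on \<phi> ({..<d} \<times> {..<m})" "\<phi> ` ({..<d} \<times> {..<m}) \<inter> C = {}"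
          and *: "\<forall>g\<in>{..<d} \<rightarrow>\<^sub>E {..<m}. (\<lambda>i\<in>{..<d}. \<phi> (i, g i)) \<in> D C \<and>
            \<phi> ` ({..<d} \<times> {..<m}) \<inter> L ((\<lambda>i. \<phi> (i, g i)) ` {..<d}) = {}"
          and Lgh: "\<forall>g\<in>{..<d} \<rightarrow>\<^sub>E {..<m}. \<forall>h\<in>{..<d} \<rightarrow>\<^sub>E {..<m}. (\<forall>i<d. g i \<noteq> h i) \<longrightarrow>
            L ((\<lambda>i. \<phi> (i, g i)) ` {..<d}) \<inter> L ((\<lambda>i. \<phi> (i, h i)) ` {..<d}) = {}"
          by (elim exE conjE) (rule that)
        note inD = *[THEN bspec, THEN conjunct1] and Lg = *[THEN bspec, THEN conjunct2]
        define \<psi> where "\<psi> i a = \<phi> (i, a)" for i a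
        have gr: "grid d m \<psi> = \<phi> ` ({..<d} \<times> {..<m})" unfolding grid_def \<psi>_def by (rule image_cong) auto
        have tr: "transversal d \<psi> g = (\<lambda>i. \<phi> (i, restrict g {..<d} i)) ` {..<d}" for g
          unfolding transversal_def \<psi>_def by auto
        have tr2: "transversal d \<psi> g = (\<lambda>i\<in>{..<d}. \<phi> (i, restrict g {..<d} i)) ` {..<d}" for g
          unfolding transversal_def \<psi>_def by auto
        have gE: "restrict g {..<d} \<in> {..<d} \<rightarrow>\<^sub>E {..<m}" if "g \<in> {..<d} \<rightarrow> {..<m}" for g
          using that by (simp add: restrict_PiE_iff Pi_iff)
        have Tg: "L (transversal d \<psi> g) \<subseteq> nbr E (transversal d \<psi> g) - C" "card (L (transversal d \<psi> g)) = q"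
          "finite (L (transversal d \<psi> g))" "C \<subseteq> nbr E (transversal d \<psi> g)"
          if "g \<in> {..<d} \<rightarrow> {..<m}" for g
          using LD[OF inD[OF gE[OF that]]] CD[OF inD[OF gE[OF that]]] unfolding tr2[symmetric] by auto
        have "block E d m C q \<psi> L"
        proof
          show "inj_on (\<lambda>(i, a). \<psi> i a) ({..<d} \<times> {..<m})" using \<phi>(1) by (simp add: inj_on_def \<psi>_def)
          show "finite C" by (rule C)
          show "grid d m \<psi> \<inter> C = {}" unfolding gr by (rule \<phi>)
          fix g assume g: "g \<in> {..<d} \<rightarrow> {..<m}"
          show "insert c (transversal d \<psi> g) \<in> E" if "c \<in> C" for c using Tg(4)[OF g] that unfolding nbr_def by auto
          show "insert x (transversal d \<psi> g) \<in> E" if "x \<in> L (transversal d \<psi> g)" for x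
            using Tg(1)[OF g] that unfolding nbr_def by auto
          show "finite (L (transversal d \<psi> g))" "card (L (transversal d \<psi> g)) = q" using Tg[OF g] by auto
          show "L (transversal d \<psi> g) \<inter> C = {}" using Tg[OF g] by auto
          show "L (transversal d \<psi> g) \<inter> grid d m \<psi> = {}" using Lg[OF gE[OF g]] unfolding gr tr by auto
          fix h assume h: "h \<in> {..<d} \<rightarrow> {..<m}" "\<And>i. i < d \<Longrightarrow> g i \<noteq> h i"
          show "L (transversal d \<psi> g) \<inter> L (transversal d \<psi> h) = {}"
            unfolding tr using h by (intro Lgh[rule_format] gE g) auto
        qed
        then show ?thesis using C by blast
      qed
    qed
  qed
  {
    case 0
    then show ?case by (rule main) simp
  next
    case (Suc q)
    show ?case by (rule main[OF Suc.prems]) (use Suc.IH in simp)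
  }
qed

text \<open>The start of the iteration, without constants and with \<open>q = t + 1\<close>. Passing
  from sets to injective enumerations does not decrease the count, so the density is kept.\<close>

lemma block_exists:
  fixes d m t :: nat and \<delta> :: real
  assumes "d \<ge> 1" "m \<ge> 1" "\<delta> > 0"
  shows "\<exists>n0. \<forall>(V :: 'a set) E. finite V \<longrightarrow> card V \<ge> n0 \<longrightarrow> (\<forall>e\<in>E. e \<subseteq> V) \<longrightarrow>
     (\<forall>T\<in>shade d E. card (nbr E T) \<ge> t + 1) \<longrightarrow> real (card (shade d E)) \<ge> \<delta> * real (card V) ^ d \<longrightarrow>
     (\<exists>C q \<phi> L. card C + q = t + 1 \<and> block E d m C q \<phi> L)"
proof -
  obtain n0 where n0: "\<forall>(V :: 'a set) E C. finite V \<longrightarrow> card V \<ge> n0 \<longrightarrow> (\<forall>e\<in>E. e \<subseteq> V) \<longrightarrow>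
     (\<forall>T\<in>shade d E. card (nbr E T) \<ge> t + 1) \<longrightarrow> finite C \<longrightarrow> card C + (t + 1) = t + 1 \<longrightarrow>
     real (card {f \<in> {..<d} \<rightarrow>\<^sub>E V. inj_on f {..<d} \<and> f ` {..<d} \<in> shade d E \<and> C \<subseteq> nbr E (f ` {..<d})})
        \<ge> \<delta> * real (card V) ^ d \<longrightarrow>
     (\<exists>C q \<phi> L. card C + q = t + 1 \<and> block E d m C q \<phi> L)"
    using block_exists_aux[OF assms, of t "t + 1", where ?'a = 'a] by (elim exE) (rule that)
  show ?thesis
  proof (rule exI[of _ n0], intro allI impI)
    fix V :: "'a set" and E
    assume V: "finite V" "card V \<ge> n0" and EV: "\<forall>e\<in>E. e \<subseteq> V"
      and full: "\<forall>T\<in>shade d E. card (nbr E T) \<ge> t + 1"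
      and big: "real (card (shade d E)) \<ge> \<delta> * real (card V) ^ d"
    let ?D = "{f \<in> {..<d} \<rightarrow>\<^sub>E V. inj_on f {..<d} \<and> f ` {..<d} \<in> shade d E \<and> {} \<subseteq> nbr E (f ` {..<d})}"
    have fD: "finite ?D" using finite_PiE[of "{..<d}" "\<lambda>_. V"] V by simp
    have "shade d E \<subseteq> (\<lambda>f. f ` {..<d}) ` ?D"
    proof
      fix T assume T: "T \<in> shade d E"
      then have "card T = d" "finite T" "T \<subseteq> V" using EV unfolding shade_def by auto
      then obtain f where f: "bij_betw f {..<d} T"
        using ex_bij_betw_nat_finite[of T] by (auto simp: atLeast0LessThan)
      have "restrict f {..<d} ` {..<d} = T" using f by (auto simp: bij_betw_def)
      moreover have "inj_on (restrict f {..<d}) {..<d}" using f by (auto simp: bij_betw_def inj_on_def)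
      moreover have "restrict f {..<d} \<in> {..<d} \<rightarrow>\<^sub>E V"
        using f \<open>T \<subseteq> V\<close> by (auto simp: bij_betw_def)
      ultimately show "T \<in> (\<lambda>f. f ` {..<d}) ` ?D" using T by (intro image_eqI[of _ _ "restrict f {..<d}"]) auto
    qed
    then have "card (shade d E) \<le> card ((\<lambda>f. f ` {..<d}) ` ?D)" using fD by (intro card_mono finite_imageI)
    also have "\<dots> \<le> card ?D" using fD by (rule card_image_le)
    finally have "real (card (shade d E)) \<le> real (card ?D)" by (rule of_nat_mono)
    then have "real (card ?D) \<ge> \<delta> * real (card V) ^ d" using big by linarith
    then show "\<exists>C q \<phi> L. card C + q = t + 1 \<and> block E d m C q \<phi> L"
      using n0[rule_format, of V E "{}"] V EV full by simp
  qed
qed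

section \<open>Copies of expansions\<close>

text \<open>The vertex set \<open>U\<close> of the copy is exposed because components are made
  disjoint by keeping these sets apart. \<open>E\<close> is a bare edge family; that
  \<open>U\<close> lies in a host graph is recovered in \<open>spans_not_free\<close>.\<close>

definition spans :: "'a set set \<Rightarrow> 'b hypergraph \<Rightarrow> 'a set \<Rightarrow> bool" where
  "spans E H U \<longleftrightarrow> (\<exists>E'\<subseteq>E. hg_isomorphic H (U, E'))"

lemma spans_card:
  assumes "spans E H U" "finite (verts H)"
  shows "finite U" "card U = card (verts H)"
  using assms bij_betw_finite bij_betw_same_card unfolding spans_def hg_isomorphic_def by fastforce+

lemma spans_disjoint_union:
  assumes "\<And>i. i < length Hs \<Longrightarrow> spans E (Hs ! i) (U i)"
    and "\<And>i j. i < length Hs \<Longrightarrow> j < length Hs \<Longrightarrow> i \<noteq> j \<Longrightarrow> U i \<inter> U j = {}"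
    and "\<And>i e. i < length Hs \<Longrightarrow> e \<in> hedges (Hs ! i) \<Longrightarrow> e \<subseteq> verts (Hs ! i)"
  shows "spans E (disjoint_union Hs) (\<Union>i<length Hs. U i)"
proof -
  let ?n = "length Hs"
  have "\<forall>i. \<exists>f. i < ?n \<longrightarrow> bij_betw f (verts (Hs ! i)) (U i) \<and> (\<lambda>e. f ` e) ` hedges (Hs ! i) \<subseteq> E"
    using assms(1) unfolding spans_def hg_isomorphic_def by fastforce
  then obtain f where f: "\<And>i. i < ?n \<Longrightarrow> bij_betw (f i) (verts (Hs ! i)) (U i)"
    "\<And>i. i < ?n \<Longrightarrow> (\<lambda>e. f i ` e) ` hedges (Hs ! i) \<subseteq> E" by metis
  define F where "F = (\<lambda>(i, x). f i x)"
  have FU: "f i x \<in> U i" if "i < ?n" "x \<in> verts (Hs ! i)" for i x using f(1) that bij_betwE by blast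
  have "bij_betw F (verts (disjoint_union Hs)) (\<Union>i<?n. U i)"
  proof (rule bij_betw_imageI)
    show "inj_on F (verts (disjoint_union Hs))"
    proof (rule inj_onI)
      fix a b assume "a \<in> verts (disjoint_union Hs)" "b \<in> verts (disjoint_union Hs)" and eq: "F a = F b"
      then obtain i x j y where a: "a = (i, x)" "i < ?n" "x \<in> verts (Hs ! i)" and b: "b = (j, y)" "j < ?n" "y \<in> verts (Hs ! j)"
        unfolding disjoint_union_def by auto
      have e: "f i x = f j y" using eq a b by (simp add: F_def)
      have "i = j" using FU[OF a(2,3)] FU[OF b(2,3)] e assms(2)[OF a(2) b(2)] by auto
      moreover have "x = y" using f(1)[OF a(2)] a b e calculation by (auto simp: bij_betw_def inj_on_def)
      ultimately show "a = b" using a b by simp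
    qed
    have "F ` verts (disjoint_union Hs) = (\<Union>i<?n. f i ` verts (Hs ! i))"
      unfolding disjoint_union_def F_def by (force simp: image_iff)
    also have "\<dots> = (\<Union>i<?n. U i)" using f(1) by (auto simp: bij_betw_def)
    finally show "F ` verts (disjoint_union Hs) = (\<Union>i<?n. U i)" .
  qed
  moreover have "(\<lambda>e. F ` e) ` hedges (disjoint_union Hs) \<subseteq> E"
  proof (rule image_subsetI)
    fix e assume "e \<in> hedges (disjoint_union Hs)"
    then obtain i e' where i: "i < ?n" "e' \<in> hedges (Hs ! i)" "e = Pair i ` e'" unfolding disjoint_union_def by auto
    have "F ` e = f i ` e'" unfolding i F_def by (simp add: image_image)
    then show "F ` e \<in> E" using f(2)[OF i(1)] i(2) by auto
  qed
  ultimately show ?thesis unfolding spans_def hg_isomorphic_def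
    by (intro exI[of _ "(\<lambda>e. F ` e) ` hedges (disjoint_union Hs)"] conjI exI[of _ F]) auto
qed

text \<open>It suffices to place the graph vertices by \<open>w\<close> and to choose a hyperedge
  over each edge: the remaining vertices of a hyperedge are interchangeable, so any numbering of
  them serves for the new vertices.\<close>

lemma spans_expansion:
  assumes w: "inj_on w (verts \<Gamma>)"
    and ed: "\<And>e. e \<in> hedges \<Gamma> \<Longrightarrow> e \<subseteq> verts \<Gamma> \<and> card e = 2"
    and Ed: "\<And>e. e \<in> hedges \<Gamma> \<Longrightarrow> Ed e \<in> E \<and> finite (Ed e) \<and> card (Ed e) = r \<and> Ed e \<inter> w ` verts \<Gamma> = w ` e"
    and disj: "\<And>e e'. e \<in> hedges \<Gamma> \<Longrightarrow> e' \<in> hedges \<Gamma> \<Longrightarrow> e \<noteq> e' \<Longrightarrow> Ed e \<inter> Ed e' \<subseteq> w ` verts \<Gamma>"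
  shows "spans E (expansion r \<Gamma>) (w ` verts \<Gamma> \<union> \<Union>(Ed ` hedges \<Gamma>))"
proof -
  have cw: "card (w ` e) = 2" "w ` e \<subseteq> Ed e" "finite (w ` e)" if "e \<in> hedges \<Gamma>" for e
    using ed[OF that] w Ed[OF that] by (auto simp: card_image inj_on_subset intro: card_ge_0_finite)
  have "\<exists>h. bij_betw h {..<r - 2} (Ed e - w ` e)" if "e \<in> hedges \<Gamma>" for e
  proof -
    have "finite (Ed e - w ` e)" "card (Ed e - w ` e) = r - 2"
      using Ed[OF that] cw[OF that] by (auto simp: card_Diff_subset)
    then show ?thesis using ex_bij_betw_nat_finite[of "Ed e - w ` e"] by (auto simp: atLeast0LessThan)
  qed
  then obtain h where h: "\<And>e. e \<in> hedges \<Gamma> \<Longrightarrow> bij_betw (h e) {..<r - 2} (Ed e - w ` e)" by metis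
  define f where "f = case_sum w (\<lambda>(e, j). h e j)"
  have hE: "h e j \<in> Ed e" "h e j \<notin> w ` verts \<Gamma>" if "e \<in> hedges \<Gamma>" "j < r - 2" for e j
  proof -
    have "h e j \<in> Ed e - w ` e" using bij_betwE[OF h[OF that(1)]] that by auto
    then show "h e j \<in> Ed e" "h e j \<notin> w ` verts \<Gamma>" using Ed[OF that(1)] by blast+
  qed
  have him: "h e ` {..<r - 2} = Ed e - w ` e" if "e \<in> hedges \<Gamma>" for e
    using h[OF that] by (simp add: bij_betw_def)
  have img: "f ` (Inl ` e \<union> Inr ` ({e} \<times> {..<r - 2})) = Ed e" if "e \<in> hedges \<Gamma>" for e
  proof -
    have "f ` (Inl ` e \<union> Inr ` ({e} \<times> {..<r - 2})) = w ` e \<union> h e ` {..<r - 2}"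
      unfolding f_def by (force simp: image_iff)
    then show ?thesis using him[OF that] cw[OF that] by auto
  qed
  have "inj_on f (verts (expansion r \<Gamma>))"
  proof (rule inj_onI)
    fix a b assume ab: "a \<in> verts (expansion r \<Gamma>)" "b \<in> verts (expansion r \<Gamma>)" and eq: "f a = f b"
    have hh: "e = e' \<and> j = j'" if "e \<in> hedges \<Gamma>" "e' \<in> hedges \<Gamma>" "j < r - 2" "j' < r - 2" "h e j = h e' j'" for e e' j j'
    proof -
      have "e = e'" using disj[OF that(1,2)] hE[OF that(1,3)] hE[OF that(2,4)] that(5) by auto
      then show ?thesis using h[OF that(1)] that by (auto simp: bij_betw_def inj_on_def)
    qed
    show "a = b"
    proof (cases a; cases b)
      fix x y assume "a = Inl x" "b = Inl y"
      then show ?thesis using ab eq w by (auto simp: expansion_def f_def inj_on_def)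
    next
      fix x y assume "a = Inr x" "b = Inr y"
      then show ?thesis using ab eq hh by (auto simp: expansion_def f_def)
    next
      fix x y assume xy: "a = Inl x" "b = Inr y"
      then obtain e j v where "e \<in> hedges \<Gamma>" "j < r - 2" "v \<in> verts \<Gamma>" "h e j = w v"
        using ab eq by (auto simp: expansion_def f_def)
      then have False using hE(2) by blast
      then show ?thesis ..
    next
      fix x y assume xy: "a = Inr x" "b = Inl y"
      then obtain e j v where "e \<in> hedges \<Gamma>" "j < r - 2" "v \<in> verts \<Gamma>" "h e j = w v"
        using ab eq by (auto simp: expansion_def f_def)
      then have False using hE(2) by blast
      then show ?thesis ..
    qed
  qed
  moreover have "f ` verts (expansion r \<Gamma>) = w ` verts \<Gamma> \<union> \<Union>(Ed ` hedges \<Gamma>)"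
  proof -
    have "f ` verts (expansion r \<Gamma>) = w ` verts \<Gamma> \<union> (\<Union>e\<in>hedges \<Gamma>. h e ` {..<r - 2})"
      unfolding f_def expansion_def by (force simp: image_iff)
    also have "\<dots> = w ` verts \<Gamma> \<union> (\<Union>e\<in>hedges \<Gamma>. Ed e - w ` e)" using him by simp
    also have "\<dots> = w ` verts \<Gamma> \<union> \<Union>(Ed ` hedges \<Gamma>)" using ed by blast
    finally show ?thesis .
  qed
  moreover have "(\<lambda>e. f ` e) ` hedges (expansion r \<Gamma>) = Ed ` hedges \<Gamma>"
  proof -
    have "(\<lambda>e. f ` e) ` hedges (expansion r \<Gamma>) = (\<lambda>e. f ` (Inl ` e \<union> Inr ` ({e} \<times> {..<r - 2}))) ` hedges \<Gamma>"
      unfolding expansion_def by (simp add: image_image)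
    also have "\<dots> = Ed ` hedges \<Gamma>" by (rule image_cong[OF refl img])
    finally show ?thesis .
  qed
  ultimately show ?thesis unfolding spans_def hg_isomorphic_def
    using Ed by (intro exI[of _ "Ed ` hedges \<Gamma>"] conjI exI[of _ f]) (auto simp: bij_betw_def)
qed

text \<open>\<open>A i\<close> is a supply reserved for the \<open>i\<close>-th object within the
  pool \<open>B\<close>. Earlier objects touch the pool only in their own supplies, so the used set
  \<open>W\<close> never meets \<open>A i\<close>; otherwise \<open>W\<close> is arbitrary of
  bounded size, and the objects have to be found robustly.\<close>

lemma greedy_pack:
  assumes step: "\<And>i W. i < n \<Longrightarrow> finite W \<Longrightarrow> card W \<le> w + (n - 1) * z \<Longrightarrow> W \<inter> A i = {} \<Longrightarrow>
      \<exists>U. P i U \<and> finite U \<and> card U \<le> z \<and> U \<inter> W = {} \<and> U \<inter> B \<subseteq> A i"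
    and A: "\<And>i j. i < n \<Longrightarrow> j < n \<Longrightarrow> i \<noteq> j \<Longrightarrow> A i \<inter> A j = {}" "\<And>i. i < n \<Longrightarrow> A i \<subseteq> B"
    and W0: "finite W0" "card W0 \<le> w" "\<And>i. i < n \<Longrightarrow> W0 \<inter> A i = {}"
  shows "\<exists>U. \<forall>i<n. P i (U i) \<and> finite (U i) \<and> U i \<inter> W0 = {} \<and> (\<forall>j<n. i \<noteq> j \<longrightarrow> U i \<inter> U j = {})"
proof -
  have "\<exists>U. \<forall>i<k. P i (U i) \<and> finite (U i) \<and> card (U i) \<le> z \<and> U i \<inter> W0 = {} \<and> U i \<inter> B \<subseteq> A i \<and>
      (\<forall>j<k. i \<noteq> j \<longrightarrow> U i \<inter> U j = {})" if "k \<le> n" for k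
    using that
  proof (induction k)
    case (Suc k)
    then obtain U where U: "\<forall>i<k. P i (U i) \<and> finite (U i) \<and> card (U i) \<le> z \<and> U i \<inter> W0 = {} \<and> U i \<inter> B \<subseteq> A i \<and>
      (\<forall>j<k. i \<noteq> j \<longrightarrow> U i \<inter> U j = {})" by auto
    define W where "W = W0 \<union> (\<Union>i<k. U i)"
    have "finite W" unfolding W_def using W0 U by auto
    moreover have "card W \<le> w + (n - 1) * z"
    proof -
      have "card W \<le> card W0 + card (\<Union>i<k. U i)" unfolding W_def by (rule card_Un_le)
      also have "card (\<Union>i<k. U i) \<le> (\<Sum>i<k. card (U i))" by (rule card_UN_le) simp
      also have "\<dots> \<le> k * z" using U sum_bounded_above[of "{..<k}" "\<lambda>i. card (U i)" z] by simp
      also have "\<dots> \<le> (n - 1) * z" using Suc.prems by (intro mult_le_mono1) simp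
      finally show ?thesis using W0 by simp
    qed
    moreover have "W \<inter> A k = {}"
    proof -
      have "U i \<inter> A k = {}" if "i < k" for i using U A(1)[of i k] A(2)[of k] that Suc.prems by fastforce
      then show ?thesis unfolding W_def using W0(3)[of k] Suc.prems by auto
    qed
    ultimately obtain X where X: "P k X" "finite X" "card X \<le> z" "X \<inter> W = {}" "X \<inter> B \<subseteq> A k"
      using step[of k W] Suc.prems by auto
    have "X \<inter> W0 = {}" "\<And>i. i < k \<Longrightarrow> X \<inter> U i = {}" using X(4) unfolding W_def by auto
    then show ?case using X U by (intro exI[of _ "U(k := X)"]) (auto simp: less_Suc_eq Int_commute)
  qed simp
  from this[of n] show ?thesis by blast
qed

text \<open>Unwanted vertices are exchanged one at a time: removing \<open>z\<close> from
  \<open>e\<close> leaves an \<open>(r - 1)\<close>-set with more than \<open>card W\<close>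
  extensions, so one of them outside \<open>W\<close> can replace \<open>z\<close>.\<close>

lemma full_avoid:
  assumes E: "\<And>e. e \<in> E \<Longrightarrow> finite e \<and> card e = r" and r: "r \<ge> 1"
    and full: "\<And>T. T \<in> shade (r - 1) E \<Longrightarrow> card (nbr E T) \<ge> N"
    and W: "finite W" "card W < N"
    and e: "e \<in> E" "A \<subseteq> e"
  shows "\<exists>e'\<in>E. A \<subseteq> e' \<and> (e' - A) \<inter> W = {}"
  using e
proof (induction "card ((e - A) \<inter> W)" arbitrary: e rule: less_induct)
  case less
  show ?case
  proof (cases "(e - A) \<inter> W = {}")
    case False
    then obtain z where z: "z \<in> e" "z \<notin> A" "z \<in> W" by blast
    define T where "T = e - {z}"
    have "T \<in> shade (r - 1) E" unfolding T_def shade_def using less.prems z E[of e] by auto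
    then have "card (nbr E T) > card W" using full W by fastforce
    then have "\<not> nbr E T \<subseteq> W" using W card_mono by (metis linorder_not_le)
    then obtain y where y: "y \<in> nbr E T" "y \<notin> W" by blast
    have "(insert y T - A) \<inter> W \<subseteq> (e - A) \<inter> W - {z}" using y unfolding T_def by auto
    then have "card ((insert y T - A) \<inter> W) \<le> card ((e - A) \<inter> W - {z})" using W by (intro card_mono) auto
    also have "\<dots> < card ((e - A) \<inter> W)" using W z by (intro card_Diff1_less) auto
    finally have "card ((insert y T - A) \<inter> W) < card ((e - A) \<inter> W)" .
    moreover have "insert y T \<in> E" using y unfolding nbr_def by simp
    moreover have "A \<subseteq> insert y T" using less.prems z unfolding T_def by auto
    ultimately show ?thesis using less.hyps by blast
  qed (use less.prems in blast)
qed

text \<open>Paths, cycles and stars all sit inside a fan of triangles around vertex 0. As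
  \<open>r \<ge> 3\<close>, a hyperedge over the last spoke has a third vertex, which continues the
  fan. The hyperedges may still intersect badly; \<open>full_expand\<close> repairs this.\<close>

lemma full_fan:
  assumes E: "\<And>e. e \<in> E \<Longrightarrow> finite e \<and> card e = r" "E \<noteq> {}" and r: "r \<ge> 3"
    and full: "\<And>T. T \<in> shade (r - 1) E \<Longrightarrow> card (nbr E T) \<ge> N"
    and W: "finite W" "card W + n + 2 < N" and n: "n \<ge> 1"
  shows "\<exists>u. inj_on u {..n} \<and> u ` {..n} \<inter> W = {} \<and> (\<exists>e\<in>E. {u 0, u n} \<subseteq> e) \<and>
     (\<forall>i. 1 \<le> i \<longrightarrow> i < n \<longrightarrow> (\<exists>e\<in>E. {u 0, u i, u (i + 1)} \<subseteq> e))"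
  using n W(2)
proof (induction n rule: dec_induct)
  case base
  obtain e0 where "e0 \<in> E" using E by blast
  then obtain e where e: "e \<in> E" "e \<inter> W = {}"
    using full_avoid[OF E(1) _ full W(1), of e0 "{}"] r base by auto
  have "card e \<ge> 2" using E(1)[OF e(1)] r by auto
  then obtain P where "P \<subseteq> e" "card P = 2" by (meson obtain_subset_with_card_n)
  then obtain a b where ab: "a \<in> e" "b \<in> e" "a \<noteq> b" by (auto simp: card_2_iff)
  have "inj_on (\<lambda>i::nat. if i = 0 then a else b) {..1}"
    using ab by (auto simp: inj_on_def le_Suc_eq)
  then show ?case using ab e by (intro exI[of _ "\<lambda>i. if i = 0 then a else b"]) auto
next
  case (step n)
  then obtain u where u: "inj_on u {..n}" "u ` {..n} \<inter> W = {}" "\<exists>e\<in>E. {u 0, u n} \<subseteq> e"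
    "\<forall>i. 1 \<le> i \<longrightarrow> i < n \<longrightarrow> (\<exists>e\<in>E. {u 0, u i, u (i + 1)} \<subseteq> e)" by auto
  obtain e0 where e0: "e0 \<in> E" "{u 0, u n} \<subseteq> e0" using u by blast
  have "card (W \<union> u ` {..n}) \<le> card W + card (u ` {..n})" by (rule card_Un_le)
  also have "card (u ` {..n}) \<le> n + 1" using card_image_le[of "{..n}" u] by simp
  finally have "card (W \<union> u ` {..n}) < N" using step by simp
  then obtain e where e: "e \<in> E" "{u 0, u n} \<subseteq> e" "(e - {u 0, u n}) \<inter> (W \<union> u ` {..n}) = {}"
    using full_avoid[OF E(1) _ full _ _ e0, of "W \<union> u ` {..n}"] r W by auto
  have "card {u 0, u n} < card e" using E(1)[OF e(1)] r by (auto intro: le_less_trans[OF card_insert_le_m1])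
  then have "\<not> e \<subseteq> {u 0, u n}" by (metis card_mono finite.emptyI finite.insertI linorder_not_le)
  then obtain x where x: "x \<in> e" "x \<notin> {u 0, u n}" by blast
  then have xW: "x \<notin> W" "x \<notin> u ` {..n}" using e by auto
  have iu: "inj_on (u(Suc n := x)) {..Suc n}"
    using u(1) xW unfolding atMost_Suc by (auto simp: inj_on_def)
  show ?case
  proof (rule exI[of _ "u(Suc n := x)"], intro conjI)
    show "(u(Suc n := x)) ` {..Suc n} \<inter> W = {}" using u(2) xW by (auto simp: le_Suc_eq disjoint_iff)
    show "\<exists>e\<in>E. {(u(Suc n := x)) 0, (u(Suc n := x)) (Suc n)} \<subseteq> e" using e x by auto
    show "\<forall>i. 1 \<le> i \<longrightarrow> i < Suc n \<longrightarrow> (\<exists>e\<in>E. {(u(Suc n := x)) 0, (u(Suc n := x)) i, (u(Suc n := x)) (i + 1)} \<subseteq> e)"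
      using u(4) e x by (auto simp: less_Suc_eq)
  qed (rule iu)
qed

text \<open>Each graph edge already lies in a hyperedge, and \<open>full_avoid\<close> moves the
  rest of it away from \<open>W\<close>, from the placed graph vertices and from the hyperedges
  chosen before. The bound below \<open>N\<close> adds up these obstacles.\<close>

lemma full_expand:
  assumes E: "\<And>e. e \<in> E \<Longrightarrow> finite e \<and> card e = r" and r: "r \<ge> 1"
    and full: "\<And>T. T \<in> shade (r - 1) E \<Longrightarrow> card (nbr E T) \<ge> N"
    and W: "finite W" "card W + card (verts \<Gamma>) + r * card (hedges \<Gamma>) < N"
    and \<Gamma>: "finite (verts \<Gamma>)" "finite (hedges \<Gamma>)" "\<And>e. e \<in> hedges \<Gamma> \<Longrightarrow> e \<subseteq> verts \<Gamma> \<and> card e = 2"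
    and w: "inj_on w (verts \<Gamma>)" "w ` verts \<Gamma> \<inter> W = {}" "\<And>e. e \<in> hedges \<Gamma> \<Longrightarrow> \<exists>e'\<in>E. w ` e \<subseteq> e'"
  shows "\<exists>U. spans E (expansion r \<Gamma>) U \<and> U \<inter> W = {}"
proof -
  have "\<exists>Ed. (\<forall>e\<in>X. Ed e \<in> E \<and> Ed e \<inter> w ` verts \<Gamma> = w ` e \<and> Ed e \<inter> W = {}) \<and>
      (\<forall>e\<in>X. \<forall>e'\<in>X. e \<noteq> e' \<longrightarrow> Ed e \<inter> Ed e' \<subseteq> w ` verts \<Gamma>)" if "finite X" "X \<subseteq> hedges \<Gamma>" for X
    using that
  proof (induction X rule: finite_induct)
    case (insert x X)
    then obtain Ed where Ed: "\<forall>e\<in>X. Ed e \<in> E \<and> Ed e \<inter> w ` verts \<Gamma> = w ` e \<and> Ed e \<inter> W = {}"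
      "\<forall>e\<in>X. \<forall>e'\<in>X. e \<noteq> e' \<longrightarrow> Ed e \<inter> Ed e' \<subseteq> w ` verts \<Gamma>" by auto
    define W' where "W' = W \<union> w ` verts \<Gamma> \<union> (\<Union>e\<in>X. Ed e)"
    have fW': "finite W'" unfolding W'_def using W \<Gamma> insert Ed E by auto
    have "card W' \<le> card (W \<union> w ` verts \<Gamma>) + card (\<Union>e\<in>X. Ed e)" unfolding W'_def by (rule card_Un_le)
    also have "card (W \<union> w ` verts \<Gamma>) \<le> card W + card (w ` verts \<Gamma>)" by (rule card_Un_le)
    also have "card (w ` verts \<Gamma>) \<le> card (verts \<Gamma>)" using \<Gamma> by (intro card_image_le)
    also have "card (\<Union>e\<in>X. Ed e) \<le> (\<Sum>e\<in>X. card (Ed e))" using insert by (intro card_UN_le)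
    also have "\<dots> = r * card X" using Ed E by simp
    also have "\<dots> \<le> r * card (hedges \<Gamma>)" using insert \<Gamma> card_mono[of "hedges \<Gamma>" X] by simp
    finally have cW': "card W' < N" using W by simp
    obtain e0 where e0: "e0 \<in> E" "w ` x \<subseteq> e0" using w(3)[of x] insert by auto
    then obtain e where e: "e \<in> E" "w ` x \<subseteq> e" "(e - w ` x) \<inter> W' = {}"
      using full_avoid[OF E r full fW' cW' e0] by auto
    have xv: "w ` x \<subseteq> w ` verts \<Gamma>" using \<Gamma>(3)[of x] insert by auto
    have a: "e \<inter> w ` verts \<Gamma> = w ` x" "e \<inter> W = {}" using e xv w(2) unfolding W'_def by blast+
    have b: "e \<inter> Ed e' \<subseteq> w ` verts \<Gamma>" "Ed e' \<inter> e \<subseteq> w ` verts \<Gamma>" if "e' \<in> X" for e'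
      using e(3) xv that unfolding W'_def by blast+
    show ?case
    proof (rule exI[of _ "Ed(x := e)"], intro conjI)
      show "\<forall>e'\<in>insert x X. (Ed(x := e)) e' \<in> E \<and> (Ed(x := e)) e' \<inter> w ` verts \<Gamma> = w ` e' \<and> (Ed(x := e)) e' \<inter> W = {}"
        using Ed(1) a e(1) by simp
      show "\<forall>c\<in>insert x X. \<forall>c'\<in>insert x X. c \<noteq> c' \<longrightarrow> (Ed(x := e)) c \<inter> (Ed(x := e)) c' \<subseteq> w ` verts \<Gamma>"
        using Ed(2) b by simp
    qed
  qed simp
  from this[OF \<Gamma>(2) order_refl] obtain Ed where Ed: "\<forall>e\<in>hedges \<Gamma>. Ed e \<in> E \<and> Ed e \<inter> w ` verts \<Gamma> = w ` e \<and> Ed e \<inter> W = {}"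
      "\<forall>e\<in>hedges \<Gamma>. \<forall>e'\<in>hedges \<Gamma>. e \<noteq> e' \<longrightarrow> Ed e \<inter> Ed e' \<subseteq> w ` verts \<Gamma>" by blast
  have "spans E (expansion r \<Gamma>) (w ` verts \<Gamma> \<union> \<Union>(Ed ` hedges \<Gamma>))"
    using Ed E \<Gamma> w by (intro spans_expansion) auto
  moreover have "(w ` verts \<Gamma> \<union> \<Union>(Ed ` hedges \<Gamma>)) \<inter> W = {}" using Ed w by auto
  ultimately show ?thesis by blast
qed

section \<open>Expansions inside a block\<close>

lemma transversal_shift: "transversal d (\<lambda>i a. \<phi> i (k + a)) g = transversal d \<phi> (\<lambda>i. k + g i)"
  unfolding transversal_def ..

text \<open>Everything, apart from constants, that a copy built inside a block can use.\<close>

definition reach :: "nat \<Rightarrow> nat \<Rightarrow> (nat \<Rightarrow> nat \<Rightarrow> 'a) \<Rightarrow> ('a set \<Rightarrow> 'a set) \<Rightarrow> 'a set" where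
  "reach d m \<phi> L = grid d m \<phi> \<union> (\<Union>g\<in>{..<d} \<rightarrow> {..<m}. L (transversal d \<phi> g))"

context block
begin

lemma phi_eq_iff: "i < d \<Longrightarrow> a < m \<Longrightarrow> j < d \<Longrightarrow> b < m \<Longrightarrow> \<phi> i a = \<phi> j b \<longleftrightarrow> i = j \<and> a = b"
  using inj unfolding inj_on_def by auto

lemma phi_grid: "i < d \<Longrightarrow> a < m \<Longrightarrow> \<phi> i a \<in> grid d m \<phi>"
  unfolding grid_def by force

lemma transversal_subset: "g \<in> {..<d} \<rightarrow> {..<m} \<Longrightarrow> transversal d \<phi> g \<subseteq> grid d m \<phi>"
  unfolding transversal_def using phi_grid by auto

lemma finite_transversal: "finite (transversal d \<phi> g)"
  unfolding transversal_def by simp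

lemma card_transversal:
  assumes "g \<in> {..<d} \<rightarrow> {..<m}" shows "card (transversal d \<phi> g) = d"
proof -
  have "inj_on (\<lambda>i. \<phi> i (g i)) {..<d}" using assms phi_eq_iff by (auto simp: inj_on_def Pi_iff)
  then show ?thesis unfolding transversal_def by (simp add: card_image)
qed

lemma mem_transversal: "g \<in> {..<d} \<rightarrow> {..<m} \<Longrightarrow> i < d \<Longrightarrow> a < m \<Longrightarrow> \<phi> i a \<in> transversal d \<phi> g \<longleftrightarrow> g i = a"
  unfolding transversal_def using phi_eq_iff by (auto simp: Pi_iff)

lemma block_shift:
  assumes "k + m' \<le> m"
  shows "block E d m' C q (\<lambda>i a. \<phi> i (k + a)) L"
proof -
  have sh: "(\<lambda>i. k + g i) \<in> {..<d} \<rightarrow> {..<m}" if "g \<in> {..<d} \<rightarrow> {..<m'}" for g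
  proof
    fix i assume "i \<in> {..<d}"
    then have "g i \<in> {..<m'}" using that by (rule funcset_mem[rotated])
    then show "k + g i \<in> {..<m}" using assms by simp
  qed
  have gr: "grid d m' (\<lambda>i a. \<phi> i (k + a)) \<subseteq> grid d m \<phi>"
    unfolding grid_def using assms by (force simp: image_iff)
  show ?thesis
  proof (unfold_locales, unfold transversal_shift)
    show "inj_on (\<lambda>(i, a). \<phi> i (k + a)) ({..<d} \<times> {..<m'})"
      using phi_eq_iff assms by (auto simp: inj_on_def)
    show "grid d m' (\<lambda>i a. \<phi> i (k + a)) \<inter> C = {}" using gr gridC by blast
    fix g assume g: "g \<in> {..<d} \<rightarrow> {..<m'}"
    show "L (transversal d \<phi> (\<lambda>i. k + g i)) \<inter> grid d m' (\<lambda>i a. \<phi> i (k + a)) = {}"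
      using list_grid[OF sh[OF g]] gr by blast
    show "L (transversal d \<phi> (\<lambda>i. k + g i)) \<inter> L (transversal d \<phi> (\<lambda>i. k + h i)) = {}"
      if "h \<in> {..<d} \<rightarrow> {..<m'}" "\<And>i. i < d \<Longrightarrow> g i \<noteq> h i" for h
      using that by (intro list_disj sh g) auto
  qed (use sh const_edge list_edge list_fin list_card list_C finC in auto)
qed

text \<open>Transversals from disjoint windows of positions differ in every class, so
  \<open>list_disj\<close> applies. A long block thus splits into independent short ones.\<close>

lemma reach_shift_disjoint:
  assumes "k + m' \<le> k'" "k' + m' \<le> m"
  shows "reach d m' (\<lambda>i a. \<phi> i (k + a)) L \<inter> reach d m' (\<lambda>i a. \<phi> i (k' + a)) L = {}"
proof -
  have sh: "(\<lambda>i. k + g i) \<in> {..<d} \<rightarrow> {..<m}" "(\<lambda>i. k' + g i) \<in> {..<d} \<rightarrow> {..<m}"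
    if "g \<in> {..<d} \<rightarrow> {..<m'}" for g
  proof -
    have "g i < m'" if "i < d" for i using funcset_mem[OF \<open>g \<in> {..<d} \<rightarrow> {..<m'}\<close>, of i] that by simp
    then show "(\<lambda>i. k + g i) \<in> {..<d} \<rightarrow> {..<m}" "(\<lambda>i. k' + g i) \<in> {..<d} \<rightarrow> {..<m}" using assms by force+
  qed
  have 1: "grid d m' (\<lambda>i a. \<phi> i (k + a)) \<inter> grid d m' (\<lambda>i a. \<phi> i (k' + a)) = {}"
    using phi_eq_iff assms unfolding grid_def by auto
  have 2: "grid d m' (\<lambda>i a. \<phi> i (k + a)) \<subseteq> grid d m \<phi>" "grid d m' (\<lambda>i a. \<phi> i (k' + a)) \<subseteq> grid d m \<phi>"
    unfolding grid_def using assms by (force simp: image_iff)+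
  have 3: "L (transversal d \<phi> (\<lambda>i. k + g i)) \<inter> L (transversal d \<phi> (\<lambda>i. k' + h i)) = {}"
    if "g \<in> {..<d} \<rightarrow> {..<m'}" "h \<in> {..<d} \<rightarrow> {..<m'}" for g h
  proof (rule list_disj)
    fix i assume "i < d"
    then have "g i < m'" using funcset_mem[OF that(1), of i] by simp
    then show "k + g i \<noteq> k' + h i" using assms by simp
  qed (use sh that in auto)
  have 4: "L (transversal d \<phi> (\<lambda>i. k + g i)) \<inter> grid d m \<phi> = {}" "L (transversal d \<phi> (\<lambda>i. k' + g i)) \<inter> grid d m \<phi> = {}"
    if "g \<in> {..<d} \<rightarrow> {..<m'}" for g by (rule list_grid[OF sh(1)[OF that]], rule list_grid[OF sh(2)[OF that]])
  show ?thesis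
  proof (rule equals0I)
    fix x assume "x \<in> reach d m' (\<lambda>i a. \<phi> i (k + a)) L \<inter> reach d m' (\<lambda>i a. \<phi> i (k' + a)) L"
    then have "x \<in> grid d m' (\<lambda>i a. \<phi> i (k + a)) \<or> (\<exists>g\<in>{..<d} \<rightarrow> {..<m'}. x \<in> L (transversal d \<phi> (\<lambda>i. k + g i)))"
      "x \<in> grid d m' (\<lambda>i a. \<phi> i (k' + a)) \<or> (\<exists>g\<in>{..<d} \<rightarrow> {..<m'}. x \<in> L (transversal d \<phi> (\<lambda>i. k' + g i)))"
      unfolding reach_def transversal_shift by auto
    then show False
    proof (elim disjE bexE)
      fix g h assume "g \<in> {..<d} \<rightarrow> {..<m'}" "h \<in> {..<d} \<rightarrow> {..<m'}"
        "x \<in> L (transversal d \<phi> (\<lambda>i. k + g i))" "x \<in> L (transversal d \<phi> (\<lambda>i. k' + h i))"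
      then show False using 3[of g h] by auto
    next
      fix g assume "g \<in> {..<d} \<rightarrow> {..<m'}" "x \<in> L (transversal d \<phi> (\<lambda>i. k + g i))" "x \<in> grid d m' (\<lambda>i a. \<phi> i (k' + a))"
      then show False using 4(1)[of g] 2(2) by auto
    next
      fix g assume "g \<in> {..<d} \<rightarrow> {..<m'}" "x \<in> L (transversal d \<phi> (\<lambda>i. k' + g i))" "x \<in> grid d m' (\<lambda>i a. \<phi> i (k + a))"
      then show False using 4(2)[of g] 2(1) by auto
    qed (use 1 in auto)
  qed
qed

text \<open>Pigeonhole: \<open>card W + 1\<close> windows have pairwise disjoint reach, and a vertex
  of \<open>W\<close> spoils at most one.\<close>

lemma clean_shift:
  assumes W: "finite W" and m: "m' * (card W + 1) \<le> m"
  shows "\<exists>k. k + m' \<le> m \<and> reach d m' (\<lambda>i a. \<phi> i (k + a)) L \<inter> W = {}"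
proof (rule ccontr)
  assume "\<not> ?thesis"
  then have no: "reach d m' (\<lambda>i a. \<phi> i (k + a)) L \<inter> W \<noteq> {}" if "k + m' \<le> m" for k using that by blast
  have km: "j * m' + m' \<le> m" if "j \<le> card W" for j
  proof -
    have "j * m' + m' = m' * (j + 1)" by simp
    also have "\<dots> \<le> m' * (card W + 1)" using that by (intro mult_le_mono) auto
    finally show ?thesis using m by (rule order_trans)
  qed
  have "\<exists>w\<in>W. w \<in> reach d m' (\<lambda>i a. \<phi> i (j * m' + a)) L" if "j \<le> card W" for j
    using no[OF km[OF that]] by blast
  then obtain f where f: "\<And>j. j \<le> card W \<Longrightarrow> f j \<in> W \<and> f j \<in> reach d m' (\<lambda>i a. \<phi> i (j * m' + a)) L" by metis
  have lt: "f i \<noteq> f j" if "i < j" "j \<le> card W" for i j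
  proof -
    have "i * m' + m' \<le> j * m'" using that mult_le_mono1[of "Suc i" j m'] by simp
    then show ?thesis using reach_shift_disjoint[of "i * m'" m' "j * m'"] km[OF that(2)] f[of i] f[of j] that by fastforce
  qed
  have "inj_on f {..card W}"
    by (rule inj_onI) (metis atMost_iff linorder_neqE_nat lt)
  moreover have "f ` {..card W} \<subseteq> W" using f by auto
  ultimately have "card {..card W} \<le> card W" using W by (rule card_inj_on_le)
  then show False by simp
qed

text \<open>Turns a construction valid in every short block into the robust form that
  \<open>greedy_pack\<close> asks for: it is carried out in a window untouched by \<open>W\<close>,
  with no constants outside the reserved set \<open>C'\<close>.\<close>

lemma robust_copy:
  assumes W: "finite W" and m: "m' * (card W + 1) \<le> m" and C': "C' \<subseteq> C" "W \<inter> C' = {}"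
    and loc: "\<And>\<psi>. block E d m' C q \<psi> L \<Longrightarrow> \<exists>U. spans E H U \<and> U \<subseteq> C' \<union> reach d m' \<psi> L"
  shows "\<exists>U. spans E H U \<and> U \<inter> W = {} \<and> U \<inter> C \<subseteq> C'"
proof -
  obtain k where k: "k + m' \<le> m" "reach d m' (\<lambda>i a. \<phi> i (k + a)) L \<inter> W = {}"
    using clean_shift[OF W m] by blast
  interpret b: block E d m' C q "\<lambda>i a. \<phi> i (k + a)" L by (rule block_shift[OF k(1)])
  obtain U where U: "spans E H U" "U \<subseteq> C' \<union> reach d m' (\<lambda>i a. \<phi> i (k + a)) L"
    using loc[OF b.block_axioms] by blast
  have "reach d m' (\<lambda>i a. \<phi> i (k + a)) L \<inter> C = {}"
    unfolding reach_def using b.gridC b.list_C by blast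
  then show ?thesis using U k C' by blast
qed

text \<open>Vertices in \<open>S\<close> are sent to constants; every other vertex \<open>v\<close> to position \<open>\<iota> v\<close> of the class
  \<open>\<chi> v\<close>. The classes not used by an edge are filled at a position private to that edge, and an
  edge missing \<open>S\<close> is completed by a vertex from its list or by an unused constant.\<close>

lemma spans_from_block:
  assumes \<Gamma>: "finite (hedges \<Gamma>)" "\<And>e. e \<in> hedges \<Gamma> \<Longrightarrow> e \<subseteq> verts \<Gamma> \<and> card e = 2"
    and S: "S \<subseteq> verts \<Gamma>" "\<And>e. e \<in> hedges \<Gamma> \<Longrightarrow> card (e \<inter> S) \<le> 1"
    and \<kappa>: "inj_on \<kappa> S" "\<kappa> ` S \<subseteq> C"
    and Cx: "Cx \<subseteq> C" "Cx \<inter> \<kappa> ` S = {}"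
    and m: "nv + card (hedges \<Gamma>) \<le> m"
    and \<iota>: "\<And>v. v \<in> verts \<Gamma> \<Longrightarrow> \<iota> v < nv" "inj_on \<iota> (verts \<Gamma>)"
    and \<chi>: "\<And>v. v \<in> verts \<Gamma> \<Longrightarrow> \<chi> v < d" "\<And>e. e \<in> hedges \<Gamma> \<Longrightarrow> inj_on \<chi> (e - S)"
    and sdr: "\<And>A. (\<And>e. e \<in> hedges \<Gamma> \<Longrightarrow> e \<inter> S = {} \<Longrightarrow> finite (A e) \<and> card (A e) = q) \<Longrightarrow>
       (\<And>e e'. e \<in> hedges \<Gamma> \<Longrightarrow> e \<inter> S = {} \<Longrightarrow> e' \<in> hedges \<Gamma> \<Longrightarrow> e' \<inter> S = {} \<Longrightarrow> e \<inter> e' = {} \<Longrightarrow> A e \<inter> A e' = {}) \<Longrightarrow>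
       \<exists>x. inj_on x {e \<in> hedges \<Gamma>. e \<inter> S = {}} \<and> (\<forall>e\<in>hedges \<Gamma>. e \<inter> S = {} \<longrightarrow> x e \<in> A e \<union> Cx)"
  shows "\<exists>U. spans E (expansion (d + 1) \<Gamma>) U \<and> U \<subseteq> (\<kappa> ` S \<union> Cx) \<union> reach d m \<phi> L"
proof -
  obtain \<eta>0 where \<eta>0: "bij_betw \<eta>0 (hedges \<Gamma>) {..<card (hedges \<Gamma>)}"
    using ex_bij_betw_finite_nat[OF \<Gamma>(1)] by (auto simp: atLeast0LessThan)
  \<comment> \<open>Graph vertices occupy positions below \<open>nv\<close>; each later position
    belongs to one edge and fills the classes that this edge leaves open.\<close>
  define \<eta> where "\<eta> e = nv + \<eta>0 e" for e
  have \<eta>: "\<eta> e < m" "\<eta> e \<ge> nv" if "e \<in> hedges \<Gamma>" for e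
    using bij_betwE[OF \<eta>0] that m unfolding \<eta>_def by fastforce+
  have \<eta>inj: "\<eta> e = \<eta> e' \<Longrightarrow> e = e'" if "e \<in> hedges \<Gamma>" "e' \<in> hedges \<Gamma>" for e e'
    using \<eta>0 that unfolding \<eta>_def by (auto simp: bij_betw_def inj_on_def)
  define gE where "gE e i = (if \<exists>v\<in>e - S. \<chi> v = i then \<iota> (SOME v. v \<in> e - S \<and> \<chi> v = i) else \<eta> e)" for e i
  have gE1: "gE e (\<chi> v) = \<iota> v" if "e \<in> hedges \<Gamma>" "v \<in> e - S" for e v
  proof -
    have "(SOME u. u \<in> e - S \<and> \<chi> u = \<chi> v) = v"
    proof (rule some_equality)
      show "v \<in> e - S \<and> \<chi> v = \<chi> v" using that by auto
      fix u assume "u \<in> e - S \<and> \<chi> u = \<chi> v"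
      then show "u = v" using \<chi>(2)[OF that(1)] that(2) unfolding inj_on_def by blast
    qed
    then show ?thesis unfolding gE_def using that(2) by auto
  qed
  have gE2: "(\<exists>v\<in>e - S. \<chi> v = i \<and> gE e i = \<iota> v) \<or> gE e i = \<eta> e" if "e \<in> hedges \<Gamma>" for e i
  proof (cases "\<exists>v\<in>e - S. \<chi> v = i")
    case True
    then show ?thesis using gE1[OF that] by blast
  qed (simp add: gE_def)
  have ev: "v \<in> verts \<Gamma>" if "e \<in> hedges \<Gamma>" "v \<in> e - S" for e v using \<Gamma>(2) that by blast
  have gPi: "gE e \<in> {..<d} \<rightarrow> {..<m}" if "e \<in> hedges \<Gamma>" for e
  proof
    fix i
    have "\<iota> v < m" if "v \<in> e - S" for v using \<iota>(1)[OF ev[OF \<open>e \<in> hedges \<Gamma>\<close> that]] m by simp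
    then show "gE e i \<in> {..<m}" using gE2[OF that, of i] \<eta>[OF that] by auto
  qed
  define T where "T e = transversal d \<phi> (gE e)" for e
  \<comment> \<open>As filling positions are private, transversals of different edges share only
    images of common vertices. Those of disjoint edges hence differ in every class and have disjoint
    lists, the only disjointness handed to \<open>sdr\<close>.\<close>
  have meet: "\<exists>v\<in>(e - S) \<inter> (e' - S). y = \<phi> (\<chi> v) (\<iota> v)"
    if e: "e \<in> hedges \<Gamma>" "e' \<in> hedges \<Gamma>" "e \<noteq> e'" and y: "y \<in> T e" "y \<in> T e'" for e e' y
  proof -
    obtain i where i: "i < d" "y = \<phi> i (gE e i)" using y(1) unfolding T_def transversal_def by auto
    have gi: "gE e i < m" "gE e' i < m" using gPi e i by (auto simp: Pi_iff)
    have eq: "gE e' i = gE e i" using y(2) i gi mem_transversal[OF gPi[OF e(2)] i(1) gi(1)] unfolding T_def by simp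
    have lt: "\<iota> v < nv" if "v \<in> e - S \<or> v \<in> e' - S" for v using \<iota>(1) ev e that by blast
    show ?thesis using gE2[OF e(1), of i] gE2[OF e(2), of i]
    proof (elim disjE bexE conjE)
      fix v v' assume v: "v \<in> e - S" "\<chi> v = i" "gE e i = \<iota> v" "v' \<in> e' - S" "\<chi> v' = i" "gE e' i = \<iota> v'"
      then have "v = v'" using eq \<iota>(2) ev e by (metis inj_onD)
      then show ?thesis using v i by auto
    next
      fix v assume "v \<in> e - S" "gE e i = \<iota> v" "gE e' i = \<eta> e'"
      then have False using eq \<eta>(2)[OF e(2)] lt[of v] by simp
      then show ?thesis ..
    next
      fix v assume "gE e i = \<eta> e" "v \<in> e' - S" "gE e' i = \<iota> v"
      then have False using eq \<eta>(2)[OF e(1)] lt[of v] by simp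
      then show ?thesis ..
    next
      assume "gE e i = \<eta> e" "gE e' i = \<eta> e'"
      then show ?thesis using eq \<eta>inj[OF e(1,2)] e(3) by simp
    qed
  qed
  have tdisj: "L (T e) \<inter> L (T e') = {}" if "e \<in> hedges \<Gamma>" "e' \<in> hedges \<Gamma>" "e \<inter> e' = {}" for e e'
    unfolding T_def
  proof (rule list_disj[OF gPi gPi])
    fix i assume i: "i < d"
    have "e \<noteq> e'" using that \<Gamma>(2)[OF that(1)] by auto
    show "gE e i \<noteq> gE e' i"
    proof
      assume eq: "gE e i = gE e' i"
      have "\<phi> i (gE e i) \<in> T e" "\<phi> i (gE e' i) \<in> T e'"
        unfolding T_def transversal_def using i by auto
      then have "\<phi> i (gE e i) \<in> T e" "\<phi> i (gE e i) \<in> T e'" by (simp_all only: eq)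
      then show False using meet[OF that(1,2) \<open>e \<noteq> e'\<close>] that(3) by blast
    qed
  qed (use that in auto)
  have "\<exists>x. inj_on x {e \<in> hedges \<Gamma>. e \<inter> S = {}} \<and> (\<forall>e\<in>hedges \<Gamma>. e \<inter> S = {} \<longrightarrow> x e \<in> L (T e) \<union> Cx)"
    using list_fin[OF gPi] list_card[OF gPi] tdisj unfolding T_def by (intro sdr) auto
  then obtain x where x: "inj_on x {e \<in> hedges \<Gamma>. e \<inter> S = {}}" "\<And>e. e \<in> hedges \<Gamma> \<Longrightarrow> e \<inter> S = {} \<Longrightarrow> x e \<in> L (T e) \<union> Cx"
    by blast
  define w where "w v = (if v \<in> S then \<kappa> v else \<phi> (\<chi> v) (\<iota> v))" for v
  \<comment> \<open>A transversal is one vertex short of a hyperedge. The missing vertex is the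
    constant for the unique vertex of \<open>e\<close> in \<open>S\<close>, or else the
    representative of \<open>e\<close>.\<close>
  define ap where "ap e = (if e \<inter> S = {} then x e else \<kappa> (the_elem (e \<inter> S)))" for e
  define Ed where "Ed e = insert (ap e) (T e)" for e
  have \<iota>m: "\<iota> v < m" if "v \<in> verts \<Gamma>" for v using \<iota>(1)[OF that] m by simp
  have wg: "w v \<in> grid d m \<phi>" if "v \<in> verts \<Gamma>" "v \<notin> S" for v
    unfolding w_def using that \<chi>(1) \<iota>m phi_grid by simp
  have wC: "w v \<in> C" if "v \<in> S" for v unfolding w_def using that \<kappa> by auto
  have Tg: "T e \<subseteq> grid d m \<phi>" if "e \<in> hedges \<Gamma>" for e unfolding T_def by (rule transversal_subset[OF gPi[OF that]])
  have apS: "\<exists>v. e \<inter> S = {v} \<and> ap e = \<kappa> v" if "e \<in> hedges \<Gamma>" "e \<inter> S \<noteq> {}" for e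
  proof -
    have "finite e" using \<Gamma>(2)[OF that(1)] by (auto intro: card_ge_0_finite)
    then have "card (e \<inter> S) = 1" using S(2)[OF that(1)] that(2)
      by (metis One_nat_def Suc_leI card_gt_0_iff finite_Int le_antisym)
    then obtain v where "e \<inter> S = {v}" by (meson card_1_singletonE)
    then show ?thesis unfolding ap_def by auto
  qed
  have apC: "ap e \<in> L (T e) \<union> C" if "e \<in> hedges \<Gamma>" for e
  proof (cases "e \<inter> S = {}")
    case True
    then show ?thesis using x(2)[OF that] Cx unfolding ap_def by auto
  next
    case False
    then show ?thesis using apS[OF that] \<kappa> by auto
  qed
  have LC: "L (T e) \<inter> C = {}" "L (T e) \<inter> grid d m \<phi> = {}" if "e \<in> hedges \<Gamma>" for e
    unfolding T_def using list_C[OF gPi] list_grid[OF gPi] that by auto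
  have apg: "ap e \<notin> grid d m \<phi>" if "e \<in> hedges \<Gamma>" for e using apC[OF that] gridC LC[OF that] by blast
  have winj: "inj_on w (verts \<Gamma>)"
  proof (rule inj_onI)
    fix u v assume uv: "u \<in> verts \<Gamma>" "v \<in> verts \<Gamma>" "w u = w v"
    consider "u \<in> S" "v \<in> S" | "u \<notin> S" "v \<notin> S" | "u \<in> S" "v \<notin> S" | "u \<notin> S" "v \<in> S" by blast
    then show "u = v"
    proof cases
      case 1 then show ?thesis using uv \<kappa>(1) unfolding w_def by (auto simp: inj_on_def)
    next
      case 2
      then have "\<iota> u = \<iota> v" using uv phi_eq_iff[of "\<chi> u" "\<iota> u" "\<chi> v" "\<iota> v"] \<chi>(1) \<iota>m unfolding w_def by auto
      then show ?thesis using \<iota>(2) uv by (auto simp: inj_on_def)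
    next
      case 3 then show ?thesis using wC wg uv gridC by (metis disjoint_iff)
    next
      case 4 then show ?thesis using wC wg uv gridC by (metis disjoint_iff)
    qed
  qed
  have wT: "w v \<in> T e" if "e \<in> hedges \<Gamma>" "v \<in> e - S" for e v
    using gE1[OF that] \<chi>(1)[OF ev[OF that]] that unfolding T_def transversal_def w_def
    by (intro image_eqI[of _ _ "\<chi> v"]) auto
  have Tw: "v \<in> e" if "e \<in> hedges \<Gamma>" "v \<in> verts \<Gamma>" "w v \<in> T e" for e v
  proof (rule ccontr)
    assume v: "v \<notin> e"
    have vS: "v \<notin> S" using wC[of v] Tg[OF that(1)] that(3) gridC by blast
    then have "gE e (\<chi> v) = \<iota> v"
      using that(3) mem_transversal[OF gPi[OF that(1)] \<chi>(1)[OF that(2)] \<iota>m[OF that(2)]] unfolding T_def w_def by simp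
    then show False using gE2[OF that(1), of "\<chi> v"] \<eta>[OF that(1)] \<iota>(1)[OF that(2)] v ev[OF that(1)]
      by (metis DiffD1 \<iota>(2) inj_onD leD that(2))
  qed
  have "spans E (expansion (d + 1) \<Gamma>) (w ` verts \<Gamma> \<union> \<Union>(Ed ` hedges \<Gamma>))"
  proof (rule spans_expansion[OF winj \<Gamma>(2)])
    fix e assume e: "e \<in> hedges \<Gamma>"
    have "Ed e \<in> E" using apC[OF e] const_edge[OF gPi[OF e]] list_edge[OF gPi[OF e]] unfolding Ed_def T_def by auto
    moreover have "finite (Ed e)" unfolding Ed_def T_def using finite_transversal by simp
    moreover have "card (Ed e) = d + 1" unfolding Ed_def using apg[OF e] Tg[OF e] card_transversal[OF gPi[OF e]]
      by (subst card_insert_disjoint) (auto simp: T_def finite_transversal)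
    moreover have "Ed e \<inter> w ` verts \<Gamma> = w ` e"
    proof
      show "w ` e \<subseteq> Ed e \<inter> w ` verts \<Gamma>"
      proof (rule image_subsetI)
        fix v assume v: "v \<in> e"
        have "w v \<in> Ed e"
        proof (cases "v \<in> S")
          case True
          then obtain u where "e \<inter> S = {u}" "ap e = \<kappa> u" using apS[OF e] v by blast
          then have "ap e = w v" using v True unfolding w_def by auto
          then show ?thesis unfolding Ed_def by simp
        qed (use wT[OF e] v in \<open>simp add: Ed_def\<close>)
        then show "w v \<in> Ed e \<inter> w ` verts \<Gamma>" using \<Gamma>(2)[OF e] v by auto
      qed
      show "Ed e \<inter> w ` verts \<Gamma> \<subseteq> w ` e"
      proof
        fix y assume "y \<in> Ed e \<inter> w ` verts \<Gamma>"
        then obtain v where v: "v \<in> verts \<Gamma>" "y = w v" "w v = ap e \<or> w v \<in> T e" unfolding Ed_def by auto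
        show "y \<in> w ` e"
        proof (cases "w v \<in> T e")
          case False
          then have va: "w v = ap e" using v by auto
          then have vS: "v \<in> S" using apg[OF e] wg v(1) by metis
          show ?thesis
          proof (cases "e \<inter> S = {}")
            case True
            then have "x e = \<kappa> v" using va vS unfolding ap_def w_def by simp
            then have False using x(2)[OF e True] Cx \<kappa> vS LC[OF e] by blast
            then show ?thesis ..
          next
            case False
            then obtain u where u: "e \<inter> S = {u}" "ap e = \<kappa> u" using apS[OF e] by blast
            then have "w u = y" using va v unfolding w_def by auto
            then show ?thesis using u by blast
          qed
        qed (use Tw[OF e v(1)] v in auto)
      qed
    qed
    ultimately show "Ed e \<in> E \<and> finite (Ed e) \<and> card (Ed e) = d + 1 \<and> Ed e \<inter> w ` verts \<Gamma> = w ` e" by blast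
    fix e' assume e': "e' \<in> hedges \<Gamma>" "e \<noteq> e'"
    show "Ed e \<inter> Ed e' \<subseteq> w ` verts \<Gamma>"
    proof
      fix y assume y: "y \<in> Ed e \<inter> Ed e'"
      show "y \<in> w ` verts \<Gamma>"
      proof (cases "y \<in> T e \<and> y \<in> T e'")
        case True
        then obtain v where "v \<in> e - S" "y = \<phi> (\<chi> v) (\<iota> v)" using meet[OF e e'] by blast
        then show ?thesis using ev[OF e] unfolding w_def by auto
      next
        case False
        then have yy: "y = ap e" "y = ap e'"
          using y apg[OF e] apg[OF e'(1)] Tg[OF e] Tg[OF e'(1)] unfolding Ed_def by blast+
        \<comment> \<open>Representatives of different edges missing \<open>S\<close> are distinct,
          so a shared completing vertex must be a constant that represents a graph vertex.\<close>
        have "e \<inter> S \<noteq> {} \<or> e' \<inter> S \<noteq> {}"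
        proof (rule ccontr)
          assume "\<not> ?thesis"
          then have "x e = x e'" "e \<inter> S = {}" "e' \<inter> S = {}" using yy unfolding ap_def by auto
          then show False using x(1) e e' unfolding inj_on_def by blast
        qed
        then obtain f where f: "f \<in> hedges \<Gamma>" "f \<inter> S \<noteq> {}" "y = ap f" using yy e e'(1) by metis
        obtain v where v: "f \<inter> S = {v}" "ap f = \<kappa> v" using apS[OF f(1,2)] by blast
        then have "v \<in> S" "y = w v" using f(3) unfolding w_def by auto
        then show ?thesis using S(1) by auto
      qed
    qed
  qed
  moreover have "w ` verts \<Gamma> \<union> \<Union>(Ed ` hedges \<Gamma>) \<subseteq> (\<kappa> ` S \<union> Cx) \<union> reach d m \<phi> L"
  proof -
    have w1: "w v \<in> \<kappa> ` S \<union> grid d m \<phi>" if "v \<in> verts \<Gamma>" for v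
      using wg[OF that] unfolding w_def by auto
    have a1: "ap e \<in> (\<kappa> ` S \<union> Cx) \<union> L (T e)" if e: "e \<in> hedges \<Gamma>" for e
    proof (cases "e \<inter> S = {}")
      case True
      then show ?thesis using x(2)[OF e] unfolding ap_def by auto
    next
      case False
      then obtain v where "e \<inter> S = {v}" "ap e = \<kappa> v" using apS[OF e] by blast
      then show ?thesis by auto
    qed
    have l1: "L (T e) \<subseteq> reach d m \<phi> L" if "e \<in> hedges \<Gamma>" for e
      unfolding reach_def T_def using gPi[OF that] by blast
    have gr: "grid d m \<phi> \<subseteq> reach d m \<phi> L" unfolding reach_def by simp
    have "w v \<in> (\<kappa> ` S \<union> Cx) \<union> reach d m \<phi> L" if "v \<in> verts \<Gamma>" for v using w1[OF that] gr by auto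
    moreover have "Ed e \<subseteq> (\<kappa> ` S \<union> Cx) \<union> reach d m \<phi> L" if "e \<in> hedges \<Gamma>" for e
      using a1[OF that] l1[OF that] Tg[OF that] gr unfolding Ed_def by auto
    ultimately show ?thesis by (simp add: image_subset_iff UN_subset_iff)
  qed
  ultimately show ?thesis by blast
qed

end

section \<open>Distinct representatives along paths and cycles\<close>

lemma seq_choice:
  fixes A :: "nat \<Rightarrow> 'a set"
  assumes "A 0 \<noteq> {}" and big: "\<And>i. 0 < i \<Longrightarrow> i < n \<Longrightarrow> finite (A i) \<and> card (A i) \<ge> 2 + b"
    and f: "\<And>a. finite (f a) \<and> card (f a) \<le> b"
  shows "\<exists>x. x 0 \<in> A 0 \<and> (\<forall>i. 0 < i \<longrightarrow> i < n \<longrightarrow> x i \<in> A i \<and> x i \<noteq> x (i - 1) \<and> x i \<notin> f (x 0))"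
proof -
  obtain a where a: "a \<in> A 0" using assms by blast
  \<comment> \<open>Greedy choice: each term avoids its predecessor and \<open>f\<close> of the
    first term, at most \<open>b + 1\<close> vertices. The dependence on the first term is for
    cycles, where the last list may meet the first.\<close>
  define x where "x = rec_nat a (\<lambda>i y. SOME v. v \<in> A (Suc i) \<and> v \<noteq> y \<and> v \<notin> f a)"
  have x0: "x 0 = a" unfolding x_def by simp
  have "x (Suc i) \<in> A (Suc i) \<and> x (Suc i) \<noteq> x i \<and> x (Suc i) \<notin> f a" if "Suc i < n" for i
  proof -
    have "card (insert (x i) (f a)) < card (A (Suc i))"
      using big[of "Suc i"] f[of a] that card_insert_le_m1[of "b + 1" "f a" "x i"] by (auto simp: card_insert_if)
    then have "\<not> A (Suc i) \<subseteq> insert (x i) (f a)"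
      using f[of a] by (meson card_mono finite_insert linorder_not_le)
    then have "\<exists>v. v \<in> A (Suc i) \<and> v \<noteq> x i \<and> v \<notin> f a" by blast
    from someI_ex[OF this] show ?thesis unfolding x_def by simp
  qed
  then have "x i \<in> A i \<and> x i \<noteq> x (i - 1) \<and> x i \<notin> f (x 0)" if "0 < i" "i < n" for i
    using that x0 by (cases i) auto
  then show ?thesis using a x0 by (intro exI[of _ x]) auto
qed

lemma inj_on_lessThanI:
  fixes x :: "nat \<Rightarrow> 'a"
  assumes "\<And>i j. i < j \<Longrightarrow> j < n \<Longrightarrow> x i \<noteq> x j"
  shows "inj_on x {..<n}"
  by (rule inj_onI) (metis assms lessThan_iff linorder_neqE_nat)

text \<open>Only neighbouring lists can clash, so avoiding the predecessor is enough and two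
  elements suffice.\<close>

lemma sdr_path:
  fixes A :: "nat \<Rightarrow> 'a set"
  assumes big: "\<And>i. i < n \<Longrightarrow> finite (A i) \<and> card (A i) \<ge> 2"
    and disj: "\<And>i j. i + 2 \<le> j \<Longrightarrow> j < n \<Longrightarrow> A i \<inter> A j = {}"
  shows "\<exists>x. inj_on x {..<n} \<and> (\<forall>i<n. x i \<in> A i)"
proof (cases "n = 0")
  case False
  then have "A 0 \<noteq> {}" using big[of 0] by fastforce
  then obtain x where x0: "x 0 \<in> A 0" and x: "\<forall>i. 0 < i \<longrightarrow> i < n \<longrightarrow> x i \<in> A i \<and> x i \<noteq> x (i - 1) \<and> x i \<notin> {}"
    using seq_choice[of A n 0 "\<lambda>_. {}"] big by auto
  have xA: "x i \<in> A i" if "i < n" for i using x0 x that by (cases i) auto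
  have "inj_on x {..<n}"
  proof (rule inj_on_lessThanI)
    fix i j :: nat assume ij: "i < j" "j < n"
    show "x i \<noteq> x j"
    proof (cases "j = i + 1")
      case True
      then show ?thesis using x[rule_format, of j] ij by auto
    next
      case False
      then show ?thesis using disj[of i j] xA[of i] xA[of j] ij by auto
    qed
  qed
  then show ?thesis using xA by blast
qed simp

text \<open>The first list may meet any other, in a cycle the last one in particular. Its
  representative is therefore forbidden throughout, at the price of a third element.\<close>

lemma sdr_cycle:
  fixes A :: "nat \<Rightarrow> 'a set"
  assumes big: "\<And>i. i < n \<Longrightarrow> finite (A i) \<and> card (A i) \<ge> 3"
    and disj: "\<And>i j. 0 < i \<Longrightarrow> i + 2 \<le> j \<Longrightarrow> j < n \<Longrightarrow> A i \<inter> A j = {}"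
  shows "\<exists>x. inj_on x {..<n} \<and> (\<forall>i<n. x i \<in> A i)"
proof (cases "n = 0")
  case False
  then have "A 0 \<noteq> {}" using big[of 0] by fastforce
  then obtain x where x0: "x 0 \<in> A 0" and x: "\<forall>i. 0 < i \<longrightarrow> i < n \<longrightarrow> x i \<in> A i \<and> x i \<noteq> x (i - 1) \<and> x i \<notin> {x 0}"
    using seq_choice[of A n 1 "\<lambda>a. {a}"] big by auto
  have xA: "x i \<in> A i" if "i < n" for i using x0 x that by (cases i) auto
  have "inj_on x {..<n}"
  proof (rule inj_on_lessThanI)
    fix i j :: nat assume ij: "i < j" "j < n"
    consider "j = i + 1" | "i = 0" | "i > 0" "i + 2 \<le> j" using ij by linarith
    then show "x i \<noteq> x j"
    proof cases
      case 3
      then show ?thesis using disj[of i j] xA[of i] xA[of j] ij by auto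
    qed (use x[rule_format, of j] ij in auto)
  qed
  then show ?thesis using xA by blast
qed simp

text \<open>Here the end lists may be singletons. The last representative is chosen in advance and
  forbidden in the interior; it cannot clash with the first, whose list is disjoint from the last
  one for \<open>n \<ge> 3\<close>.\<close>

lemma sdr_ends:
  fixes A :: "nat \<Rightarrow> 'a set"
  assumes n: "n \<ge> 3" and ends: "A 0 \<noteq> {}" "A (n - 1) \<noteq> {}"
    and big: "\<And>i. 0 < i \<Longrightarrow> i < n - 1 \<Longrightarrow> finite (A i) \<and> card (A i) \<ge> 3"
    and disj: "\<And>i j. i + 2 \<le> j \<Longrightarrow> j < n \<Longrightarrow> A i \<inter> A j = {}"
  shows "\<exists>x. inj_on x {..<n} \<and> (\<forall>i<n. x i \<in> A i)"
proof -
  obtain y where y: "y \<in> A (n - 1)" using ends by blast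
  obtain x where x0: "x 0 \<in> A 0" and x: "\<forall>i. 0 < i \<longrightarrow> i < n - 1 \<longrightarrow> x i \<in> A i \<and> x i \<noteq> x (i - 1) \<and> x i \<noteq> y"
    using seq_choice[of A "n - 1" 1 "\<lambda>_. {y}"] big ends by auto
  define x' where "x' = x(n - 1 := y)"
  have x'A: "x' i \<in> A i" if "i < n" for i using x0 x y that unfolding x'_def by (cases "i = 0") auto
  have "inj_on x' {..<n}"
  proof (rule inj_on_lessThanI)
    fix i j :: nat assume ij: "i < j" "j < n"
    show "x' i \<noteq> x' j"
    proof (cases "j = i + 1")
      case j: True
      show ?thesis
      proof (cases "j = n - 1")
        case True
        then have "0 < i" "i < n - 1" using j n by auto
        then show ?thesis using x True unfolding x'_def by auto
      next
        case False
        then have "0 < j" "j < n - 1" using ij j by auto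
        then have "x j \<noteq> x (j - 1)" "i \<noteq> n - 1" using x j by auto
        then show ?thesis using j False unfolding x'_def by simp
      qed
    next
      case False
      then show ?thesis using disj[of i j] x'A[of i] x'A[of j] ij by auto
    qed
  qed
  then show ?thesis using x'A by blast
qed

text \<open>A value repeated within its row occurs in no other row. If no row has \<open>u\<close> distinct values, then
  fewer than \<open>u\<close> cells of each row carry unrepeated values, so some column is mostly free of them.\<close>

lemma grid_row_or_column:
  fixes y :: "nat \<Rightarrow> nat \<Rightarrow> 'a"
  assumes y: "\<And>i j i' j'. i < 2 * u \<Longrightarrow> j < 2 * u \<Longrightarrow> i' < 2 * u \<Longrightarrow> j' < 2 * u \<Longrightarrow> i \<noteq> i' \<Longrightarrow> j \<noteq> j' \<Longrightarrow> y i j \<noteq> y i' j'"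
    and u: "u \<ge> 1"
  shows "(\<exists>i<2*u. \<exists>J\<subseteq>{..<2*u}. card J = u \<and> inj_on (y i) J) \<or> (\<exists>j<2*u. \<exists>J\<subseteq>{..<2*u}. card J = u \<and> inj_on (\<lambda>i. y i j) J)"
proof (rule ccontr)
  assume no: "\<not> ?thesis"
  define n where "n = 2 * u"
  define B where "B i = {j. j < n \<and> (\<forall>j'<n. j' \<noteq> j \<longrightarrow> y i j' \<noteq> y i j)}" for i
  have fB: "finite (B i)" for i unfolding B_def by simp
  have cB: "card (B i) < u" if "i < n" for i
  proof (rule ccontr)
    assume "\<not> card (B i) < u"
    then obtain J where J: "J \<subseteq> B i" "card J = u" by (meson leI obtain_subset_with_card_n)
    have "inj_on (y i) J" using J unfolding B_def inj_on_def by auto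
    moreover have "J \<subseteq> {..<2 * u}" using J unfolding B_def n_def by auto
    ultimately show False using no that J unfolding n_def by blast
  qed
  have "\<exists>j<n. card {i. i < n \<and> j \<in> B i} < u"
  proof (rule ccontr)
    assume "\<not> ?thesis"
    then have "u \<le> card {i. i < n \<and> j \<in> B i}" if "j \<in> {..<n}" for j
      using that by (metis lessThan_iff not_less)
    then have "n * u \<le> (\<Sum>j<n. card {i. i < n \<and> j \<in> B i})"
      using sum_bounded_below[of "{..<n}" u "\<lambda>j. card {i. i < n \<and> j \<in> B i}"] by simp
    also have "\<dots> = card (SIGMA j:{..<n}. {i. i < n \<and> j \<in> B i})" by simp
    also have "\<dots> = card (SIGMA i:{..<n}. B i)"
      by (rule bij_betw_same_card[of prod.swap]) (auto simp: bij_betw_def inj_on_def B_def image_iff)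
    also have "\<dots> = (\<Sum>i<n. card (B i))" using fB by simp
    also have "\<dots> < (\<Sum>i<n. u)" using cB u n_def by (intro sum_strict_mono) (auto simp: lessThan_empty_iff)
    finally show False by simp
  qed
  then obtain j where j: "j < n" "card {i. i < n \<and> j \<in> B i} < u" by blast
  have "{i. i < n \<and> j \<notin> B i} = {..<n} - {i. i < n \<and> j \<in> B i}" by auto
  then have "card {i. i < n \<and> j \<notin> B i} = n - card {i. i < n \<and> j \<in> B i}"
    by (simp add: card_Diff_subset subset_iff)
  then have "u \<le> card {i. i < n \<and> j \<notin> B i}" using j n_def by simp
  then obtain J where J: "J \<subseteq> {i. i < n \<and> j \<notin> B i}" "card J = u" by (meson obtain_subset_with_card_n)
  have "inj_on (\<lambda>i. y i j) J"
  proof (rule inj_onI, rule ccontr)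
    fix a b assume ab: "a \<in> J" "b \<in> J" "y a j = y b j" "a \<noteq> b"
    then have "a < n" "b < n" "j \<notin> B a" using J by auto
    then obtain j' where "j' < n" "j' \<noteq> j" "y a j' = y a j" using j unfolding B_def by blast
    then show False using y[of a j' b j] ab j \<open>a < n\<close> \<open>b < n\<close> unfolding n_def by auto
  qed
  then show False using no J j unfolding n_def by blast
qed

text \<open>In each hyperedge any vertex other than the centre \<open>c\<close> can serve as the
  leaf; the rest become expansion vertices.\<close>

lemma spans_star:
  assumes u: "u \<ge> 1" and r: "r \<ge> 2"
    and X: "\<And>v. v \<in> {1..u} \<Longrightarrow> X v \<in> E \<and> finite (X v) \<and> card (X v) = r \<and> c \<in> X v"
    and disj: "\<And>v v'. v \<in> {1..u} \<Longrightarrow> v' \<in> {1..u} \<Longrightarrow> v \<noteq> v' \<Longrightarrow> X v \<inter> X v' = {c}"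
  shows "spans E (expansion r (star_graph u)) (\<Union>v\<in>{1..u}. X v)"
proof -
  have "\<exists>y. y \<in> X v \<and> y \<noteq> c" if "v \<in> {1..u}" for v
  proof (rule ccontr)
    assume "\<not> ?thesis"
    then have "X v = {c}" using X[OF that] by auto
    then show False using X[OF that] r by simp
  qed
  then obtain y where y: "\<And>v. v \<in> {1..u} \<Longrightarrow> y v \<in> X v \<and> y v \<noteq> c" by metis
  define w where "w v = (if v = 0 then c else y v)" for v :: nat
  have yy: "v = v'" if "v \<in> {1..u}" "v' \<in> {1..u}" "y v \<in> X v'" for v v'
    using disj[OF that(1,2)] y[OF that(1)] that(3) by auto
  have v: "verts (star_graph u) = {..u}" and h: "hedges (star_graph u) = (\<lambda>v. {0, v}) ` {1..u}"
    unfolding star_graph_def by auto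
  \<comment> \<open>The maximum of the edge \<open>{0, v}\<close> is its leaf
    \<open>v\<close>.\<close>
  define Ed where "Ed e = X (Max e)" for e :: "nat set"
  have Ed: "Ed {0, v} = X v" for v unfolding Ed_def by simp
  have "spans E (expansion r (star_graph u)) (w ` verts (star_graph u) \<union> \<Union>(Ed ` hedges (star_graph u)))"
  proof (rule spans_expansion)
    show "inj_on w (verts (star_graph u))"
      unfolding v
    proof (rule inj_onI)
      fix a b assume ab: "a \<in> {..u}" "b \<in> {..u}" "w a = w b"
      show "a = b"
      proof (cases "a = 0 \<or> b = 0")
        case True
        then show ?thesis using ab y[of a] y[of b] unfolding w_def by (auto split: if_splits)
      next
        case False
        then have "y a \<in> X b" "a \<in> {1..u}" "b \<in> {1..u}" using ab y[of b] unfolding w_def by auto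
        then show ?thesis using yy by blast
      qed
    qed
    fix e assume "e \<in> hedges (star_graph u)"
    then obtain a where a: "a \<in> {1..u}" "e = {0, a}" unfolding h by blast
    show "e \<subseteq> verts (star_graph u) \<and> card e = 2" using a unfolding v by auto
    have "X a \<inter> w ` {..u} = w ` e"
    proof
      show "w ` e \<subseteq> X a \<inter> w ` {..u}" using a X[OF a(1)] y[OF a(1)] unfolding w_def by auto
      show "X a \<inter> w ` {..u} \<subseteq> w ` e"
      proof
        fix x assume "x \<in> X a \<inter> w ` {..u}"
        then obtain b where b: "b \<le> u" "x = w b" "w b \<in> X a" by auto
        show "x \<in> w ` e"
        proof (cases "b = 0")
          case False
          then have "b = a" using yy[of b a] b a unfolding w_def by simp
          then show ?thesis using b a by auto
        qed (use b a in auto)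
      qed
    qed
    then show "Ed e \<in> E \<and> finite (Ed e) \<and> card (Ed e) = r \<and> Ed e \<inter> w ` verts (star_graph u) = w ` e"
      using X[OF a(1)] a(2) Ed v by simp
    fix e' assume "e' \<in> hedges (star_graph u)" and ne: "e \<noteq> e'"
    then obtain b where b: "b \<in> {1..u}" "e' = {0, b}" unfolding h by blast
    have "Ed e \<inter> Ed e' = {c}" using disj[OF a(1) b(1)] a b ne Ed by auto
    moreover have "c \<in> w ` verts (star_graph u)" unfolding v w_def by (auto intro!: image_eqI[of _ _ 0])
    ultimately show "Ed e \<inter> Ed e' \<subseteq> w ` verts (star_graph u)" by simp
  qed
  moreover have "w ` verts (star_graph u) \<union> \<Union>(Ed ` hedges (star_graph u)) = (\<Union>v\<in>{1..u}. X v)"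
  proof -
    have "\<Union>(Ed ` hedges (star_graph u)) = (\<Union>v\<in>{1..u}. X v)" unfolding h by (simp add: image_image Ed)
    moreover have "w a \<in> (\<Union>v\<in>{1..u}. X v)" if "a \<le> u" for a
    proof (cases "a = 0")
      case True
      then show ?thesis using X[of 1] u unfolding w_def by (auto intro!: bexI[of _ 1])
    next
      case False
      then show ?thesis using y[of a] that unfolding w_def by (auto intro!: bexI[of _ a])
    qed
    ultimately show ?thesis unfolding v by auto
  qed
  ultimately show ?thesis by simp
qed

section \<open>Stars inside a block\<close>

context block
begin

text \<open>Constant position functions give disjoint transversals, and adding \<open>c\<close> to
  each makes it the centre.\<close>

lemma star_with_constant:
  assumes c: "c \<in> C" and u: "u \<ge> 1" "u + 1 \<le> m" and d: "d \<ge> 1"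
  shows "\<exists>U. spans E (expansion (d + 1) (star_graph u)) U \<and> U \<subseteq> {c} \<union> reach d m \<phi> L"
proof -
  define X where "X v = insert c (transversal d \<phi> (\<lambda>_. v))" for v
  have g: "(\<lambda>_. v) \<in> {..<d} \<rightarrow> {..<m}" if "v \<in> {1..u}" for v using that u by auto
  have cn: "c \<notin> transversal d \<phi> (\<lambda>_. v)" if "v \<in> {1..u}" for v
    using transversal_subset[OF g[OF that]] gridC c by blast
  have "spans E (expansion (d + 1) (star_graph u)) (\<Union>v\<in>{1..u}. X v)"
  proof (rule spans_star[OF u(1)])
    fix v assume v: "v \<in> {1..u}"
    show "X v \<in> E \<and> finite (X v) \<and> card (X v) = d + 1 \<and> c \<in> X v"
      unfolding X_def using const_edge[OF g[OF v] c] cn[OF v] card_transversal[OF g[OF v]] finite_transversal by auto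
    fix v' assume v': "v' \<in> {1..u}" "v \<noteq> v'"
    have "transversal d \<phi> (\<lambda>_. v) \<inter> transversal d \<phi> (\<lambda>_. v') = {}"
      using phi_eq_iff v v' u unfolding transversal_def by auto
    then show "X v \<inter> X v' = {c}" unfolding X_def using cn[OF v] cn[OF v'(1)] by auto
  qed (use d in simp)
  moreover have "(\<Union>v\<in>{1..u}. X v) \<subseteq> {c} \<union> reach d m \<phi> L"
  proof (rule UN_least)
    fix v assume "v \<in> {1..u}"
    from transversal_subset[OF g[OF this]] show "X v \<subseteq> {c} \<union> reach d m \<phi> L"
      unfolding X_def reach_def by auto
  qed
  ultimately show ?thesis by blast
qed

text \<open>The centre is a grid vertex. Transversals through it need not have disjoint lists, so a
  two-dimensional array of transversals is used, in which entries with different row and column do;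
  \<open>grid_row_or_column\<close> then yields a row or column with enough distinct
  representatives.\<close>

lemma star_from_lists:
  assumes q: "q \<ge> 1" and u: "u \<ge> 1" "2 * u + 4 * u * u \<le> m" and d: "d \<ge> 2"
  shows "\<exists>U. spans E (expansion (d + 1) (star_graph u)) U \<and> U \<subseteq> reach d m \<phi> L"
proof -
  define n where "n = 2 * u"
  \<comment> \<open>Classes 0 and 1 carry row and column. The other classes use the
    base-\<open>n\<close> code of the pair, shifted past the first \<open>n\<close> positions; with
    \<open>n = 2 * u\<close> this takes \<open>2 * u + 4 * u * u\<close> positions.\<close>
  define g where "g i j c = (if c = 0 then i else if c = 1 then j else n + (i * n + j))" for i j c :: nat
  have gm: "n + (i * n + j) < m" if "i < n" "j < n" for i j
  proof -
    have "i * n + j < Suc i * n" using that by simp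
    also have "\<dots> \<le> n * n" using that by (intro mult_le_mono1) simp
    finally have "i * n + j < n * n" .
    then show ?thesis using u(2) unfolding n_def by simp
  qed
  have gP: "g i j \<in> {..<d} \<rightarrow> {..<m}" if "i < n" "j < n" for i j
    using gm[OF that] that u unfolding g_def by (auto simp: Pi_iff)
  have uniq: "i = i' \<and> j = j'" if "i < n" "j < n" "i' < n" "j' < n" "i * n + j = i' * n + j'" for i j i' j'
  proof -
    have "(a * n + b) div n = a" "(a * n + b) mod n = b" if "b < n" for a b
      using that by (simp_all add: add.commute[of "a * n"])
    then show ?thesis using that by metis
  qed
  define T where "T i j = transversal d \<phi> (g i j)" for i j
  have "\<exists>y. y \<in> L (T i j)" if "i < n" "j < n" for i j
    using list_card[OF gP[OF that]] q unfolding T_def by (metis card.empty ex_in_conv not_one_le_zero)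
  then obtain y where y: "\<And>i j. i < n \<Longrightarrow> j < n \<Longrightarrow> y i j \<in> L (T i j)" by metis
  have ydiff: "y i j \<noteq> y i' j'" if ij: "i < n" "j < n" "i' < n" "j' < n" "i \<noteq> i'" "j \<noteq> j'" for i j i' j'
  proof -
    have "L (T i j) \<inter> L (T i' j') = {}" unfolding T_def
    proof (rule list_disj[OF gP gP])
      show "g i j c \<noteq> g i' j' c" if "c < d" for c using ij uniq[of i j i' j'] unfolding g_def by auto
    qed (use ij in auto)
    then show ?thesis using y[OF ij(1,2)] y[OF ij(3,4)] by auto
  qed
  have meet: "T i j \<inter> T i' j' \<subseteq> (if i = i' then {\<phi> 0 i} else {}) \<union> (if j = j' then {\<phi> 1 j} else {})"
    if ij: "i < n" "j < n" "i' < n" "j' < n" "(i, j) \<noteq> (i', j')" for i j i' j'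
  proof
    fix x assume x: "x \<in> T i j \<inter> T i' j'"
    then obtain c where c: "c < d" "x = \<phi> c (g i j c)" unfolding T_def transversal_def by auto
    have "g i j c < m" using gP[OF ij(1,2)] c by (auto simp: Pi_iff)
    then have "g i' j' c = g i j c" using x c mem_transversal[OF gP[OF ij(3,4)] c(1)] unfolding T_def by auto
    then show "x \<in> (if i = i' then {\<phi> 0 i} else {}) \<union> (if j = j' then {\<phi> 1 j} else {})"
      using c ij uniq[of i j i' j'] unfolding g_def by (auto split: if_splits)
  qed
  have Tin: "\<phi> 0 i \<in> T i j" "\<phi> 1 j \<in> T i j" for i j
    using imageI[of 0 "{..<d}" "\<lambda>c. \<phi> c (g i j c)"] imageI[of 1 "{..<d}" "\<lambda>c. \<phi> c (g i j c)"] d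
    unfolding T_def transversal_def g_def by auto
  define X where "X i j = insert (y i j) (T i j)" for i j
  have Tg: "T i j \<subseteq> grid d m \<phi>" if "i < n" "j < n" for i j unfolding T_def by (rule transversal_subset[OF gP[OF that]])
  have yg: "y i j \<notin> grid d m \<phi>" if "i < n" "j < n" for i j
    using y[OF that] list_grid[OF gP[OF that]] unfolding T_def by blast
  have XE: "X i j \<in> E \<and> finite (X i j) \<and> card (X i j) = d + 1" if "i < n" "j < n" for i j
    using list_edge[OF gP[OF that]] y[OF that] card_transversal[OF gP[OF that]] yg[OF that] Tg[OF that]
    unfolding X_def T_def by (auto simp: finite_transversal card_insert_if)
  have Xr: "X i j \<subseteq> reach d m \<phi> L" if "i < n" "j < n" for i j
    using Tg[OF that] y[OF that] gP[OF that] unfolding X_def reach_def T_def by auto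
  have star: "\<exists>U. spans E (expansion (d + 1) (star_graph u)) U \<and> U \<subseteq> reach d m \<phi> L"
    if f: "\<And>v. v \<in> {1..u} \<Longrightarrow> a v < n \<and> b v < n \<and> c \<in> T (a v) (b v)"
      and inj: "inj_on (\<lambda>v. y (a v) (b v)) {1..u}"
      and TT: "\<And>v v'. v \<in> {1..u} \<Longrightarrow> v' \<in> {1..u} \<Longrightarrow> v \<noteq> v' \<Longrightarrow> T (a v) (b v) \<inter> T (a v') (b v') \<subseteq> {c}" for a b c
  proof (rule exI[of _ "\<Union>v\<in>{1..u}. X (a v) (b v)"], rule conjI)
    show "spans E (expansion (d + 1) (star_graph u)) (\<Union>v\<in>{1..u}. X (a v) (b v))"
    proof (rule spans_star[OF u(1)])
      show "X (a v) (b v) \<in> E \<and> finite (X (a v) (b v)) \<and> card (X (a v) (b v)) = d + 1 \<and> c \<in> X (a v) (b v)"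
        if "v \<in> {1..u}" for v using XE f[OF that] unfolding X_def by auto
      show "X (a v) (b v) \<inter> X (a v') (b v') = {c}" if "v \<in> {1..u}" "v' \<in> {1..u}" "v \<noteq> v'" for v v'
      proof -
        have "y (a v) (b v) \<noteq> y (a v') (b v')" using inj that unfolding inj_on_def by blast
        moreover have "y (a v) (b v) \<notin> T (a v') (b v')" "y (a v') (b v') \<notin> T (a v) (b v)"
          using yg Tg f[OF that(1)] f[OF that(2)] by blast+
        ultimately show ?thesis using TT[OF that] f[OF that(1)] f[OF that(2)] unfolding X_def by blast
      qed
    qed (use d in simp)
    show "(\<Union>v\<in>{1..u}. X (a v) (b v)) \<subseteq> reach d m \<phi> L" using Xr f by blast
  qed
  have enum: "\<exists>f. bij_betw f {1..u} J" if "J \<subseteq> {..<n}" "card J = u" for J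
  proof -
    have "finite J" using that finite_subset by blast
    then show ?thesis using that by (intro finite_same_card_bij) auto
  qed
  have "(\<exists>i<n. \<exists>J\<subseteq>{..<n}. card J = u \<and> inj_on (y i) J) \<or> (\<exists>j<n. \<exists>J\<subseteq>{..<n}. card J = u \<and> inj_on (\<lambda>i. y i j) J)"
    unfolding n_def using ydiff u(1) unfolding n_def by (intro grid_row_or_column) auto
  then show ?thesis
  proof (elim disjE exE conjE)
    fix i J assume i: "i < n" "J \<subseteq> {..<n}" "card J = u" "inj_on (y i) J"
    then obtain f where f: "bij_betw f {1..u} J" using enum by blast
    have fn: "f v < n" if "v \<in> {1..u}" for v using bij_betwE[OF f] that i by auto
    have fi: "f v \<noteq> f v'" if "v \<in> {1..u}" "v' \<in> {1..u}" "v \<noteq> v'" for v v'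
      using inj_onD[OF bij_betw_imp_inj_on[OF f], of v v'] that by blast
    show ?thesis
    proof (rule star[of "\<lambda>_. i" f "\<phi> 0 i"])
      show "inj_on (\<lambda>v. y i (f v)) {1..u}" using f i(4) comp_inj_on[of f "{1..u}" "y i"] by (simp add: bij_betw_def comp_def)
      show "T i (f v) \<inter> T i (f v') \<subseteq> {\<phi> 0 i}" if "v \<in> {1..u}" "v' \<in> {1..u}" "v \<noteq> v'" for v v'
        using meet[of i "f v" i "f v'"] fn fi that i by auto
    qed (use fn i Tin in auto)
  next
    fix j J assume j: "j < n" "J \<subseteq> {..<n}" "card J = u" "inj_on (\<lambda>i. y i j) J"
    then obtain f where f: "bij_betw f {1..u} J" using enum by blast
    have fn: "f v < n" if "v \<in> {1..u}" for v using bij_betwE[OF f] that j by auto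
    have fi: "f v \<noteq> f v'" if "v \<in> {1..u}" "v' \<in> {1..u}" "v \<noteq> v'" for v v'
      using inj_onD[OF bij_betw_imp_inj_on[OF f], of v v'] that by blast
    show ?thesis
    proof (rule star[of f "\<lambda>_. j" "\<phi> 1 j"])
      show "inj_on (\<lambda>v. y (f v) j) {1..u}" using f j(4) comp_inj_on[of f "{1..u}" "\<lambda>i. y i j"] by (simp add: bij_betw_def comp_def)
      show "T (f v) j \<inter> T (f v') j \<subseteq> {\<phi> 1 j}" if "v \<in> {1..u}" "v' \<in> {1..u}" "v \<noteq> v'" for v v'
        using meet[of "f v" j "f v'" j] fn fi that j by auto
    qed (use fn j Tin in auto)
  qed
qed

end

section \<open>Paths and cycles inside a block\<close>

text \<open>The path (\<open>z = l\<close>) and the cycle (\<open>z = 0\<close>) with \<open>l\<close> edges.\<close>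

definition qnext :: "nat \<Rightarrow> nat \<Rightarrow> nat \<Rightarrow> nat" where
  "qnext l z i = (if Suc i = l then z else Suc i)"

definition qedge :: "nat \<Rightarrow> nat \<Rightarrow> nat \<Rightarrow> nat set" where
  "qedge l z i = {i, qnext l z i}"

text \<open>Edges are numbered by their first vertex, and only the last one depends on
  \<open>z\<close>. The numbering turns lists of edges into sequences for the lemmas on distinct
  representatives.\<close>

definition qgraph :: "nat \<Rightarrow> nat \<Rightarrow> nat hypergraph" where
  "qgraph l z = (insert z {..<l}, qedge l z ` {..<l})"

lemma path_graph_eq: "path_graph l = qgraph l l"
  unfolding path_graph_def qgraph_def qedge_def qnext_def by (auto simp: image_iff)

lemma cycle_graph_eq: "l \<ge> 1 \<Longrightarrow> cycle_graph l = qgraph l 0"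
proof -
  assume l: "l \<ge> 1"
  have e: "(i + 1) mod l = qnext l 0 i" if "i < l" for i using that unfolding qnext_def by auto
  have "{{i, (i + 1) mod l} |i. i < l} = qedge l 0 ` {..<l}"
    unfolding qedge_def using e by auto
  then show ?thesis unfolding cycle_graph_def qgraph_def using l by auto
qed

context
  fixes l z :: nat
  assumes l: "l \<ge> 5" and z: "z = 0 \<or> z = l"
begin

lemma qedge_card: "i < l \<Longrightarrow> card (qedge l z i) = 2"
  unfolding qedge_def qnext_def using l z by auto

lemma qedge_subset: "i < l \<Longrightarrow> qedge l z i \<subseteq> insert z {..<l}"
  unfolding qedge_def qnext_def by auto

text \<open>The side condition excludes the first edge paired with the last, since these meet in a
  cycle.\<close>

lemma qedge_disjoint: "i + 2 \<le> j \<Longrightarrow> j < l \<Longrightarrow> 0 < i \<or> j \<noteq> l - 1 \<Longrightarrow> qedge l z i \<inter> qedge l z j = {}"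
  unfolding qedge_def qnext_def using l z by auto

lemma qedge_inj: "inj_on (qedge l z) {..<l}"
proof (rule inj_onI)
  fix i j assume "i \<in> {..<l}" "j \<in> {..<l}" "qedge l z i = qedge l z j"
  then show "i = j" unfolding qedge_def qnext_def doubleton_eq_iff using l z by (auto split: if_splits)
qed

end

lemma card_same_parity: "card {v::nat. c \<le> v \<and> v < l \<and> even (v - c)} = (l - c + 1) div 2"
proof -
  have "{v. c \<le> v \<and> v < l \<and> even (v - c)} = (\<lambda>j. 2 * j + c) ` {..<(l - c + 1) div 2}"
  proof (intro set_eqI iffI)
    fix v assume "v \<in> {v. c \<le> v \<and> v < l \<and> even (v - c)}"
    then have "v = 2 * ((v - c) div 2) + c" "(v - c) div 2 < (l - c + 1) div 2" by auto
    then show "v \<in> (\<lambda>j. 2 * j + c) ` {..<(l - c + 1) div 2}" by blast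
  qed auto
  then show ?thesis by (simp add: card_image inj_on_def)
qed

context block
begin

text \<open>\<open>S\<close> is an independent partial cover played by constants, and
  \<open>R\<close> numbers the edges it misses. The constants of \<open>C'\<close> left over are
  offered to these edges besides their lists.\<close>

lemma qgraph_from_block:
  assumes l: "l \<ge> 5" "z = 0 \<or> z = l" and m: "2 * l + 1 \<le> m" and d: "d \<ge> 2"
    and S: "S \<subseteq> {..<l}" "\<And>i. i < l \<Longrightarrow> \<not> (i \<in> S \<and> qnext l z i \<in> S)"
    and C': "C' \<subseteq> C" "card S \<le> card C'"
    and \<chi>: "\<And>v. v \<le> l \<Longrightarrow> \<chi> v < d" "\<And>i. i < l \<Longrightarrow> i \<notin> S \<Longrightarrow> qnext l z i \<notin> S \<Longrightarrow> \<chi> i \<noteq> \<chi> (qnext l z i)"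
    and sdr: "\<And>A Cx. R = {i. i < l \<and> i \<notin> S \<and> qnext l z i \<notin> S} \<Longrightarrow> Cx \<subseteq> C' \<Longrightarrow> card Cx = card C' - card S \<Longrightarrow>
       (\<And>i. i \<in> R \<Longrightarrow> finite (A i) \<and> card (A i) = q) \<Longrightarrow>
       (\<And>i j. i \<in> R \<Longrightarrow> j \<in> R \<Longrightarrow> qedge l z i \<inter> qedge l z j = {} \<Longrightarrow> A i \<inter> A j = {}) \<Longrightarrow>
       \<exists>x. inj_on x R \<and> (\<forall>i\<in>R. x i \<in> A i \<union> Cx)"
    and R: "R = {i. i < l \<and> i \<notin> S \<and> qnext l z i \<notin> S}"
  shows "\<exists>U. spans E (expansion (d + 1) (qgraph l z)) U \<and> U \<subseteq> C' \<union> reach d m \<phi> L"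
proof -
  have fC': "finite C'" using C' finC finite_subset by blast
  have fS: "finite S" using S finite_subset by blast
  obtain C1 where C1: "C1 \<subseteq> C'" "card C1 = card S" using C' by (meson obtain_subset_with_card_n)
  have "finite C1" using C1 fC' finite_subset by blast
  then obtain \<kappa> where \<kappa>: "bij_betw \<kappa> S C1" using finite_same_card_bij[OF fS] C1 by metis
  have kS: "\<kappa> ` S = C1" using \<kappa> by (simp add: bij_betw_def)
  let ?\<Gamma> = "qgraph l z"
  have v: "verts ?\<Gamma> = insert z {..<l}" and h: "hedges ?\<Gamma> = qedge l z ` {..<l}" unfolding qgraph_def by auto
  have ch: "card (hedges ?\<Gamma>) = l" unfolding h using qedge_inj[OF l] by (simp add: card_image)
  have vl: "u \<le> l" if "u \<in> verts ?\<Gamma>" for u using that l(2) unfolding v by auto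
  have RS: "i \<in> R \<longleftrightarrow> i < l \<and> qedge l z i \<inter> S = {}" for i unfolding R qedge_def by auto
  define idx where "idx = the_inv_into {..<l} (qedge l z)"
  have idx: "idx (qedge l z i) = i" if "i < l" for i
    unfolding idx_def using the_inv_into_f_f[OF qedge_inj[OF l]] that by simp
  have "\<exists>U. spans E (expansion (d + 1) ?\<Gamma>) U \<and> U \<subseteq> (\<kappa> ` S \<union> (C' - C1)) \<union> reach d m \<phi> L"
  proof (rule spans_from_block[where nv = "l + 1" and \<iota> = "\<lambda>v. v" and \<chi> = \<chi>])
    show "finite (hedges ?\<Gamma>)" unfolding h by simp
    show "e \<subseteq> verts ?\<Gamma> \<and> card e = 2" if "e \<in> hedges ?\<Gamma>" for e
      using that qedge_card[OF l] qedge_subset[OF l] unfolding h v by blast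
    show "S \<subseteq> verts ?\<Gamma>" using S unfolding v by auto
    show "card (e \<inter> S) \<le> 1" if e: "e \<in> hedges ?\<Gamma>" for e
    proof -
      obtain i where i: "i < l" "e = qedge l z i" using e unfolding h by auto
      have "\<exists>a. e \<inter> S \<subseteq> {a}" using S(2)[OF i(1)] unfolding i qedge_def by blast
      then obtain a where "e \<inter> S \<subseteq> {a}" by blast
      then show ?thesis using card_mono[of "{a}" "e \<inter> S"] by simp
    qed
    show "inj_on \<kappa> S" using \<kappa> by (simp add: bij_betw_def)
    show "\<kappa> ` S \<subseteq> C" "C' - C1 \<subseteq> C" "(C' - C1) \<inter> \<kappa> ` S = {}" using kS C1 C' by auto
    show "l + 1 + card (hedges ?\<Gamma>) \<le> m" using ch m by simp
    show "u < l + 1" "\<chi> u < d" if "u \<in> verts ?\<Gamma>" for u using vl[OF that] \<chi>(1) by auto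
    show "inj_on (\<lambda>v. v) (verts ?\<Gamma>)" by simp
    show "inj_on \<chi> (e - S)" if e: "e \<in> hedges ?\<Gamma>" for e
    proof -
      obtain i where i: "i < l" "e = qedge l z i" using e unfolding h by auto
      show ?thesis using \<chi>(2)[OF i(1)] unfolding i qedge_def by (auto simp: inj_on_def)
    qed
    fix A :: "nat set \<Rightarrow> 'a set"
    assume A: "\<And>e. e \<in> hedges ?\<Gamma> \<Longrightarrow> e \<inter> S = {} \<Longrightarrow> finite (A e) \<and> card (A e) = q"
      "\<And>e e'. e \<in> hedges ?\<Gamma> \<Longrightarrow> e \<inter> S = {} \<Longrightarrow> e' \<in> hedges ?\<Gamma> \<Longrightarrow> e' \<inter> S = {} \<Longrightarrow> e \<inter> e' = {} \<Longrightarrow> A e \<inter> A e' = {}"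
    have "\<exists>x. inj_on x R \<and> (\<forall>i\<in>R. x i \<in> A (qedge l z i) \<union> (C' - C1))"
    proof (rule sdr[OF R])
      show "C' - C1 \<subseteq> C'" by auto
      show "card (C' - C1) = card C' - card S" using C1 \<open>finite C1\<close> by (simp add: card_Diff_subset)
      show "finite (A (qedge l z i)) \<and> card (A (qedge l z i)) = q" if "i \<in> R" for i
        using that RS h by (intro A(1)) auto
      show "A (qedge l z i) \<inter> A (qedge l z j) = {}" if "i \<in> R" "j \<in> R" "qedge l z i \<inter> qedge l z j = {}" for i j
        using that RS h by (intro A(2)) auto
    qed
    then obtain x where x: "inj_on x R" "\<forall>i\<in>R. x i \<in> A (qedge l z i) \<union> (C' - C1)" by blast
    have R': "\<exists>i\<in>R. e = qedge l z i" if "e \<in> hedges ?\<Gamma>" "e \<inter> S = {}" for e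
      using that RS unfolding h by blast
    have Rl: "i < l" if "i \<in> R" for i using that unfolding R by simp
    show "\<exists>x. inj_on x {e \<in> hedges ?\<Gamma>. e \<inter> S = {}} \<and> (\<forall>e\<in>hedges ?\<Gamma>. e \<inter> S = {} \<longrightarrow> x e \<in> A e \<union> (C' - C1))"
    proof (rule exI[of _ "\<lambda>e. x (idx e)"], intro conjI ballI impI)
      show "inj_on (\<lambda>e. x (idx e)) {e \<in> hedges ?\<Gamma>. e \<inter> S = {}}"
      proof (rule inj_onI)
        fix a b assume "a \<in> {e \<in> hedges ?\<Gamma>. e \<inter> S = {}}" "b \<in> {e \<in> hedges ?\<Gamma>. e \<inter> S = {}}" and eq: "x (idx a) = x (idx b)"
        then obtain i j where ij: "i \<in> R" "a = qedge l z i" "j \<in> R" "b = qedge l z j" using R' by blast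
        then have "x i = x j" using eq idx Rl by simp
        then show "a = b" using x(1) ij by (auto simp: inj_on_def)
      qed
      fix e assume "e \<in> hedges ?\<Gamma>" "e \<inter> S = {}"
      then obtain i where i: "i \<in> R" "e = qedge l z i" using R' by blast
      then show "x (idx e) \<in> A e \<union> (C' - C1)" using x(2) idx[OF Rl[OF i(1)]] by auto
    qed
  qed
  moreover have "\<kappa> ` S \<union> (C' - C1) = C'" using kS C1 by auto
  ultimately show ?thesis by simp
qed

lemma parity_lt: "d \<ge> 2 \<Longrightarrow> v mod 2 < d" for v :: nat
  using mod_less_divisor[of 2 v] by linarith

text \<open>A hyperedge has room for one constant, so \<open>S\<close> must be independent, and an
  odd cycle has no independent cover. The even vertices from 2 on miss edge 0 only, which takes a
  spare constant as expansion vertex or, with one constant less, a list entry.\<close>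

lemma qgraph_odd:
  assumes l: "l \<ge> 5" "z = 0 \<or> z = l" and odd: "odd l" and m: "2 * l + 1 \<le> m" and d: "d \<ge> 2"
    and C': "C' \<subseteq> C" "card C' \<ge> (l - 1) div 2" "card C' > (l - 1) div 2 \<or> q \<ge> 1"
  shows "\<exists>U. spans E (expansion (d + 1) (qgraph l z)) U \<and> U \<subseteq> C' \<union> reach d m \<phi> L"
proof -
  define S where "S = {v. v < l \<and> even v \<and> 2 \<le> v}"
  have "S = {v. 2 \<le> v \<and> v < l \<and> even (v - 2)}" unfolding S_def by auto
  then have cS: "card S = (l - 1) div 2" using card_same_parity[of 2 l] l by simp
  have z0: "z \<notin> S" unfolding S_def using l by auto
  have cov: "i \<in> S \<or> qnext l z i \<in> S" if "i < l" "i \<noteq> 0" for i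
  proof (cases "even i")
    case True
    then show ?thesis using that unfolding S_def by (auto elim!: evenE)
  next
    case False
    then have "Suc i \<noteq> l" using odd by auto
    then have "Suc i < l" using that by simp
    then show ?thesis using False that unfolding S_def qnext_def by (auto elim!: oddE)
  qed
  show ?thesis
  proof (rule qgraph_from_block[OF l m d, where S = S and \<chi> = "\<lambda>v. v mod 2" and R = "{0}"])
    show "S \<subseteq> {..<l}" unfolding S_def by auto
    show "\<not> (i \<in> S \<and> qnext l z i \<in> S)" if "i < l" for i
      using z0 unfolding qnext_def S_def by auto
    have nx: "qnext l z 0 = 1" unfolding qnext_def using l by auto
    have i0: "i = 0" if "i < l" "i \<notin> S" "qnext l z i \<notin> S" for i using cov[OF that(1)] that by blast
    moreover have "0 \<notin> S" "qnext l z 0 \<notin> S" unfolding nx S_def by auto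
    ultimately show "{0} = {i. i < l \<and> i \<notin> S \<and> qnext l z i \<notin> S}" using l by auto
    show "i mod 2 \<noteq> qnext l z i mod 2" if "i < l" "i \<notin> S" "qnext l z i \<notin> S" for i
      using i0[OF that] nx by simp
    show "card S \<le> card C'" using C' cS by simp
    fix A :: "nat \<Rightarrow> 'a set" and Cx :: "'a set"
    assume Cx: "card Cx = card C' - card S" and A: "\<And>i. i \<in> {0} \<Longrightarrow> finite (A i) \<and> card (A i) = q"
    have "A 0 \<union> Cx \<noteq> {}" using C'(3) A[of 0] Cx cS by auto
    then obtain c where "c \<in> A 0 \<union> Cx" by blast
    then show "\<exists>x. inj_on x {0::nat} \<and> (\<forall>i\<in>{0}. x i \<in> A i \<union> Cx)" by (intro exI[of _ "\<lambda>_. c"]) auto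
  qed (use C' parity_lt[OF d] in auto)
qed

text \<open>For even \<open>l\<close> the odd vertices are an independent cover of the right size;
  for odd \<open>l\<close> one constant remains for edge 0.\<close>

lemma qgraph_with_cover:
  assumes l: "l \<ge> 5" "z = 0 \<or> z = l" and m: "2 * l + 1 \<le> m" and d: "d \<ge> 2"
    and C': "C' \<subseteq> C" "card C' = (l + 1) div 2"
  shows "\<exists>U. spans E (expansion (d + 1) (qgraph l z)) U \<and> U \<subseteq> C' \<union> reach d m \<phi> L"
proof (cases "even l")
  case True
  define S where "S = {v. v < l \<and> odd v}"
  have "S = {v. 1 \<le> v \<and> v < l \<and> even (v - 1)}" unfolding S_def by (auto intro: odd_pos[THEN Suc_leI])
  then have cS: "card S = l div 2" using card_same_parity[of 1 l] l by simp
  show ?thesis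
  proof (rule qgraph_from_block[OF l m d, where S = S and \<chi> = "\<lambda>v. v mod 2" and R = "{}"])
    show "S \<subseteq> {..<l}" unfolding S_def by auto
    show "\<not> (i \<in> S \<and> qnext l z i \<in> S)" if "i < l" for i
      using l True unfolding S_def qnext_def by auto
    have "i \<in> S \<or> qnext l z i \<in> S" if "i < l" for i
    proof (cases "even i")
      case i: True
      then have "Suc i \<noteq> l" using True by auto
      then have "Suc i < l" using that by simp
      then show ?thesis using i unfolding S_def qnext_def by auto
    qed (use that in \<open>simp add: S_def\<close>)
    then show "{} = {i. i < l \<and> i \<notin> S \<and> qnext l z i \<notin> S}" "\<And>i. i < l \<Longrightarrow> i \<notin> S \<Longrightarrow> qnext l z i \<notin> S \<Longrightarrow> i mod 2 \<noteq> qnext l z i mod 2"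
      by blast+
  qed (use C' cS parity_lt[OF d] True in auto)
qed (rule qgraph_odd[OF l _ m d C'(1)], use C' in \<open>auto elim!: oddE\<close>)

text \<open>For even \<open>l\<close>, dropping a vertex of the alternating cover would expose two
  adjacent edges, whose lists may coincide when \<open>q = 1\<close>. The cover is rearranged so
  that the two exposed edges are disjoint.\<close>

lemma qgraph_with_almost_cover:
  assumes l: "l \<ge> 5" "z = 0 \<or> z = l" and m: "2 * l + 1 \<le> m" and d: "d \<ge> 2" and q: "q \<ge> 1"
    and C': "C' \<subseteq> C" "card C' = (l + 1) div 2 - 1"
  shows "\<exists>U. spans E (expansion (d + 1) (qgraph l z)) U \<and> U \<subseteq> C' \<union> reach d m \<phi> L"
proof (cases "even l")
  case True
  then have l6: "l \<ge> 6" using l by (auto elim!: evenE)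
  \<comment> \<open>The edges missing \<open>S\<close> are numbers 0 and 3; being disjoint, they have disjoint lists.\<close>
  define S where "S = insert 2 {v. v < l \<and> odd v \<and> 5 \<le> v}"
  have "{v. v < l \<and> odd v \<and> 5 \<le> v} = {v. 5 \<le> v \<and> v < l \<and> even (v - 5)}" by auto
  then have "card {v. v < l \<and> odd v \<and> 5 \<le> v} = (l - 4) div 2" using card_same_parity[of 5 l] l6 by simp
  then have cS: "card S = (l - 4) div 2 + 1" unfolding S_def by (subst card_insert_disjoint) auto
  have z0: "z \<notin> S" unfolding S_def using l by auto
  have cov: "i \<in> S \<or> qnext l z i \<in> S" if "i < l" "i \<noteq> 0" "i \<noteq> 3" for i
  proof (cases "i = 1 \<or> i = 2")
    case True
    then show ?thesis using l6 unfolding S_def qnext_def by auto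
  next
    case F: False
    show ?thesis
    proof (cases "even i")
      case True
      then have "Suc i \<noteq> l" using \<open>even l\<close> by auto
      then have "Suc i < l" using that by simp
      then show ?thesis using True F that unfolding S_def qnext_def by auto
    next
      case False
      then have "i \<ge> 5" using F that by (cases "i = 4") auto
      then show ?thesis using False that unfolding S_def by auto
    qed
  qed
  have n0: "0 \<notin> S" "1 \<notin> S" "3 \<notin> S" "4 \<notin> S" unfolding S_def by auto
  have nx: "qnext l z 0 = 1" "qnext l z 3 = 4" unfolding qnext_def using l6 by auto
  have R: "{0, 3} = {i. i < l \<and> i \<notin> S \<and> qnext l z i \<notin> S}"
  proof -
    have "i = 0 \<or> i = 3" if "i < l" "i \<notin> S" "qnext l z i \<notin> S" for i using cov[OF that(1)] that by blast
    then show ?thesis using n0 nx l6 by auto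
  qed
  show ?thesis
  proof (rule qgraph_from_block[OF l m d, where S = S and \<chi> = "\<lambda>v. v mod 2" and R = "{0, 3}"])
    show "S \<subseteq> {..<l}" unfolding S_def using l by auto
    show "\<not> (i \<in> S \<and> qnext l z i \<in> S)" if "i < l" for i
    proof (cases "Suc i = l")
      case True
      then show ?thesis using z0 unfolding qnext_def by simp
    next
      case False
      then show ?thesis unfolding qnext_def S_def by auto
    qed
    show "{0, 3} = {i. i < l \<and> i \<notin> S \<and> qnext l z i \<notin> S}" by (rule R)
    show "i mod 2 \<noteq> qnext l z i mod 2" if "i < l" "i \<notin> S" "qnext l z i \<notin> S" for i
    proof -
      have "i \<in> {0, 3}" unfolding R using that by simp
      then show ?thesis using nx by auto
    qed
    show "card S \<le> card C'" using C' cS True l6 by (auto elim!: evenE)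
    fix A :: "nat \<Rightarrow> 'a set" and Cx :: "'a set"
    assume A: "\<And>i. i \<in> {0, 3} \<Longrightarrow> finite (A i) \<and> card (A i) = q"
      "\<And>i j. i \<in> {0, 3} \<Longrightarrow> j \<in> {0, 3} \<Longrightarrow> qedge l z i \<inter> qedge l z j = {} \<Longrightarrow> A i \<inter> A j = {}"
    have "A 0 \<noteq> {}" "A 3 \<noteq> {}" using A(1)[of 0] A(1)[of 3] q by auto
    then obtain a b where ab: "a \<in> A 0" "b \<in> A 3" by blast
    have "A 0 \<inter> A 3 = {}" using qedge_disjoint[OF l, of 0 3] l6 by (intro A(2)) auto
    then have "a \<noteq> b" using ab by auto
    then show "\<exists>x. inj_on x {0::nat, 3} \<and> (\<forall>i\<in>{0, 3}. x i \<in> A i \<union> Cx)"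
      using ab by (intro exI[of _ "\<lambda>i. if i = 0 then a else b"]) auto
  qed (use C' parity_lt[OF d] in auto)
qed (rule qgraph_odd[OF l _ m d C'(1)], use C' q in \<open>auto elim!: oddE\<close>)

text \<open>A constant at vertex \<open>l - 1\<close> settles the last two edges. The others form a
  path even if the graph is a cycle, so two alternating classes and lists of size 2 suffice.\<close>

lemma qgraph_with_one_constant:
  assumes l: "l \<ge> 5" "z = 0 \<or> z = l" and m: "2 * l + 1 \<le> m" and d: "d \<ge> 2" and q: "q \<ge> 2"
    and C': "C' \<subseteq> C" "card C' = 1"
  shows "\<exists>U. spans E (expansion (d + 1) (qgraph l z)) U \<and> U \<subseteq> C' \<union> reach d m \<phi> L"
proof (rule qgraph_from_block[OF l m d, where S = "{l - 1}" and \<chi> = "\<lambda>v. v mod 2" and R = "{..<l - 2}"])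
  have nx: "qnext l z i = Suc i" if "i < l - 2" for i using that unfolding qnext_def by auto
  show R: "{..<l - 2} = {i. i < l \<and> i \<notin> {l - 1} \<and> qnext l z i \<notin> {l - 1}}"
    using l unfolding qnext_def by auto
  show "i mod 2 \<noteq> qnext l z i mod 2" if "i < l" "i \<notin> {l - 1}" "qnext l z i \<notin> {l - 1}" for i
  proof -
    have "i \<in> {..<l - 2}" unfolding R using that by simp
    then show ?thesis using nx by (simp add: mod_Suc)
  qed
  fix A :: "nat \<Rightarrow> 'a set" and Cx :: "'a set"
  assume A: "\<And>i. i \<in> {..<l - 2} \<Longrightarrow> finite (A i) \<and> card (A i) = q"
    "\<And>i j. i \<in> {..<l - 2} \<Longrightarrow> j \<in> {..<l - 2} \<Longrightarrow> qedge l z i \<inter> qedge l z j = {} \<Longrightarrow> A i \<inter> A j = {}"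
  have "\<exists>x. inj_on x {..<l - 2} \<and> (\<forall>i<l - 2. x i \<in> A i)"
  proof (rule sdr_path)
    show "finite (A i) \<and> 2 \<le> card (A i)" if "i < l - 2" for i using A(1)[of i] q that by auto
    show "A i \<inter> A j = {}" if "i + 2 \<le> j" "j < l - 2" for i j
    proof (rule A(2))
      show "qedge l z i \<inter> qedge l z j = {}" using that by (intro qedge_disjoint[OF l]) auto
    qed (use that in auto)
  qed
  then show "\<exists>x. inj_on x {..<l - 2} \<and> (\<forall>i\<in>{..<l - 2}. x i \<in> A i \<union> Cx)" by auto
qed (use C' parity_lt[OF d] l in \<open>auto simp: qnext_def\<close>)

text \<open>Without constants the classes must colour the graph properly. Vertex
  \<open>l - 1\<close> of an odd cycle moves to a third class, which does not exist for
  \<open>d = 2\<close>.\<close>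

lemma qgraph_from_lists:
  assumes l: "l \<ge> 5" "z = 0 \<or> z = l" and m: "2 * l + 1 \<le> m" and d: "d \<ge> 2" and q: "q \<ge> 3"
    and par: "z = 0 \<Longrightarrow> odd l \<Longrightarrow> d \<ge> 3"
  shows "\<exists>U. spans E (expansion (d + 1) (qgraph l z)) U \<and> U \<subseteq> {} \<union> reach d m \<phi> L"
proof (rule qgraph_from_block[OF l m d, where S = "{}" and R = "{..<l}"
      and \<chi> = "\<lambda>v. if z = 0 \<and> odd l \<and> v = l - 1 then 2 else v mod 2"])
  show "{..<l} = {i. i < l \<and> i \<notin> {} \<and> qnext l z i \<notin> {}}" by auto
  show "(if z = 0 \<and> odd l \<and> v = l - 1 then 2 else v mod 2) < d" for v
    using par parity_lt[OF d, of v] by auto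
  show "(if z = 0 \<and> odd l \<and> i = l - 1 then 2 else i mod 2)
       \<noteq> (if z = 0 \<and> odd l \<and> qnext l z i = l - 1 then 2 else qnext l z i mod 2)" if "i < l" for i
  proof (cases "Suc i = l")
    case True
    then show ?thesis using l unfolding qnext_def by (auto simp: mod_Suc mod2_eq_if)
  next
    case False
    then show ?thesis using l that unfolding qnext_def by (auto simp: mod_Suc)
  qed
  fix A :: "nat \<Rightarrow> 'a set" and Cx :: "'a set"
  assume A: "\<And>i. i \<in> {..<l} \<Longrightarrow> finite (A i) \<and> card (A i) = q"
    "\<And>i j. i \<in> {..<l} \<Longrightarrow> j \<in> {..<l} \<Longrightarrow> qedge l z i \<inter> qedge l z j = {} \<Longrightarrow> A i \<inter> A j = {}"
  have "\<exists>x. inj_on x {..<l} \<and> (\<forall>i<l. x i \<in> A i)"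
  proof (rule sdr_cycle)
    show "finite (A i) \<and> 3 \<le> card (A i)" if "i < l" for i using A(1)[of i] q that by auto
    show "A i \<inter> A j = {}" if "0 < i" "i + 2 \<le> j" "j < l" for i j
    proof (rule A(2))
      show "qedge l z i \<inter> qedge l z j = {}" using that by (intro qedge_disjoint[OF l]) auto
    qed (use that in auto)
  qed
  then show "\<exists>x. inj_on x {..<l} \<and> (\<forall>i\<in>{..<l}. x i \<in> A i \<union> Cx)" by auto
qed auto

end

section \<open>Disjoint odd cycles in 3-graphs\<close>

text \<open>In a digraph of out-degree at most \<open>D\<close> some vertex has in-degree at most
  \<open>D\<close>, by averaging. Taking it and discarding its at most \<open>2 * D\<close>
  neighbours sets up the induction.\<close>

lemma independent_subset:
  fixes out :: "'b \<Rightarrow> 'b set"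
  assumes "finite X" "\<And>\<sigma>. \<sigma> \<in> X \<Longrightarrow> card (out \<sigma> \<inter> X) \<le> D" "(2 * D + 1) * k \<le> card X"
  shows "\<exists>I\<subseteq>X. card I = k \<and> (\<forall>\<sigma>\<in>I. \<forall>\<tau>\<in>I. \<sigma> \<noteq> \<tau> \<longrightarrow> \<tau> \<notin> out \<sigma>)"
  using assms
proof (induction k arbitrary: X)
  case 0
  then show ?case by (intro exI[of _ "{}"]) auto
next
  case (Suc k)
  have X0: "card X > 0" using Suc.prems(3) by (auto intro: Nat.gr0I)
  have "\<exists>\<tau>\<in>X. card {\<sigma> \<in> X. \<tau> \<in> out \<sigma>} \<le> D"
  proof (rule ccontr)
    assume "\<not> ?thesis"
    then have "\<And>\<tau>. \<tau> \<in> X \<Longrightarrow> D < card {\<sigma> \<in> X. \<tau> \<in> out \<sigma>}" by (auto simp: not_le)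
    then have "(\<Sum>\<tau>\<in>X. D) < (\<Sum>\<tau>\<in>X. card {\<sigma> \<in> X. \<tau> \<in> out \<sigma>})"
      using X0 Suc.prems(1) by (intro sum_strict_mono) auto
    also have "\<dots> = card (SIGMA \<tau>:X. {\<sigma> \<in> X. \<tau> \<in> out \<sigma>})" using Suc.prems(1) by simp
    also have "\<dots> = card (SIGMA \<sigma>:X. out \<sigma> \<inter> X)"
      by (rule bij_betw_same_card[of prod.swap]) (auto simp: bij_betw_def inj_on_def image_iff)
    also have "\<dots> = (\<Sum>\<sigma>\<in>X. card (out \<sigma> \<inter> X))" using Suc.prems(1) by simp
    also have "\<dots> \<le> (\<Sum>\<sigma>\<in>X. D)" by (intro sum_mono Suc.prems(2))
    finally show False by simp
  qed
  then obtain \<tau> where \<tau>: "\<tau> \<in> X" "card {\<sigma> \<in> X. \<tau> \<in> out \<sigma>} \<le> D" by blast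
  define R where "R = insert \<tau> ({\<sigma> \<in> X. \<tau> \<in> out \<sigma>} \<union> (out \<tau> \<inter> X))"
  have "card R \<le> Suc (card ({\<sigma> \<in> X. \<tau> \<in> out \<sigma>} \<union> (out \<tau> \<inter> X)))"
    unfolding R_def by (rule card_insert_le_m1) auto
  also have "\<dots> \<le> Suc (card {\<sigma> \<in> X. \<tau> \<in> out \<sigma>} + card (out \<tau> \<inter> X))" using card_Un_le by auto
  also have "\<dots> \<le> 2 * D + 1" using \<tau> Suc.prems(2)[OF \<tau>(1)] by simp
  finally have cR: "card R \<le> 2 * D + 1" .
  have RX: "R \<subseteq> X" unfolding R_def using \<tau> by auto
  have fR: "finite R" using RX Suc.prems(1) finite_subset by blast
  have "(2 * D + 1) * k \<le> card (X - R)" using Suc.prems(3) cR RX fR by (simp add: card_Diff_subset)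
  moreover have "card (out \<sigma> \<inter> (X - R)) \<le> D" if "\<sigma> \<in> X - R" for \<sigma>
    using Suc.prems(2)[of \<sigma>] that card_mono[of "out \<sigma> \<inter> X" "out \<sigma> \<inter> (X - R)"] Suc.prems(1) by fastforce
  ultimately obtain I where I: "I \<subseteq> X - R" "card I = k" "\<forall>\<sigma>\<in>I. \<forall>\<tau>\<in>I. \<sigma> \<noteq> \<tau> \<longrightarrow> \<tau> \<notin> out \<sigma>"
    using Suc.IH[of "X - R"] Suc.prems(1) by auto
  have "\<tau> \<notin> I" "finite I" using I Suc.prems(1) finite_subset[of I X] unfolding R_def by auto
  then have "card (insert \<tau> I) = Suc k" using I by simp
  moreover have "\<sigma> \<notin> out \<tau>" "\<tau> \<notin> out \<sigma>" if "\<sigma> \<in> I" for \<sigma> using I(1) that unfolding R_def by auto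
  ultimately show ?case using I \<tau> by (intro exI[of _ "insert \<tau> I"]) auto
qed

lemma spans_qgraph_3:
  assumes l: "l \<ge> 5" "z = 0 \<or> z = l"
    and w: "inj_on w (insert z {..<l})" and pr: "inj_on priv {..<l}" "priv ` {..<l} \<inter> w ` insert z {..<l} = {}"
    and E: "\<And>i. i < l \<Longrightarrow> insert (priv i) (w ` qedge l z i) \<in> E"
  shows "spans E (expansion 3 (qgraph l z)) (w ` insert z {..<l} \<union> priv ` {..<l})"
proof -
  let ?\<Gamma> = "qgraph l z"
  have v: "verts ?\<Gamma> = insert z {..<l}" and h: "hedges ?\<Gamma> = qedge l z ` {..<l}" unfolding qgraph_def by auto
  define idx where "idx = the_inv_into {..<l} (qedge l z)"
  have idx: "idx (qedge l z i) = i" if "i < l" for i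
    unfolding idx_def using the_inv_into_f_f[OF qedge_inj[OF l]] that by simp
  define Ed where "Ed e = insert (priv (idx e)) (w ` e)" for e
  have pn: "priv i \<notin> w ` verts ?\<Gamma>" if "i < l" for i using pr(2) that unfolding v by blast
  have ws: "w ` qedge l z i \<subseteq> w ` verts ?\<Gamma>" if "i < l" for i using qedge_subset[OF l that] unfolding v by blast
  have "spans E (expansion 3 ?\<Gamma>) (w ` verts ?\<Gamma> \<union> \<Union>(Ed ` hedges ?\<Gamma>))"
  proof (rule spans_expansion)
    show "inj_on w (verts ?\<Gamma>)" using w unfolding v .
    fix e assume "e \<in> hedges ?\<Gamma>"
    then obtain i where i: "i < l" "e = qedge l z i" unfolding h by auto
    show e: "e \<subseteq> verts ?\<Gamma> \<and> card e = 2" using qedge_card[OF l i(1)] qedge_subset[OF l i(1)] unfolding i v by blast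
    have Ee: "Ed e = insert (priv i) (w ` e)" unfolding Ed_def i(2) idx[OF i(1)] ..
    have "card (w ` e) = 2" using e w unfolding v by (metis card_image inj_on_subset)
    moreover have "finite (w ` e)" using calculation by (metis card.infinite zero_neq_numeral)
    moreover have "priv i \<notin> w ` e" using pn[OF i(1)] ws[OF i(1)] i by blast
    ultimately show "Ed e \<in> E \<and> finite (Ed e) \<and> card (Ed e) = 3 \<and> Ed e \<inter> w ` verts ?\<Gamma> = w ` e"
      unfolding Ee using E[OF i(1)] pn[OF i(1)] ws[OF i(1)] i by auto
    fix e' assume "e' \<in> hedges ?\<Gamma>" and ne: "e \<noteq> e'"
    then obtain j where j: "j < l" "e' = qedge l z j" unfolding h by auto
    have "priv i \<noteq> priv j" using pr(1) i j ne unfolding inj_on_def by blast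
    moreover have "Ed e' = insert (priv j) (w ` e')" unfolding Ed_def j(2) idx[OF j(1)] ..
    ultimately show "Ed e \<inter> Ed e' \<subseteq> w ` verts ?\<Gamma>" unfolding Ee using ws[OF i(1)] ws[OF j(1)] i j by auto
  qed
  moreover have "w ` verts ?\<Gamma> \<union> \<Union>(Ed ` hedges ?\<Gamma>) = w ` insert z {..<l} \<union> priv ` {..<l}"
  proof -
    have "\<Union>(Ed ` hedges ?\<Gamma>) = (\<Union>i<l. insert (priv i) (w ` qedge l z i))"
      unfolding h image_image by (rule SUP_cong) (auto simp: Ed_def idx)
    then show ?thesis using ws unfolding v[symmetric] by blast
  qed
  ultimately show ?thesis by simp
qed

section \<open>Blocks with two classes\<close>

lemma transversal_2: "transversal 2 \<phi> g = {\<phi> 0 (g 0), \<phi> 1 (g 1)}"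
  unfolding transversal_def by (auto simp: numeral_2_eq_2 lessThan_Suc)

locale block2 = block E 2 m C q \<phi> L for E :: "'a set set" and m C q \<phi> L
begin

lemma pair_lists:
  assumes "i < m" "j < m"
  shows "card (L {\<phi> 0 i, \<phi> 1 j}) = q" "finite (L {\<phi> 0 i, \<phi> 1 j})" "L {\<phi> 0 i, \<phi> 1 j} \<inter> grid 2 m \<phi> = {}"
    "L {\<phi> 0 i, \<phi> 1 j} \<subseteq> reach 2 m \<phi> L" "x \<in> L {\<phi> 0 i, \<phi> 1 j} \<Longrightarrow> {x, \<phi> 0 i, \<phi> 1 j} \<in> E"
proof -
  define g where "g s = (if s = 0 then i else j)" for s :: nat
  have g: "g \<in> {..<2} \<rightarrow> {..<m}" unfolding g_def using assms by auto
  have t: "transversal 2 \<phi> g = {\<phi> 0 i, \<phi> 1 j}" unfolding transversal_2 g_def by simp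
  show "card (L {\<phi> 0 i, \<phi> 1 j}) = q" "finite (L {\<phi> 0 i, \<phi> 1 j})" "L {\<phi> 0 i, \<phi> 1 j} \<inter> grid 2 m \<phi> = {}"
    "x \<in> L {\<phi> 0 i, \<phi> 1 j} \<Longrightarrow> {x, \<phi> 0 i, \<phi> 1 j} \<in> E"
    using list_card[OF g] list_fin[OF g] list_grid[OF g] list_edge[OF g] unfolding t by auto
  show "L {\<phi> 0 i, \<phi> 1 j} \<subseteq> reach 2 m \<phi> L" unfolding reach_def using g t by auto
qed

lemma pair_disjoint:
  assumes "i < m" "j < m" "i' < m" "j' < m" "i \<noteq> i'" "j \<noteq> j'"
  shows "L {\<phi> 0 i, \<phi> 1 j} \<inter> L {\<phi> 0 i', \<phi> 1 j'} = {}"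
proof -
  define g where "g i j s = (if s = 0 then i else j)" for s i j :: nat
  have t: "transversal 2 \<phi> (g i j) = {\<phi> 0 i, \<phi> 1 j}" for i j unfolding transversal_2 g_def by simp
  have "L (transversal 2 \<phi> (g i j)) \<inter> L (transversal 2 \<phi> (g i' j')) = {}"
    using assms by (intro list_disj) (auto simp: g_def)
  then show ?thesis unfolding t .
qed

text \<open>Symmetry of the classes, used in \<open>core_exists\<close> to assume that two meeting
  lists share their class-0 vertex.\<close>

lemma swap: "block2 E m C q (\<lambda>s. \<phi> (1 - s)) L"
proof -
  define sw where "sw g s = g (1 - s)" for g :: "nat \<Rightarrow> nat" and s :: nat
  have t: "transversal 2 (\<lambda>s. \<phi> (1 - s)) g = transversal 2 \<phi> (sw g)" for g
    unfolding transversal_2 sw_def by auto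
  have sw: "sw g \<in> {..<2} \<rightarrow> {..<m}" if "g \<in> {..<2} \<rightarrow> {..<m}" for g using that unfolding sw_def by auto
  have gr: "grid 2 m (\<lambda>s. \<phi> (1 - s)) = grid 2 m \<phi>"
  proof -
    have "grid 2 m \<psi> = \<psi> 0 ` {..<m} \<union> \<psi> 1 ` {..<m}" for \<psi> :: "nat \<Rightarrow> nat \<Rightarrow> 'a"
      unfolding grid_def numeral_2_eq_2 lessThan_Suc by auto
    then show ?thesis by auto
  qed
  show ?thesis
  proof (unfold_locales, unfold t gr)
    show "inj_on (\<lambda>(s, a). \<phi> (1 - s) a) ({..<2} \<times> {..<m})"
    proof (rule inj_onI)
      fix P Q assume PQ: "P \<in> {..<2} \<times> {..<m}" "Q \<in> {..<2} \<times> {..<m}"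
        "(\<lambda>(s, a). \<phi> (1 - s) a) P = (\<lambda>(s, a). \<phi> (1 - s) a) Q"
      obtain s a s' a' where P: "P = (s, a)" "Q = (s', a')" by (cases P; cases Q)
      have "1 - s = 1 - s' \<and> a = a'" using PQ phi_eq_iff[of "1 - s" a "1 - s'" a'] unfolding P by auto
      then show "P = Q" using PQ unfolding P by auto
    qed
    fix g :: "nat \<Rightarrow> nat" assume g: "g \<in> {..<2} \<rightarrow> {..<m}"
    show "L (transversal 2 \<phi> (sw g)) \<inter> L (transversal 2 \<phi> (sw h)) = {}"
      if "h \<in> {..<2} \<rightarrow> {..<m}" "\<And>i. i < 2 \<Longrightarrow> g i \<noteq> h i" for h
      using that by (intro list_disj sw g) (auto simp: sw_def)
  qed (use sw const_edge list_edge list_fin list_card list_C finC gridC list_grid in auto)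
qed

lemma reach_swap: "reach 2 m (\<lambda>s. \<phi> (1 - s)) L \<subseteq> reach 2 m \<phi> L"
proof -
  have "grid 2 m (\<lambda>s. \<phi> (1 - s)) \<subseteq> grid 2 m \<phi>"
    unfolding grid_def by (force simp: image_iff)
  moreover have "transversal 2 (\<lambda>s. \<phi> (1 - s)) g = transversal 2 \<phi> (\<lambda>s. g (1 - s))" for g
    unfolding transversal_2 by auto
  moreover have "(\<lambda>s. g (1 - s)) \<in> {..<2} \<rightarrow> {..<m}" if "g \<in> {..<2::nat} \<rightarrow> {..<m}" for g using that by auto
  ultimately show ?thesis unfolding reach_def by fastforce
qed

text \<open>A dichotomy. If two different lists meet, \<open>pair_disjoint\<close> forces their
  pairs to share a vertex, and a common element \<open>x\<close> forms edges with this vertex and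
  either of two grid vertices. Otherwise all lists are pairwise disjoint, which is recorded by
  \<open>ia' = ia\<close>.\<close>

lemma core_exists:
  assumes q: "q \<ge> 1" and m: "m \<ge> 1"
  shows "\<exists>\<psi> ib ia ia' x. block2 E m C q \<psi> L \<and> reach 2 m \<psi> L \<subseteq> reach 2 m \<phi> L \<and> ib < m \<and> ia < m \<and> ia' < m \<and>
    x \<in> L {\<psi> 0 ib, \<psi> 1 ia} \<and> (ia' \<noteq> ia \<and> x \<in> L {\<psi> 0 ib, \<psi> 1 ia'} \<or>
      ia' = ia \<and> (\<forall>i<m. \<forall>j<m. \<forall>i'<m. \<forall>j'<m. (i, j) \<noteq> (i', j') \<longrightarrow> L {\<psi> 0 i, \<psi> 1 j} \<inter> L {\<psi> 0 i', \<psi> 1 j'} = {}))"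
proof (cases "\<forall>i<m. \<forall>j<m. \<forall>i'<m. \<forall>j'<m. (i, j) \<noteq> (i', j') \<longrightarrow> L {\<phi> 0 i, \<phi> 1 j} \<inter> L {\<phi> 0 i', \<phi> 1 j'} = {}")
  case True
  have "L {\<phi> 0 0, \<phi> 1 0} \<noteq> {}" using pair_lists(1)[of 0 0] q m by auto
  then obtain x where "x \<in> L {\<phi> 0 0, \<phi> 1 0}" by blast
  then show ?thesis using True m block2_axioms
    by (intro exI[of _ \<phi>] exI[of _ 0] exI[of _ x]) auto
next
  case False
  then obtain i j i' j' x where ij: "i < m" "j < m" "i' < m" "j' < m" "(i, j) \<noteq> (i', j')"
    and x: "x \<in> L {\<phi> 0 i, \<phi> 1 j}" "x \<in> L {\<phi> 0 i', \<phi> 1 j'}" by blast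
  then have "i = i' \<or> j = j'" using pair_disjoint[of i j i' j'] by blast
  then show ?thesis
  proof
    assume "i = i'"
    then show ?thesis using ij x block2_axioms
      by (intro exI[of _ \<phi>] exI[of _ i] exI[of _ j] exI[of _ j'] exI[of _ x]) auto
  next
    assume "j = j'"
    then show ?thesis using ij x swap reach_swap
      by (intro exI[of _ "\<lambda>s. \<phi> (1 - s)"] exI[of _ j] exI[of _ i] exI[of _ i'] exI[of _ x]) (auto simp: insert_commute)
  qed
qed

text \<open>A path with an odd number of edges from class 0 to class 1 can alternate between the
  classes. Its ends are prescribed, while the other positions lie in a window untouched by
  \<open>Z'\<close>. So interior lists avoid \<open>Z\<close> automatically, and only the two end
  lists, controlled by \<open>HB\<close> and \<open>HA\<close>, can lose elements.\<close>

lemma odd_path: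
  assumes l: "l \<ge> 5" "odd l" and q: "q \<ge> 3" and ib: "ib < m" and ia: "ia < m"
    and Z: "finite Z'" "Z \<subseteq> Z'" "\<phi> 0 ib \<in> Z" "\<phi> 1 ia \<in> Z" and m: "l * (card Z' + 1) \<le> m"
    and HB: "\<And>p. p < m \<Longrightarrow> \<phi> 1 p \<notin> Z' \<Longrightarrow> L {\<phi> 0 ib, \<phi> 1 p} - Z \<noteq> {}"
    and HA: "\<And>p. p < m \<Longrightarrow> \<phi> 0 p \<notin> Z' \<Longrightarrow> L {\<phi> 0 p, \<phi> 1 ia} - Z \<noteq> {}"
  shows "\<exists>p \<xi>. p 0 = \<phi> 0 ib \<and> p (l - 2) = \<phi> 1 ia \<and> inj_on p {..l - 2} \<and> p ` {..l - 2} \<subseteq> grid 2 m \<phi> \<and>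
     (\<forall>s. 0 < s \<longrightarrow> s < l - 2 \<longrightarrow> p s \<notin> Z) \<and> inj_on \<xi> {..<l - 2} \<and>
     (\<forall>s<l - 2. \<xi> s \<in> reach 2 m \<phi> L - grid 2 m \<phi> - Z \<and> {\<xi> s, p s, p (Suc s)} \<in> E)"
proof -
  obtain k where k: "k + l \<le> m" "reach 2 l (\<lambda>i a. \<phi> i (k + a)) L \<inter> Z' = {}"
    using clean_shift[OF Z(1) m] by blast
  define n where "n = l - 2"
  define ix where "ix s = (if s = 0 then ib else if s = n then ia else k + s)" for s
  have n: "n \<ge> 3" "odd n" unfolding n_def using l by auto
  have ixm: "ix s < m" if "s \<le> n" for s using that ib ia k unfolding ix_def n_def by auto
  have cl: "\<phi> c (k + s) \<notin> Z'" if "c < 2" "s < l" for c s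
  proof -
    have "\<phi> c (k + s) \<in> grid 2 l (\<lambda>i a. \<phi> i (k + a))" unfolding grid_def using that by force
    then show ?thesis using k(2) unfolding reach_def by blast
  qed
  \<comment> \<open>Equal parity means equal class. A prescribed end differs from the window
    positions of its class because it lies in \<open>Z\<close>, which the window avoids.\<close>
  have ixne: "ix s \<noteq> ix s'" if "s \<le> n" "s' \<le> n" "s < s'" "even s = even s'" for s s'
  proof (cases "s = 0")
    case True
    then have s': "0 < s'" "s' < n" using that n by (auto simp: order_le_less)
    then have "s' < l" unfolding n_def by simp
    then have "\<phi> 0 (k + s') \<notin> Z" using cl[of 0 s'] Z(2) by auto
    then have "k + s' \<noteq> ib" using Z(3) by auto
    then show ?thesis using s' True unfolding ix_def by auto
  next
    case False
    show ?thesis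
    proof (cases "s' = n")
      case True
      have "s < l" using that True unfolding n_def by simp
      then have "\<phi> 1 (k + s) \<notin> Z" using cl[of 1 s] Z(2) by auto
      then have "k + s \<noteq> ia" using Z(4) by auto
      then show ?thesis using True False that unfolding ix_def by auto
    qed (use False that in \<open>auto simp: ix_def\<close>)
  qed
  define p where "p s = \<phi> (s mod 2) (ix s)" for s
  have pinj: "inj_on p {..n}"
  proof (rule inj_onI)
    fix s s' assume s: "s \<in> {..n}" "s' \<in> {..n}" "p s = p s'"
    then have "s mod 2 = s' mod 2 \<and> ix s = ix s'"
      using phi_eq_iff[of "s mod 2" "ix s" "s' mod 2" "ix s'"] ixm unfolding p_def by auto
    then have "even s = even s'" "ix s = ix s'" by (auto simp: even_iff_mod_2_eq_zero)
    then have "\<not> s < s'" "\<not> s' < s" using ixne[of s s'] ixne[of s' s] s by auto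
    then show "s = s'" by simp
  qed
  \<comment> \<open>The even and the odd one of \<open>s\<close> and \<open>Suc s\<close>, so that
    every pair can be written with its class-0 vertex first.\<close>
  define ev od where "ev s = (if even s then s else Suc s)" and "od s = (if even s then Suc s else s)" for s :: nat
  have pp: "{p s, p (Suc s)} = {\<phi> 0 (ix (ev s)), \<phi> 1 (ix (od s))}" for s
    unfolding p_def ev_def od_def by (cases "even s") (auto simp: mod2_eq_if)
  have eo: "ev s \<le> n" "od s \<le> n" if "s < n" for s using that unfolding ev_def od_def by auto
  define A where "A s = L {p s, p (Suc s)} - Z" for s
  have mid: "A s = L {p s, p (Suc s)}" if "0 < s" "s < n - 1" for s
  proof -
    have s: "ix (ev s) = k + ev s" "ix (od s) = k + od s" "ev s < l" "od s < l"
      using that n unfolding ix_def ev_def od_def n_def by auto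
    define g where "g c = (if c = 0 then ev s else od s)" for c :: nat
    have "g \<in> {..<2} \<rightarrow> {..<l}" unfolding g_def using s by auto
    moreover have "transversal 2 (\<lambda>i a. \<phi> i (k + a)) g = {p s, p (Suc s)}"
      unfolding transversal_2 pp s g_def by simp
    ultimately have "L {p s, p (Suc s)} \<subseteq> reach 2 l (\<lambda>i a. \<phi> i (k + a)) L" unfolding reach_def by auto
    then show ?thesis using k(2) Z(2) unfolding A_def by blast
  qed
  have "\<exists>\<xi>. inj_on \<xi> {..<n} \<and> (\<forall>s<n. \<xi> s \<in> A s)"
  \<comment> \<open>\<open>sdr_path\<close> does not apply, since without \<open>Z\<close> the end
    lists are only known to be nonempty.\<close>
  proof (rule sdr_ends[OF n(1)])
    have "\<phi> 1 (k + 1) \<notin> Z'" "k + 1 < m" using cl[of 1 1] l k by auto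
    then show "A 0 \<noteq> {}" using HB[of "k + 1"] n unfolding A_def pp ev_def od_def ix_def by auto
    have "\<phi> 0 (k + (n - 1)) \<notin> Z'" "k + (n - 1) < m" using cl[of 0 "n - 1"] l k n_def by auto
    moreover have "ev (n - 1) = n - 1" "od (n - 1) = n" unfolding ev_def od_def using n by auto
    ultimately show "A (n - 1) \<noteq> {}" using HA[of "k + (n - 1)"] n unfolding A_def pp ix_def by auto
    show "finite (A s) \<and> 3 \<le> card (A s)" if "0 < s" "s < n - 1" for s
      unfolding mid[OF that] pp using pair_lists(1,2)[OF ixm ixm] eo[of s] that q by auto
    show "A s \<inter> A s' = {}" if "s + 2 \<le> s'" "s' < n" for s s'
    proof -
      have "ev s < ev s'" "od s < od s'" "even (ev s)" "even (ev s')" "odd (od s)" "odd (od s')"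
        using that unfolding ev_def od_def by auto
      then have "ix (ev s) \<noteq> ix (ev s')" "ix (od s) \<noteq> ix (od s')"
        using ixne eo[of s] eo[of s'] that by auto
      then show ?thesis using pair_disjoint[of "ix (ev s)" "ix (od s)" "ix (ev s')" "ix (od s')"] ixm eo[of s] eo[of s'] that
        unfolding A_def pp by auto
    qed
  qed
  then obtain \<xi> where \<xi>: "inj_on \<xi> {..<n}" "\<And>s. s < n \<Longrightarrow> \<xi> s \<in> A s" by blast
  have "\<xi> s \<in> reach 2 m \<phi> L - grid 2 m \<phi> - Z \<and> {\<xi> s, p s, p (Suc s)} \<in> E" if s: "s < n" for s
  proof -
    have x: "\<xi> s \<in> L {\<phi> 0 (ix (ev s)), \<phi> 1 (ix (od s))}" "\<xi> s \<notin> Z" using \<xi>(2)[OF s] unfolding A_def pp by auto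
    note pl = pair_lists[OF ixm[OF eo(1)[OF s]] ixm[OF eo(2)[OF s]]]
    show ?thesis using x pl(3,4) pl(5)[OF x(1)] unfolding pp by blast
  qed
  moreover have "p s \<in> grid 2 m \<phi>" if "s \<le> n" for s unfolding p_def using ixm[OF that] by (intro phi_grid) auto
  moreover have "p s \<notin> Z" if "0 < s" "s < n" for s
  proof -
    have "s < l" using that unfolding n_def by simp
    then show ?thesis using cl[of "s mod 2" s] that Z(2) unfolding p_def ix_def by auto
  qed
  moreover have "p 0 = \<phi> 0 ib" "p n = \<phi> 1 ia" unfolding p_def ix_def using n by (auto simp: mod2_eq_if)
  ultimately show ?thesis unfolding n_def[symmetric] using pinj \<xi>(1) by (intro exI[of _ p] exI[of _ \<xi>]) auto
qed

text \<open>The detour over \<open>x\<close> has two edges and leaves the classes, so the rest of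
  the cycle is a path of odd length \<open>l - 2\<close>. Vertex 0 of the cycle is \<open>x\<close>;
  \<open>y'\<close> and \<open>y\<close> are the private vertices of the first and the last
  edge.\<close>

lemma odd_cycle_from_gadget:
  assumes l: "l \<ge> 5" "odd l" and q: "q \<ge> 3" and ib: "ib < m" and ia: "ia < m"
    and Z: "finite Z'" "Z \<subseteq> Z'" and m: "l * (card Z' + 1) \<le> m"
    and HB: "\<And>p. p < m \<Longrightarrow> \<phi> 1 p \<notin> Z' \<Longrightarrow> L {\<phi> 0 ib, \<phi> 1 p} - Z \<noteq> {}"
    and HA: "\<And>p. p < m \<Longrightarrow> \<phi> 0 p \<notin> Z' \<Longrightarrow> L {\<phi> 0 p, \<phi> 1 ia} - Z \<noteq> {}"
    and D: "{\<phi> 0 ib, \<phi> 1 ia, x, y, y'} \<subseteq> Z" "x \<notin> {\<phi> 0 ib, \<phi> 1 ia, y, y'}" "y \<noteq> y'" "y \<notin> {\<phi> 0 ib, \<phi> 1 ia}" "y' \<notin> {\<phi> 0 ib, \<phi> 1 ia}"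
    and E: "{y, \<phi> 1 ia, x} \<in> E" "{y', x, \<phi> 0 ib} \<in> E"
  shows "\<exists>U. spans E (expansion 3 (cycle_graph l)) U \<and> U \<subseteq> {\<phi> 0 ib, \<phi> 1 ia, x, y, y'} \<union> (reach 2 m \<phi> L - Z)"
proof -
  obtain p \<xi> where p: "p 0 = \<phi> 0 ib" "p (l - 2) = \<phi> 1 ia" "inj_on p {..l - 2}" "p ` {..l - 2} \<subseteq> grid 2 m \<phi>"
     "\<And>s. 0 < s \<Longrightarrow> s < l - 2 \<Longrightarrow> p s \<notin> Z" and \<xi>: "inj_on \<xi> {..<l - 2}"
     "\<And>s. s < l - 2 \<Longrightarrow> \<xi> s \<in> reach 2 m \<phi> L - grid 2 m \<phi> - Z \<and> {\<xi> s, p s, p (Suc s)} \<in> E"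
    using odd_path[OF l q ib ia Z _ _ m HB HA] D(1) by auto
  have pc: "p s \<in> {\<phi> 0 ib, \<phi> 1 ia} \<or> p s \<notin> Z" if "s \<le> l - 2" for s
    using p(1,2) p(5)[of s] that by (cases "s = 0"; cases "s = l - 2") auto
  define w where "w v = (if v = 0 then x else p (v - 1))" for v
  define priv where "priv i = (if i = 0 then y' else if i = l - 1 then y else \<xi> (i - 1))" for i
  have xp: "x \<noteq> p s" "y \<noteq> p s" "y' \<noteq> p s" if "s \<le> l - 2" for s using pc[OF that] D by auto
  have "spans E (expansion 3 (qgraph l 0)) (w ` insert 0 {..<l} \<union> priv ` {..<l})"
  proof (rule spans_qgraph_3[OF l(1)])
    show "inj_on w (insert 0 {..<l})"
    proof (rule inj_onI)
      fix a b assume ab: "a \<in> insert 0 {..<l}" "b \<in> insert 0 {..<l}" "w a = w b"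
      show "a = b"
      proof (cases "a = 0 \<or> b = 0")
        case True
        have "a - 1 \<le> l - 2" "b - 1 \<le> l - 2" using ab by auto
        then show ?thesis using True ab(3) xp(1)[of "a - 1"] xp(1)[of "b - 1"] unfolding w_def by (auto split: if_splits)
      next
        case False
        then have "a - 1 = b - 1" using ab p(3) l unfolding w_def inj_on_def by auto
        then show ?thesis using False by (cases a; cases b) auto
      qed
    qed
    show "inj_on priv {..<l}"
    proof (rule inj_on_lessThanI)
      fix i j assume ij: "i < j" "j < l"
      have y: "y \<in> Z" "y' \<in> Z" using D by auto
      consider "i = 0" "j = l - 1" | "i = 0" "j < l - 1" | "0 < i" "j = l - 1" | "0 < i" "j < l - 1" using ij by linarith
      then show "priv i \<noteq> priv j"
      proof cases
        case 1 then show ?thesis using D l unfolding priv_def by auto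
      next
        case 2 then show ?thesis using y \<xi>(2)[of "j - 1"] ij l unfolding priv_def by auto
      next
        case 3 then show ?thesis using y \<xi>(2)[of "i - 1"] ij l unfolding priv_def by auto
      next
        case 4
        then have "i - 1 \<in> {..<l - 2}" "j - 1 \<in> {..<l - 2}" "i - 1 \<noteq> j - 1" using ij by auto
        then have "\<xi> (i - 1) \<noteq> \<xi> (j - 1)" using \<xi>(1) unfolding inj_on_def by blast
        then show ?thesis using 4 ij unfolding priv_def by auto
      qed
    qed
    have "priv i \<noteq> w v" if "i < l" "v < l" for i v
    proof -
      have "priv i \<in> {y, y'} \<or> priv i \<in> reach 2 m \<phi> L - grid 2 m \<phi> - Z"
        using that \<xi>(2)[of "i - 1"] unfolding priv_def by auto
      moreover have "w v = x \<or> (v - 1 \<le> l - 2 \<and> w v = p (v - 1))" using that unfolding w_def by auto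
      ultimately show ?thesis using xp[of "v - 1"] p(4) D by fastforce
    qed
    then show "priv ` {..<l} \<inter> w ` insert 0 {..<l} = {}" using l by auto
    fix i assume i: "i < l"
    consider "i = 0" | "i = l - 1" | "0 < i" "i < l - 1" using i by linarith
    then show "insert (priv i) (w ` qedge l 0 i) \<in> E"
    proof cases
      case 1
      then show ?thesis using E(2) p(1) l unfolding priv_def qedge_def qnext_def w_def by (auto simp: insert_commute)
    next
      case 2
      have "w (l - 1) = \<phi> 1 ia" unfolding w_def using p(2) l by (auto simp: numeral_2_eq_2)
      moreover have "qedge l 0 i = {l - 1, 0}" unfolding qedge_def qnext_def using 2 l by auto
      moreover have "w 0 = x" "priv i = y" unfolding w_def priv_def using 2 l by auto
      ultimately show ?thesis using E(1) by simp
    next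
      case 3
      have "qedge l 0 i = {i, Suc i}" unfolding qedge_def qnext_def using 3 by auto
      moreover have "w i = p (i - 1)" "w (Suc i) = p (Suc (i - 1))" "priv i = \<xi> (i - 1)" unfolding w_def priv_def using 3 by auto
      ultimately show ?thesis using \<xi>(2)[of "i - 1"] 3 by auto
    qed
  qed simp
  moreover have "w ` insert 0 {..<l} \<union> priv ` {..<l} \<subseteq> {\<phi> 0 ib, \<phi> 1 ia, x, y, y'} \<union> (reach 2 m \<phi> L - Z)"
  proof -
    have pr: "p s \<in> {\<phi> 0 ib, \<phi> 1 ia} \<union> (reach 2 m \<phi> L - Z)" if "s \<le> l - 2" for s
      using pc[OF that] p(4) that unfolding reach_def by auto
    have "w v \<in> {\<phi> 0 ib, \<phi> 1 ia, x} \<union> (reach 2 m \<phi> L - Z)" if "v < l" for v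
    proof (cases "v = 0")
      case False
      then have "v - 1 \<le> l - 2" using that by simp
      then show ?thesis using pr[of "v - 1"] False unfolding w_def by auto
    qed (simp add: w_def)
    moreover have "priv i \<in> {y, y'} \<union> (reach 2 m \<phi> L - Z)" if "i < l" for i
      using that \<xi>(2)[of "i - 1"] unfolding priv_def by auto
    ultimately show ?thesis using l by (fastforce simp: image_subset_iff)
  qed
  ultimately show ?thesis using cycle_graph_eq[of l] l by auto
qed

end

text \<open>Each element of \<open>Z\<close> lies in at most one of the disjoint sets, so choosing a
  hit element is injective.\<close>

lemma card_hits:
  assumes "finite Z" "\<And>p p'. p \<in> P \<Longrightarrow> p' \<in> P \<Longrightarrow> p \<noteq> p' \<Longrightarrow> \<Lambda> p \<inter> \<Lambda> p' = {}"
  shows "card {p \<in> P. \<Lambda> p \<inter> Z \<noteq> {}} \<le> card Z"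
proof -
  have "\<exists>f. \<forall>p\<in>{p \<in> P. \<Lambda> p \<inter> Z \<noteq> {}}. f p \<in> \<Lambda> p \<inter> Z"
    by (rule bchoice) blast
  then obtain f where f: "\<And>p. p \<in> P \<Longrightarrow> \<Lambda> p \<inter> Z \<noteq> {} \<Longrightarrow> f p \<in> \<Lambda> p \<inter> Z" by blast
  show ?thesis
  proof (rule card_inj_on_le[of f])
    show "inj_on f {p \<in> P. \<Lambda> p \<inter> Z \<noteq> {}}"
    proof (rule inj_onI, rule ccontr)
      fix p p' assume "p \<in> {p \<in> P. \<Lambda> p \<inter> Z \<noteq> {}}" "p' \<in> {p \<in> P. \<Lambda> p \<inter> Z \<noteq> {}}" "f p = f p'" "p \<noteq> p'"
      then show False using assms(2)[of p p'] f[of p] f[of p'] by auto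
    qed
    show "f ` {p \<in> P. \<Lambda> p \<inter> Z \<noteq> {}} \<subseteq> Z" using f by blast
  qed (rule assms(1))
qed

lemma pick_outside: "finite W \<Longrightarrow> card W < card A \<Longrightarrow> \<exists>a\<in>A. a \<notin> W"
  by (metis card_mono leD subsetI)

section \<open>All odd cycles at once\<close>

context block2
begin

text \<open>An odd cycle closes up through a gadget: two edges \<open>{y, a, x}\<close>, \<open>{y', x, b}\<close> with \<open>x\<close> in the
  list of the pair \<open>a, b\<close>. The free vertices \<open>y, y'\<close> are only known to come from lists with \<open>t + 1\<close>
  elements, so they are fixed for all cycles at once, before the cycles are completed.\<close>

lemma disjoint_odd_cycles:
  assumes full: "\<And>T. T \<in> shade 2 E \<Longrightarrow> card (nbr E T) \<ge> t + 1"
    and k: "k \<ge> 1" "3 * k \<le> t + 1" "2 * k + 1 \<le> q"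
    and l: "\<And>i. i < k \<Longrightarrow> l i \<ge> 5 \<and> odd (l i) \<and> l i \<le> lm"
    and m: "((8 * k + 1) * k) * (lm * (18 * k + 1) + 1) \<le> m"
  shows "\<exists>U. \<forall>i<k. spans E (expansion 3 (cycle_graph (l i))) (U i) \<and> (\<forall>j<k. i \<noteq> j \<longrightarrow> U i \<inter> U j = {})"
proof -
  \<comment> \<open>\<open>N\<close> windows of length \<open>M\<close> supply candidate cores.
    \<open>N\<close> is what \<open>independent_subset\<close> needs for \<open>k\<close> cores of
    out-degree at most \<open>4 * k\<close>; \<open>M\<close> leaves room for a cycle of length at
    most \<open>lm\<close> that avoids \<open>18 * k\<close> vertices.\<close>
  define M where "M = lm * (18 * k + 1) + 1"
  define N where "N = (8 * k + 1) * k"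
  have sM: "\<sigma> * M + M \<le> m" if "\<sigma> < N" for \<sigma>
  proof -
    have "\<sigma> * M + M = Suc \<sigma> * M" by simp
    also have "\<dots> \<le> N * M" using that by (intro mult_le_mono1) simp
    finally show ?thesis using m unfolding M_def N_def by linarith
  qed
  define R where "R \<sigma> = reach 2 M (\<lambda>i a. \<phi> i (\<sigma> * M + a)) L" for \<sigma>
  have Rlt: "R \<sigma> \<inter> R \<tau> = {}" if "\<sigma> < \<tau>" "\<tau> < N" for \<sigma> \<tau>
  proof -
    have "\<sigma> * M + M \<le> \<tau> * M" using mult_le_mono1[of "Suc \<sigma>" \<tau> M] that by simp
    then show ?thesis unfolding R_def using reach_shift_disjoint[of "\<sigma> * M" M "\<tau> * M"] sM[OF that(2)] by simp
  qed
  have Rdisj: "R \<sigma> \<inter> R \<tau> = {}" if "\<sigma> < N" "\<tau> < N" "\<sigma> \<noteq> \<tau>" for \<sigma> \<tau>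
    using Rlt[of \<sigma> \<tau>] Rlt[of \<tau> \<sigma>] that by (cases "\<sigma> < \<tau>") auto
  define disjl where "disjl \<psi> \<longleftrightarrow> (\<forall>i<M. \<forall>j<M. \<forall>i'<M. \<forall>j'<M. (i, j) \<noteq> (i', j') \<longrightarrow>
    L {\<psi> 0 i, \<psi> 1 j} \<inter> L {\<psi> 0 i', \<psi> 1 j'} = {})" for \<psi> :: "nat \<Rightarrow> nat \<Rightarrow> 'a"
  define core where "core \<sigma> \<psi> ib ia ia' x \<longleftrightarrow> block2 E M C q \<psi> L \<and> reach 2 M \<psi> L \<subseteq> R \<sigma> \<and>
     ib < M \<and> ia < M \<and> ia' < M \<and> x \<in> L {\<psi> 0 ib, \<psi> 1 ia} \<and>
     (ia' \<noteq> ia \<and> x \<in> L {\<psi> 0 ib, \<psi> 1 ia'} \<or> ia' = ia \<and> disjl \<psi>)" for \<sigma> \<psi> ib ia ia' x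
  have "\<exists>\<psi> ib ia ia' x. core \<sigma> \<psi> ib ia ia' x" if "\<sigma> < N" for \<sigma>
  proof -
    interpret b: block2 E M C q "\<lambda>i a. \<phi> i (\<sigma> * M + a)" L
      unfolding block2_def using block_shift[OF sM[OF that]] .
    show ?thesis unfolding core_def R_def disjl_def using k by (intro b.core_exists) (auto simp: M_def)
  qed
  then obtain \<psi> ib ia ia' x where co: "\<And>\<sigma>. \<sigma> < N \<Longrightarrow> core \<sigma> (\<psi> \<sigma>) (ib \<sigma>) (ia \<sigma>) (ia' \<sigma>) (x \<sigma>)"
    by metis
  have bl: "block2 E M C q (\<psi> \<sigma>) L" and RR: "reach 2 M (\<psi> \<sigma>) L \<subseteq> R \<sigma>" and ibM: "ib \<sigma> < M" "ia \<sigma> < M" "ia' \<sigma> < M"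
    and xL: "x \<sigma> \<in> L {\<psi> \<sigma> 0 (ib \<sigma>), \<psi> \<sigma> 1 (ia \<sigma>)}"
    and ty: "ia' \<sigma> \<noteq> ia \<sigma> \<and> x \<sigma> \<in> L {\<psi> \<sigma> 0 (ib \<sigma>), \<psi> \<sigma> 1 (ia' \<sigma>)} \<or> ia' \<sigma> = ia \<sigma> \<and> disjl (\<psi> \<sigma>)"
    if "\<sigma> < N" for \<sigma> using co[OF that] unfolding core_def by auto
  define a b a' where "a \<sigma> = \<psi> \<sigma> 1 (ia \<sigma>)" and "b \<sigma> = \<psi> \<sigma> 0 (ib \<sigma>)" and "a' \<sigma> = \<psi> \<sigma> 1 (ia' \<sigma>)" for \<sigma>
  define K where "K \<sigma> = {a \<sigma>, b \<sigma>, x \<sigma>, a' \<sigma>}" for \<sigma>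
  have grd: "a \<sigma> \<in> grid 2 M (\<psi> \<sigma>)" "b \<sigma> \<in> grid 2 M (\<psi> \<sigma>)" "a' \<sigma> \<in> grid 2 M (\<psi> \<sigma>)" if "\<sigma> < N" for \<sigma>
    using block.phi_grid[OF block2.axioms[OF bl[OF that]]] ibM[OF that] unfolding a_def b_def a'_def by auto
  have xg: "x \<sigma> \<notin> grid 2 M (\<psi> \<sigma>)" "x \<sigma> \<in> R \<sigma>" "{x \<sigma>, b \<sigma>, a \<sigma>} \<in> E" if "\<sigma> < N" for \<sigma>
    using block2.pair_lists(3,4,5)[OF bl[OF that] ibM(1,2)[OF that]] xL[OF that] RR[OF that]
    unfolding a_def b_def by blast+
  have gR: "grid 2 M (\<psi> \<sigma>) \<subseteq> R \<sigma>" if "\<sigma> < N" for \<sigma> using RR[OF that] unfolding reach_def by blast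
  have KR: "K \<sigma> \<subseteq> R \<sigma>" if "\<sigma> < N" for \<sigma> using grd[OF that] gR[OF that] xg(2)[OF that] unfolding K_def by blast
  have ab: "a \<sigma> \<noteq> b \<sigma>" "a' \<sigma> \<noteq> b \<sigma>" "x \<sigma> \<noteq> a \<sigma>" "x \<sigma> \<noteq> b \<sigma>" "x \<sigma> \<noteq> a' \<sigma>" if "\<sigma> < N" for \<sigma>
  proof -
    show "x \<sigma> \<noteq> a \<sigma>" "x \<sigma> \<noteq> b \<sigma>" "x \<sigma> \<noteq> a' \<sigma>" using grd[OF that] xg(1)[OF that] by metis+
    show "a \<sigma> \<noteq> b \<sigma>" "a' \<sigma> \<noteq> b \<sigma>"
      using block.phi_eq_iff[OF block2.axioms[OF bl[OF that]]] ibM[OF that] unfolding a_def b_def a'_def by auto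
  qed
  have Kdisj: "K \<sigma> \<inter> K \<tau> = {}" if "\<sigma> < N" "\<tau> < N" "\<sigma> \<noteq> \<tau>" for \<sigma> \<tau>
    using KR[OF that(1)] KR[OF that(2)] Rdisj[OF that] by blast
  have nb: "card (nbr E {a \<sigma>, x \<sigma>}) \<ge> 3 * k" "card (nbr E {b \<sigma>, x \<sigma>}) \<ge> 3 * k" if "\<sigma> < N" for \<sigma>
  proof -
    have "card {a \<sigma>, x \<sigma>} = 2" "card {b \<sigma>, x \<sigma>} = 2" using ab(3,4)[OF that] by auto
    then have "{a \<sigma>, x \<sigma>} \<in> shade 2 E" "{b \<sigma>, x \<sigma>} \<in> shade 2 E"
      unfolding shade_def mem_Collect_eq by (intro conjI bexI[OF _ xg(3)[OF that]]; simp)+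
    then have "card (nbr E {a \<sigma>, x \<sigma>}) \<ge> t + 1" "card (nbr E {b \<sigma>, x \<sigma>}) \<ge> t + 1" by (simp_all only: full)
    then show "card (nbr E {a \<sigma>, x \<sigma>}) \<ge> 3 * k" "card (nbr E {b \<sigma>, x \<sigma>}) \<ge> 3 * k" using k(2) by linarith+
  qed
  \<comment> \<open>Candidates for \<open>y\<close>. When candidates are picked in turn, at most
    \<open>2 * k - 2\<close> vertices are already taken, so \<open>2 * k - 1\<close> suffice;
    \<open>y'\<close> also has to avoid \<open>y\<close> and gets \<open>2 * k\<close> below. The
    \<open>3 * k\<close> known extensions allow for both.\<close>
  have "\<exists>Y. Y \<subseteq> nbr E {a \<sigma>, x \<sigma>} - {b \<sigma>, a' \<sigma>} \<and> card Y = 2 * k - 1" if "\<sigma> < N" for \<sigma>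
  proof -
    have "card (nbr E {a \<sigma>, x \<sigma>}) - card {b \<sigma>, a' \<sigma>} \<le> card (nbr E {a \<sigma>, x \<sigma>} - {b \<sigma>, a' \<sigma>})"
      by (rule diff_card_le_card_Diff) simp
    moreover have "card {b \<sigma>, a' \<sigma>} \<le> 2" by (simp add: card_insert_if)
    ultimately have "2 * k - 1 \<le> card (nbr E {a \<sigma>, x \<sigma>} - {b \<sigma>, a' \<sigma>})" using nb(1)[OF that] k by linarith
    then show ?thesis by (meson obtain_subset_with_card_n)
  qed
  then obtain Y where Y: "\<And>\<sigma>. \<sigma> < N \<Longrightarrow> Y \<sigma> \<subseteq> nbr E {a \<sigma>, x \<sigma>} - {b \<sigma>, a' \<sigma>} \<and> card (Y \<sigma>) = 2 * k - 1" by metis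
  \<comment> \<open>If two lists meet, \<open>a'\<close> is the only candidate for
    \<open>y'\<close>: as a grid vertex it uses up no list element later.\<close>
  have "\<exists>Y. Y \<subseteq> nbr E {b \<sigma>, x \<sigma>} - {a \<sigma>} \<and> finite Y \<and> card Y \<le> 2 * k \<and>
      (Y = {a' \<sigma>} \<and> ia' \<sigma> \<noteq> ia \<sigma> \<or> card Y = 2 * k \<and> disjl (\<psi> \<sigma>))" if s: "\<sigma> < N" for \<sigma>
    using ty[OF s]
  proof
    assume A: "ia' \<sigma> \<noteq> ia \<sigma> \<and> x \<sigma> \<in> L {\<psi> \<sigma> 0 (ib \<sigma>), \<psi> \<sigma> 1 (ia' \<sigma>)}"
    have "{x \<sigma>, b \<sigma>, a' \<sigma>} \<in> E" unfolding b_def a'_def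
      using block2.pair_lists(5)[OF bl[OF s] ibM(1,3)[OF s]] A by blast
    then have "a' \<sigma> \<in> nbr E {b \<sigma>, x \<sigma>}" unfolding nbr_def using ab[OF s] by (auto simp: insert_commute)
    moreover have "a' \<sigma> \<noteq> a \<sigma>" unfolding a_def a'_def
      using block.phi_eq_iff[OF block2.axioms[OF bl[OF s]]] ibM[OF s] A by auto
    ultimately show ?thesis using A k by (intro exI[of _ "{a' \<sigma>}"]) auto
  next
    assume B: "ia' \<sigma> = ia \<sigma> \<and> disjl (\<psi> \<sigma>)"
    have "card (nbr E {b \<sigma>, x \<sigma>}) - card {a \<sigma>} \<le> card (nbr E {b \<sigma>, x \<sigma>} - {a \<sigma>})"
      by (rule diff_card_le_card_Diff) simp
    then have "2 * k \<le> card (nbr E {b \<sigma>, x \<sigma>} - {a \<sigma>})" using nb(2)[OF s] k by simp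
    then obtain Y where "Y \<subseteq> nbr E {b \<sigma>, x \<sigma>} - {a \<sigma>}" "card Y = 2 * k" "finite Y"
      by (meson obtain_subset_with_card_n)
    then show ?thesis using B by (intro exI[of _ Y]) auto
  qed
  then obtain Y' where Y': "\<And>\<sigma>. \<sigma> < N \<Longrightarrow> Y' \<sigma> \<subseteq> nbr E {b \<sigma>, x \<sigma>} - {a \<sigma>} \<and> finite (Y' \<sigma>) \<and> card (Y' \<sigma>) \<le> 2 * k \<and>
      (Y' \<sigma> = {a' \<sigma>} \<and> ia' \<sigma> \<noteq> ia \<sigma> \<or> card (Y' \<sigma>) = 2 * k \<and> disjl (\<psi> \<sigma>))" by metis
  have fY: "finite (Y \<sigma>)" if "\<sigma> < N" for \<sigma> using Y[OF that] k by (intro card_ge_0_finite) simp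
  \<comment> \<open>An arc means that a candidate of one core is a vertex of another. Cores are
    disjoint, so few arcs leave each, and \<open>k\<close> cores can be selected with no arcs
    between them.\<close>
  define out where "out \<sigma> = {\<tau>. K \<tau> \<inter> (Y \<sigma> \<union> Y' \<sigma>) \<noteq> {}}" for \<sigma>
  have "\<exists>I\<subseteq>{..<N}. card I = k \<and> (\<forall>\<sigma>\<in>I. \<forall>\<tau>\<in>I. \<sigma> \<noteq> \<tau> \<longrightarrow> \<tau> \<notin> out \<sigma>)"
  proof (rule independent_subset[where D = "4 * k"])
    fix \<sigma> assume "\<sigma> \<in> {..<N}"
    then have s: "\<sigma> < N" by simp
    have "card {\<tau> \<in> {..<N}. K \<tau> \<inter> (Y \<sigma> \<union> Y' \<sigma>) \<noteq> {}} \<le> card (Y \<sigma> \<union> Y' \<sigma>)"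
      using fY[OF s] Y'[OF s] Kdisj by (intro card_hits) auto
    also have "\<dots> \<le> card (Y \<sigma>) + card (Y' \<sigma>)" by (rule card_Un_le)
    also have "\<dots> \<le> 4 * k" using Y[OF s] Y'[OF s] by linarith
    also have "{\<tau> \<in> {..<N}. K \<tau> \<inter> (Y \<sigma> \<union> Y' \<sigma>) \<noteq> {}} = out \<sigma> \<inter> {..<N}" unfolding out_def by blast
    finally show "card (out \<sigma> \<inter> {..<N}) \<le> 4 * k" .
  qed (auto simp: N_def)
  then obtain I where I: "I \<subseteq> {..<N}" "card I = k" and ind: "\<And>\<sigma> \<tau>. \<sigma> \<in> I \<Longrightarrow> \<tau> \<in> I \<Longrightarrow> \<sigma> \<noteq> \<tau> \<Longrightarrow> K \<tau> \<inter> (Y \<sigma> \<union> Y' \<sigma>) = {}"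
    unfolding out_def by blast
  have "finite I" using I finite_subset by blast
  then obtain s where s: "bij_betw s {..<k} I" using I(2) ex_bij_betw_nat_finite[of I] by (auto simp: atLeast0LessThan)
  have sI: "s i \<in> I" "s i < N" if "i < k" for i using bij_betwE[OF s] I(1) that by auto
  have sne: "s i \<noteq> s j" if "i < k" "j < k" "i \<noteq> j" for i j
    using inj_onD[OF bij_betw_imp_inj_on[OF s], of i j] that by auto
  define P where "P i U \<longleftrightarrow> (\<exists>y y'. U = {y, y'} \<and> y \<noteq> y' \<and> y \<in> Y (s i) \<and> y' \<in> Y' (s i))" for i U
  have "\<exists>U. \<forall>i<k. P i (U i) \<and> finite (U i) \<and> U i \<inter> {} = {} \<and> (\<forall>j<k. i \<noteq> j \<longrightarrow> U i \<inter> U j = {})"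
  \<comment> \<open>Each core is its own supply, which keeps \<open>a'\<close> free where it is the
    only candidate.\<close>
  proof (rule greedy_pack[where A = "\<lambda>i. K (s i)" and B = "\<Union>i<k. K (s i)" and w = 0 and z = 2])
    fix i W assume i: "i < k" and W: "finite W" "card W \<le> 0 + (k - 1) * 2" "W \<inter> K (s i) = {}"
    note si = sI(2)[OF i]
    have "card W < card (Y (s i))" using Y[OF si] W k by simp
    then obtain y where y: "y \<in> Y (s i)" "y \<notin> W" using pick_outside[OF W(1)] by blast
    have "\<exists>y'\<in>Y' (s i). y' \<notin> insert y W"
    proof (cases "card (Y' (s i)) = 2 * k")
      case True
      have "card (insert y W) < card (Y' (s i))" using W k y True by simp
      then show ?thesis using W(1) by (intro pick_outside) auto
    next
      case False
      then have "Y' (s i) = {a' (s i)}" using Y'[OF si] by blast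
      moreover have "a' (s i) \<notin> W" using W(3) unfolding K_def by blast
      moreover have "y \<noteq> a' (s i)" using Y[OF si] y by blast
      ultimately show ?thesis by auto
    qed
    then obtain y' where y': "y' \<in> Y' (s i)" "y' \<noteq> y" "y' \<notin> W" by blast
    have "{y, y'} \<inter> (\<Union>j<k. K (s j)) \<subseteq> K (s i)"
    proof
      fix v assume v: "v \<in> {y, y'} \<inter> (\<Union>j<k. K (s j))"
      then obtain j where j: "j < k" "v \<in> K (s j)" by blast
      have "v \<in> Y (s i) \<union> Y' (s i)" using v y y' by blast
      then have "s j = s i" using ind[OF sI(1)[OF i] sI(1)[OF j(1)]] j(2) by (metis IntI empty_iff)
      then show "v \<in> K (s i)" using j by simp
    qed
    moreover have "P i {y, y'}" unfolding P_def using y y' by metis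
    moreover have "{y, y'} \<inter> W = {}" "card {y, y'} \<le> 2" using y y' by auto
    ultimately show "\<exists>U. P i U \<and> finite U \<and> card U \<le> 2 \<and> U \<inter> W = {} \<and> U \<inter> (\<Union>i<k. K (s i)) \<subseteq> K (s i)"
      by (intro exI[of _ "{y, y'}"]) auto
  next
    show "K (s i) \<inter> K (s j) = {}" if "i < k" "j < k" "i \<noteq> j" for i j
      using Kdisj[OF sI(2)[OF that(1)] sI(2)[OF that(2)] sne[OF that]] .
  qed auto
  then obtain U0 where *: "\<forall>i<k. P i (U0 i) \<and> finite (U0 i) \<and> U0 i \<inter> {} = {} \<and> (\<forall>j<k. i \<noteq> j \<longrightarrow> U0 i \<inter> U0 j = {})"
    by (elim exE) (rule that)
  have U0: "\<And>i. i < k \<Longrightarrow> P i (U0 i)" "\<And>i j. i < k \<Longrightarrow> j < k \<Longrightarrow> i \<noteq> j \<Longrightarrow> U0 i \<inter> U0 j = {}"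
    using * by simp_all
  have "\<forall>i. \<exists>y y'. i < k \<longrightarrow> U0 i = {y, y'} \<and> y \<noteq> y' \<and> y \<in> Y (s i) \<and> y' \<in> Y' (s i)"
    using U0(1) unfolding P_def by metis
  then obtain y y' where yy: "\<And>i. i < k \<Longrightarrow> U0 i = {y i, y' i} \<and> y i \<noteq> y' i \<and> y i \<in> Y (s i) \<and> y' i \<in> Y' (s i)" by metis
  define G where "G i = K (s i) \<union> {y i, y' i}" for i
  define Z where "Z = (\<Union>i<k. G i)"
  have Gdisj: "G i \<inter> G j = {}" if ij: "i < k" "j < k" "i \<noteq> j" for i j
  proof -
    have "K (s i) \<inter> K (s j) = {}" using Kdisj[OF sI(2)[OF ij(1)] sI(2)[OF ij(2)] sne[OF ij]] .
    moreover have "{y i, y' i} \<inter> {y j, y' j} = {}" using U0(2)[OF ij] yy[OF ij(1)] yy[OF ij(2)] by simp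
    moreover have "{y i, y' i} \<inter> K (s j) = {}" using ind[OF sI(1)[OF ij(1)] sI(1)[OF ij(2)] sne[OF ij]] yy[OF ij(1)] by blast
    moreover have "{y j, y' j} \<inter> K (s i) = {}"
      using ind[OF sI(1)[OF ij(2)] sI(1)[OF ij(1)] sne[OF ij(2,1) ij(3)[symmetric]]] yy[OF ij(2)] by blast
    ultimately show ?thesis unfolding G_def by blast
  qed
  have fG: "finite (G i)" for i unfolding G_def K_def by simp
  have fZ: "finite Z" unfolding Z_def using fG by simp
  have "card (G i) \<le> 6" for i unfolding G_def K_def
    by (rule order_trans[OF card_Un_le]) (auto simp: card_insert_if)
  then have "(\<Sum>i<k. card (G i)) \<le> k * 6" using sum_bounded_above[of "{..<k}" "\<lambda>i. card (G i)" 6] by simp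
  moreover have "card Z \<le> (\<Sum>i<k. card (G i))" unfolding Z_def by (rule card_UN_le) simp
  ultimately have cZ: "card Z \<le> 6 * k" by simp
  have "\<exists>U. spans E (expansion 3 (cycle_graph (l i))) U \<and> U \<subseteq> G i \<union> (R (s i) - Z)" if i: "i < k" for i
  proof -
    note si = sI(2)[OF i]
    interpret b: block2 E M C q "\<psi> (s i)" L by (rule bl[OF si])
    have GZ: "G i \<subseteq> Z" unfolding Z_def using i by blast
    have yi: "y i \<in> nbr E {a (s i), x (s i)}" "y i \<notin> {b (s i), a' (s i)}" "y' i \<in> nbr E {b (s i), x (s i)}" "y' i \<noteq> a (s i)"
      using yy[OF i] Y[OF si] Y'[OF si] by blast+
    \<comment> \<open>Such a list lies in the window of this core and off the grid. It can lose only
      \<open>x\<close>, the chosen \<open>y j\<close>, and the \<open>y' j\<close> of other cores,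
      since the own \<open>y' i\<close> is in the grid: at most \<open>2 * k\<close> losses, against
      \<open>q \<ge> 2 * k + 1\<close>.\<close>
    have typeA: "\<Lambda> - Z \<noteq> {}" if A: "Y' (s i) = {a' (s i)}"
      and \<Lambda>: "\<Lambda> \<subseteq> R (s i)" "\<Lambda> \<inter> grid 2 M (\<psi> (s i)) = {}" "card \<Lambda> = q" for \<Lambda>
    proof -
      define Q where "Q = insert (x (s i)) (y ` {..<k} \<union> y' ` ({..<k} - {i}))"
      have "\<Lambda> \<inter> Z \<subseteq> Q"
      proof
        fix v assume v: "v \<in> \<Lambda> \<inter> Z"
        then obtain j where j: "j < k" "v \<in> G j" unfolding Z_def by blast
        have vg: "v \<notin> grid 2 M (\<psi> (s i))" using v \<Lambda> by blast
        show "v \<in> Q"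
        proof (cases "v \<in> K (s j)")
          case True
          have "j = i"
          proof (rule ccontr)
            assume "j \<noteq> i"
            then have "R (s j) \<inter> R (s i) = {}" using Rdisj[OF sI(2)[OF j(1)] si sne[OF j(1) i]] by simp
            then show False using KR[OF sI(2)[OF j(1)]] True v \<Lambda>(1) by blast
          qed
          then have "v = x (s i)" using True vg grd[OF si] unfolding K_def by blast
          then show ?thesis unfolding Q_def by simp
        next
          case False
          then have "v = y j \<or> v = y' j" using j unfolding G_def by blast
          moreover have "y' i = a' (s i)" using yy[OF i] A by blast
          then have "v \<noteq> y' i" using vg grd(3)[OF si] by metis
          ultimately show ?thesis unfolding Q_def using j by auto
        qed
      qed
      moreover have "card Q < q"
      proof -
        have "card Q \<le> Suc (card (y ` {..<k} \<union> y' ` ({..<k} - {i})))"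
          unfolding Q_def by (rule card_insert_le_m1) auto
        also have "\<dots> \<le> Suc (card (y ` {..<k}) + card (y' ` ({..<k} - {i})))" using card_Un_le by auto
        also have "card (y ` {..<k}) \<le> k" using card_image_le[of "{..<k}" y] by simp
        also have "card (y' ` ({..<k} - {i})) \<le> k - 1" using card_image_le[of "{..<k} - {i}" y'] i by simp
        finally show ?thesis using k by simp
      qed
      moreover have "finite Q" unfolding Q_def by simp
      ultimately have "\<not> \<Lambda> \<subseteq> Z" using \<Lambda>(3) card_mono[of Q \<Lambda>] by (metis Int_absorb2 leD)
      then show ?thesis by blast
    qed
    \<comment> \<open>If the lists are pairwise disjoint, a vertex of \<open>Z\<close> meets at most
      one list at \<open>b\<close> and one at \<open>a\<close>. The grid vertices concerned join the
      set to be avoided, which triples the bound \<open>6 * k\<close>.\<close>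
    define ZB where "ZB = Z \<union> \<psi> (s i) 1 ` {p \<in> {..<M}. L {b (s i), \<psi> (s i) 1 p} \<inter> Z \<noteq> {}}
      \<union> \<psi> (s i) 0 ` {p \<in> {..<M}. L {\<psi> (s i) 0 p, a (s i)} \<inter> Z \<noteq> {}}"
    define Z' where "Z' = (if Y' (s i) = {a' (s i)} then Z else ZB)"
    have plB: "card (L {b (s i), \<psi> (s i) 1 p}) = q" "L {b (s i), \<psi> (s i) 1 p} \<inter> grid 2 M (\<psi> (s i)) = {}"
       "L {b (s i), \<psi> (s i) 1 p} \<subseteq> R (s i)" if "p < M" for p
      using b.pair_lists(1,3,4)[OF ibM(1)[OF si] that] RR[OF si] unfolding b_def by blast+
    have plA: "card (L {\<psi> (s i) 0 p, a (s i)}) = q" "L {\<psi> (s i) 0 p, a (s i)} \<inter> grid 2 M (\<psi> (s i)) = {}"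
       "L {\<psi> (s i) 0 p, a (s i)} \<subseteq> R (s i)" if "p < M" for p
      using b.pair_lists(1,3,4)[OF that ibM(2)[OF si]] RR[OF si] unfolding a_def by blast+
    have fZ': "finite Z'" unfolding Z'_def ZB_def using fZ by simp
    have ZZ': "Z \<subseteq> Z'" unfolding Z'_def ZB_def by auto
    have cZ': "card Z' \<le> 18 * k"
    proof (cases "Y' (s i) = {a' (s i)}")
      case True
      then show ?thesis unfolding Z'_def using cZ by simp
    next
      case False
      then have dj: "disjl (\<psi> (s i))" using Y'[OF si] by blast
      have "card {p \<in> {..<M}. L {b (s i), \<psi> (s i) 1 p} \<inter> Z \<noteq> {}} \<le> card Z"
      proof (rule card_hits[OF fZ])
        fix p p' assume "p \<in> {..<M}" "p' \<in> {..<M}" "p \<noteq> p'"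
        then show "L {b (s i), \<psi> (s i) 1 p} \<inter> L {b (s i), \<psi> (s i) 1 p'} = {}"
          using dj[unfolded disjl_def, rule_format, of "ib (s i)" p "ib (s i)" p'] ibM[OF si] unfolding b_def by auto
      qed
      moreover have "card {p \<in> {..<M}. L {\<psi> (s i) 0 p, a (s i)} \<inter> Z \<noteq> {}} \<le> card Z"
      proof (rule card_hits[OF fZ])
        fix p p' assume "p \<in> {..<M}" "p' \<in> {..<M}" "p \<noteq> p'"
        then show "L {\<psi> (s i) 0 p, a (s i)} \<inter> L {\<psi> (s i) 0 p', a (s i)} = {}"
          using dj[unfolded disjl_def, rule_format, of p "ia (s i)" p' "ia (s i)"] ibM[OF si] unfolding a_def by auto
      qed
      moreover have "card (f ` {p \<in> {..<M}. Q p}) \<le> card {p \<in> {..<M}. Q p}" for f :: "nat \<Rightarrow> 'a" and Q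
        by (rule card_image_le) simp
      moreover have "card ZB \<le> card Z + card (\<psi> (s i) 1 ` {p \<in> {..<M}. L {b (s i), \<psi> (s i) 1 p} \<inter> Z \<noteq> {}})
        + card (\<psi> (s i) 0 ` {p \<in> {..<M}. L {\<psi> (s i) 0 p, a (s i)} \<inter> Z \<noteq> {}})"
        unfolding ZB_def by (meson add_le_mono1 card_Un_le order_trans)
      ultimately have "card ZB \<le> card Z + card Z + card Z" by (meson add_le_mono order_refl order_trans)
      then show ?thesis unfolding Z'_def using cZ False by simp
    qed
    have "\<exists>U. spans E (expansion 3 (cycle_graph (l i))) U \<and>
        U \<subseteq> {\<psi> (s i) 0 (ib (s i)), \<psi> (s i) 1 (ia (s i)), x (s i), y i, y' i} \<union> (reach 2 M (\<psi> (s i)) L - Z)"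
    proof (rule b.odd_cycle_from_gadget[where Z' = Z'])
      show "l i \<ge> 5" "odd (l i)" using l[OF i] by auto
      show "q \<ge> 3" using k by simp
      show "ib (s i) < M" "ia (s i) < M" using ibM[OF si] by auto
      show "finite Z'" "Z \<subseteq> Z'" by fact+
      have "l i * (card Z' + 1) \<le> lm * (18 * k + 1)" using l[OF i] cZ' by (intro mult_le_mono) auto
      then show "l i * (card Z' + 1) \<le> M" unfolding M_def by simp
      show "L {\<psi> (s i) 0 (ib (s i)), \<psi> (s i) 1 p} - Z \<noteq> {}" if p: "p < M" "\<psi> (s i) 1 p \<notin> Z'" for p
      proof (cases "Y' (s i) = {a' (s i)}")
        case True
        show ?thesis using typeA[OF True plB(3,2,1)[OF p(1)]] unfolding b_def .
      next
        case False
        have "L {b (s i), \<psi> (s i) 1 p} \<inter> Z = {}" using p False unfolding Z'_def ZB_def by auto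
        moreover have "L {b (s i), \<psi> (s i) 1 p} \<noteq> {}" using plB(1)[OF p(1)] k by auto
        ultimately show ?thesis unfolding b_def by blast
      qed
      show "L {\<psi> (s i) 0 p, \<psi> (s i) 1 (ia (s i))} - Z \<noteq> {}" if p: "p < M" "\<psi> (s i) 0 p \<notin> Z'" for p
      proof (cases "Y' (s i) = {a' (s i)}")
        case True
        show ?thesis using typeA[OF True plA(3,2,1)[OF p(1)]] unfolding a_def .
      next
        case False
        have "L {\<psi> (s i) 0 p, a (s i)} \<inter> Z = {}" using p False unfolding Z'_def ZB_def by auto
        moreover have "L {\<psi> (s i) 0 p, a (s i)} \<noteq> {}" using plA(1)[OF p(1)] k by auto
        ultimately show ?thesis unfolding a_def by blast
      qed
      show "{\<psi> (s i) 0 (ib (s i)), \<psi> (s i) 1 (ia (s i)), x (s i), y i, y' i} \<subseteq> Z"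
        using GZ unfolding G_def K_def a_def b_def by blast
      show "x (s i) \<notin> {\<psi> (s i) 0 (ib (s i)), \<psi> (s i) 1 (ia (s i)), y i, y' i}"
        using ab[OF si] yi unfolding a_def b_def nbr_def by auto
      show "y i \<noteq> y' i" using yy[OF i] by blast
      show "y i \<notin> {\<psi> (s i) 0 (ib (s i)), \<psi> (s i) 1 (ia (s i))}"
        using yi(1,2) unfolding a_def b_def nbr_def by auto
      show "y' i \<notin> {\<psi> (s i) 0 (ib (s i)), \<psi> (s i) 1 (ia (s i))}"
        using yi(3,4) unfolding a_def b_def nbr_def by auto
      show "{y i, \<psi> (s i) 1 (ia (s i)), x (s i)} \<in> E" using yi(1) unfolding a_def nbr_def by blast
      show "{y' i, x (s i), \<psi> (s i) 0 (ib (s i))} \<in> E"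
        using yi(3) unfolding b_def nbr_def by (simp add: insert_commute)
    qed
    then obtain U where U: "spans E (expansion 3 (cycle_graph (l i))) U"
      "U \<subseteq> {b (s i), a (s i), x (s i), y i, y' i} \<union> (reach 2 M (\<psi> (s i)) L - Z)" unfolding a_def b_def by blast
    then have "U \<subseteq> G i \<union> (R (s i) - Z)" using RR[OF si] unfolding G_def K_def by blast
    then show ?thesis using U(1) by blast
  qed
  then obtain U where U: "\<And>i. i < k \<Longrightarrow> spans E (expansion 3 (cycle_graph (l i))) (U i) \<and> U i \<subseteq> G i \<union> (R (s i) - Z)" by metis
  have "U i \<inter> U j = {}" if ij: "i < k" "j < k" "i \<noteq> j" for i j
  proof -
    have "G i \<subseteq> Z" "G j \<subseteq> Z" unfolding Z_def using ij by blast+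
    moreover have "R (s i) \<inter> R (s j) = {}" using Rdisj[OF sI(2)[OF ij(1)] sI(2)[OF ij(2)] sne[OF ij]] .
    ultimately show ?thesis using Gdisj[OF ij] U[OF ij(1)] U[OF ij(2)] by blast
  qed
  then show ?thesis using U by blast
qed

end

section \<open>Packing the components\<close>

definition packs :: "'a set set \<Rightarrow> nat \<Rightarrow> (nat \<Rightarrow> 'b hypergraph) \<Rightarrow> bool" where
  "packs E n H \<longleftrightarrow> (\<exists>U. \<forall>i<n. spans E (H i) (U i) \<and> (\<forall>j<n. i \<noteq> j \<longrightarrow> U i \<inter> U j = {}))"

lemma disjoint_subsets_of_card:
  fixes n :: nat
  assumes "finite C" "(\<Sum>i<n. c i) \<le> card C"
  shows "\<exists>A. \<forall>i<n. A i \<subseteq> C \<and> card (A i) = c i \<and> (\<forall>j<n. i \<noteq> j \<longrightarrow> A i \<inter> A j = {})"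
  using assms
proof (induction n arbitrary: C)
  case (Suc n)
  obtain B where B: "B \<subseteq> C" "card B = c n" "finite B"
    using Suc.prems obtain_subset_with_card_n[of "c n" C] by (auto intro: finite_subset)
  have "(\<Sum>i<n. c i) \<le> card (C - B)" using Suc.prems B by (simp add: card_Diff_subset)
  then obtain A where A: "\<forall>i<n. A i \<subseteq> C - B \<and> card (A i) = c i \<and> (\<forall>j<n. i \<noteq> j \<longrightarrow> A i \<inter> A j = {})"
    using Suc.IH[of "C - B"] Suc.prems by auto
  have "A i \<inter> B = {}" "B \<inter> A i = {}" if "i < n" for i using A that by blast+
  then show ?case using A B by (intro exI[of _ "A(n := B)"]) (auto simp: less_Suc_eq)
qed simp

lemma sum_if_less:
  fixes g :: nat
  shows "(\<Sum>i<k + p. if i < k then f i else g) = (\<Sum>i<k. f i) + p * g"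
proof -
  have "(\<Sum>i<k + p. if i < k then f i else g) = (\<Sum>i<k. if i < k then f i else g) + (\<Sum>i=k..<k + p. if i < k then f i else g)"
    unfolding lessThan_atLeast0 by (rule sum.atLeastLessThan_concat[symmetric]) auto
  moreover have "(\<Sum>i=k..<k + p. if i < k then f i else g) = (\<Sum>i=k..<k + p. g)" by (rule sum.cong) auto
  ultimately show ?thesis by simp
qed

text \<open>\<open>A i\<close> are the constants reserved for component \<open>i\<close>, and
  \<open>W0\<close> holds vertices occupied beforehand, namely by odd cycles when
  \<open>r = 3\<close>. The length of the block pays for the largest \<open>W\<close> that can
  occur.\<close>

lemma (in block) pack_from_block:
  assumes loc: "\<And>i \<psi>. i < n \<Longrightarrow> block E d m' C q \<psi> L \<Longrightarrow> \<exists>U. spans E (H i) U \<and> U \<subseteq> A i \<union> reach d m' \<psi> L"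
    and A: "\<And>i j. i < n \<Longrightarrow> j < n \<Longrightarrow> i \<noteq> j \<Longrightarrow> A i \<inter> A j = {}" "\<And>i. i < n \<Longrightarrow> A i \<subseteq> C"
    and H: "\<And>i. i < n \<Longrightarrow> finite (verts (H i)) \<and> card (verts (H i)) \<le> z"
    and W0: "finite W0" "card W0 \<le> w" "\<And>i. i < n \<Longrightarrow> W0 \<inter> A i = {}"
    and m: "m' * (w + (n - 1) * z + 1) \<le> m"
  shows "\<exists>U. \<forall>i<n. spans E (H i) (U i) \<and> finite (U i) \<and> U i \<inter> W0 = {} \<and> (\<forall>j<n. i \<noteq> j \<longrightarrow> U i \<inter> U j = {})"
proof (rule greedy_pack[OF _ A W0])
  fix i W assume i: "i < n" and W: "finite W" "card W \<le> w + (n - 1) * z" "W \<inter> A i = {}"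
  have "m' * (card W + 1) \<le> m' * (w + (n - 1) * z + 1)" using W by (intro mult_le_mono) auto
  then have "m' * (card W + 1) \<le> m" using m by linarith
  then obtain U where U: "spans E (H i) U" "U \<inter> W = {}" "U \<inter> C \<subseteq> A i"
    using robust_copy[OF W(1) _ A(2)[OF i] W(3) loc[OF i]] by blast
  then show "\<exists>U. spans E (H i) U \<and> finite U \<and> card U \<le> z \<and> U \<inter> W = {} \<and> U \<inter> C \<subseteq> A i"
    using spans_card[OF U(1)] H[OF i] by auto
qed

lemma finite_qgraph: "finite (verts (qgraph l z))" "finite (hedges (qgraph l z))"
  unfolding qgraph_def by auto

lemma star_graph_simps: "verts (star_graph u) = {..u}" "hedges (star_graph u) = (\<lambda>v. {0, v}) ` {1..u}"
  unfolding star_graph_def by auto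

lemma finite_expansion: "finite (verts \<Gamma>) \<Longrightarrow> finite (hedges \<Gamma>) \<Longrightarrow> finite (verts (expansion r \<Gamma>))"
  unfolding expansion_def by auto

text \<open>The last assumption is the shape shared by paths, cycles and stars, so the graph can be
  read off a fan and then expanded.\<close>

lemma full_component:
  assumes E: "\<And>e. e \<in> E \<Longrightarrow> finite e \<and> card e = r" "E \<noteq> {}" and r: "r \<ge> 3"
    and full: "\<And>T. T \<in> shade (r - 1) E \<Longrightarrow> card (nbr E T) \<ge> N"
    and W: "finite W" "card W + 2 * n + 3 + r * card (hedges \<Gamma>) < N" and n: "n \<ge> 1"
    and \<Gamma>: "verts \<Gamma> \<subseteq> {..n}" "finite (hedges \<Gamma>)" "\<And>e. e \<in> hedges \<Gamma> \<Longrightarrow> e \<subseteq> verts \<Gamma> \<and> card e = 2"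
      "\<And>e. e \<in> hedges \<Gamma> \<Longrightarrow> \<exists>i. 1 \<le> i \<and> i < n \<and> e \<subseteq> {0, i, i + 1}"
  shows "\<exists>U. spans E (expansion r \<Gamma>) U \<and> U \<inter> W = {}"
proof -
  have "card W + n + 2 < N" using W by simp
  from full_fan[OF E r full W(1) this n] obtain u where u: "inj_on u {..n}" "u ` {..n} \<inter> W = {}"
     "\<And>i. 1 \<le> i \<Longrightarrow> i < n \<Longrightarrow> \<exists>e\<in>E. {u 0, u i, u (i + 1)} \<subseteq> e" by blast
  have cv: "card (verts \<Gamma>) \<le> n + 1" using card_mono[OF _ \<Gamma>(1)] by simp
  show ?thesis
  proof (rule full_expand[OF E(1) _ full W(1), where w = u])
    show "card W + card (verts \<Gamma>) + r * card (hedges \<Gamma>) < N" using W cv by simp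
    show "finite (verts \<Gamma>)" using \<Gamma>(1) finite_subset by blast
    show "inj_on u (verts \<Gamma>)" using u(1) \<Gamma>(1) by (rule inj_on_subset)
    show "u ` verts \<Gamma> \<inter> W = {}" using u(2) \<Gamma>(1) by blast
    show "\<exists>e'\<in>E. u ` e \<subseteq> e'" if e: "e \<in> hedges \<Gamma>" for e
    proof -
      obtain i where i: "1 \<le> i" "i < n" "e \<subseteq> {0, i, i + 1}" using \<Gamma>(4)[OF e] by blast
      obtain e' where "e' \<in> E" "{u 0, u i, u (i + 1)} \<subseteq> e'" using u(3)[OF i(1,2)] by blast
      then show ?thesis using i(3) by blast
    qed
  qed (use r \<Gamma> in auto)
qed

text \<open>Indices start at 0 and \<open>z i\<close> encodes path or cycle. The equation for
  \<open>t + 1\<close> avoids truncated subtraction; its right side is the cover number of the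
  forbidden hypergraph.\<close>

locale components =
  fixes r k p t :: nat and l z u :: "nat \<Rightarrow> nat"
  assumes r: "r \<ge> 3" and k: "k \<ge> 1" and l: "\<And>i. i < k \<Longrightarrow> l i \<ge> 5" and z: "\<And>i. i < k \<Longrightarrow> z i = 0 \<or> z i = l i"
    and u: "\<And>j. j < p \<Longrightarrow> u j \<ge> 2" and t: "t + 1 = (\<Sum>i<k. (l i + 1) div 2) + p"
begin

definition \<Gamma> :: "nat \<Rightarrow> nat hypergraph" where
  "\<Gamma> i = (if i < k then qgraph (l i) (z i) else star_graph (u (i - k)))"

text \<open>A crude common bound for the size of a component, hence a sum instead of a
  maximum.\<close>

definition vsum :: nat where
  "vsum = (\<Sum>i<k + p. card (verts (expansion r (\<Gamma> i))))"

lemma finite_\<Gamma>: "finite (verts (\<Gamma> i))" "finite (hedges (\<Gamma> i))"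
  unfolding \<Gamma>_def using finite_qgraph by (auto simp: star_graph_simps)

lemma verts_bound: "i < k + p \<Longrightarrow> finite (verts (expansion r (\<Gamma> i))) \<and> card (verts (expansion r (\<Gamma> i))) \<le> vsum"
  unfolding vsum_def using finite_expansion[OF finite_\<Gamma>]
    member_le_sum[of i "{..<k + p}" "\<lambda>i. card (verts (expansion r (\<Gamma> i)))"] by simp

lemma \<Gamma>_edge: "i < k + p \<Longrightarrow> e \<in> hedges (\<Gamma> i) \<Longrightarrow> e \<subseteq> verts (\<Gamma> i) \<and> card e = 2"
proof (cases "i < k")
  case True
  assume e: "e \<in> hedges (\<Gamma> i)"
  then obtain j where j: "j < l i" "e = qedge (l i) (z i) j" using True unfolding \<Gamma>_def qgraph_def by auto
  then show ?thesis using qedge_card[OF l[OF True] z[OF True] j(1)] qedge_subset[OF l[OF True] z[OF True] j(1)] True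
    unfolding \<Gamma>_def qgraph_def by simp
next
  case False
  assume "e \<in> hedges (\<Gamma> i)"
  then show ?thesis using False unfolding \<Gamma>_def by (auto simp: star_graph_simps)
qed

lemma full_packs:
  "\<exists>N. \<forall>E :: 'a set set. (\<forall>e\<in>E. finite e \<and> card e = r) \<longrightarrow> E \<noteq> {} \<longrightarrow>
     (\<forall>T\<in>shade (r - 1) E. card (nbr E T) \<ge> N) \<longrightarrow> packs E (k + p) (\<lambda>i. expansion r (\<Gamma> i))"
proof -
  define nn where "nn i = (if i < k then l i else u (i - k))" for i
  define N where "N = (\<Sum>i<k + p. (k + p - 1) * vsum + 2 * nn i + 3 + r * card (hedges (\<Gamma> i)) + 1)"
  have Ni: "(k + p - 1) * vsum + 2 * nn i + 3 + r * card (hedges (\<Gamma> i)) < N" if "i < k + p" for i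
    using member_le_sum[of i "{..<k + p}" "\<lambda>i. (k + p - 1) * vsum + 2 * nn i + 3 + r * card (hedges (\<Gamma> i)) + 1"] that
    unfolding N_def by simp
  have vs: "verts (\<Gamma> i) \<subseteq> {..nn i}" if "i < k + p" for i
    using z[of i] unfolding \<Gamma>_def nn_def qgraph_def by (auto simp: star_graph_simps)
  have fan: "\<exists>j. 1 \<le> j \<and> j < nn i \<and> e \<subseteq> {0, j, j + 1}" if i: "i < k + p" and e: "e \<in> hedges (\<Gamma> i)" for i e
  proof (cases "i < k")
    case True
    then obtain j where j: "j < l i" "e = qedge (l i) (z i) j" using e unfolding \<Gamma>_def qgraph_def by auto
    show ?thesis
    proof (cases "j = 0")
      case True
      then show ?thesis using j l[OF \<open>i < k\<close>] \<open>i < k\<close> unfolding qedge_def qnext_def nn_def by (intro exI[of _ 1]) auto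
    next
      case False
      then show ?thesis using j l[OF \<open>i < k\<close>] z[OF \<open>i < k\<close>] \<open>i < k\<close>
        unfolding qedge_def qnext_def nn_def by (intro exI[of _ j]) auto
    qed
  next
    case False
    then obtain v where v: "1 \<le> v" "v \<le> nn i" "e = {0, v}" using e unfolding \<Gamma>_def nn_def by (auto simp: star_graph_simps)
    have "nn i \<ge> 2" unfolding nn_def using False i u[of "i - k"] by auto
    show ?thesis
    proof (cases "v = nn i")
      case True
      then show ?thesis using v \<open>nn i \<ge> 2\<close> by (intro exI[of _ "v - 1"]) auto
    next
      case False
      then show ?thesis using v by (intro exI[of _ v]) auto
    qed
  qed
  have nn1: "nn i \<ge> 1" if "i < k + p" for i using that l[of i] u[of "i - k"] unfolding nn_def by fastforce
  show ?thesis
  proof (rule exI[of _ N], intro allI impI)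
    fix E :: "'a set set"
    assume E: "\<forall>e\<in>E. finite e \<and> card e = r" "E \<noteq> {}" and full: "\<forall>T\<in>shade (r - 1) E. card (nbr E T) \<ge> N"
    have "\<exists>U. \<forall>i<k + p. spans E (expansion r (\<Gamma> i)) (U i) \<and> finite (U i) \<and> U i \<inter> {} = {} \<and> (\<forall>j<k + p. i \<noteq> j \<longrightarrow> U i \<inter> U j = {})"
    proof (rule greedy_pack[where A = "\<lambda>_. {}" and B = "{}" and w = 0 and z = vsum])
      fix i and W :: "'a set" assume i: "i < k + p" and W: "finite W" "card W \<le> 0 + (k + p - 1) * vsum"
      have "card W + 2 * nn i + 3 + r * card (hedges (\<Gamma> i)) < N" using W Ni[OF i] by simp
      then obtain U where U: "spans E (expansion r (\<Gamma> i)) U" "U \<inter> W = {}"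
        using full_component[of E r N W "nn i" "\<Gamma> i"] E full r W(1) nn1[OF i] vs[OF i] finite_\<Gamma> \<Gamma>_edge[OF i] fan[OF i] by blast
      then show "\<exists>U. spans E (expansion r (\<Gamma> i)) U \<and> finite U \<and> card U \<le> vsum \<and> U \<inter> W = {} \<and> U \<inter> {} \<subseteq> {}"
        using spans_card[OF U(1)] verts_bound[OF i] by auto
    qed auto
    then show "packs E (k + p) (\<lambda>i. expansion r (\<Gamma> i))" unfolding packs_def by blast
  qed
qed

text \<open>Here \<open>l i \<ge> 5\<close> enters the arithmetic of constants against
  lists.\<close>

lemma sum_cov: "(\<Sum>i<k. (l i + 1) div 2) \<ge> 3 * k"
proof -
  have "(\<Sum>i<k. 3) \<le> (\<Sum>i<k. (l i + 1) div 2)"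
  proof (rule sum_mono)
    fix i assume "i \<in> {..<k}"
    then show "3 \<le> (l i + 1) div 2" using l[of i] by simp
  qed
  then show ?thesis by simp
qed

text \<open>The length \<open>m\<close> must serve every split of \<open>t + 1\<close> into
  constants and list size, because the split is known only once the block is.\<close>

lemma block_packs:
  "\<exists>m\<ge>1. \<forall>(E :: 'a set set) C q \<phi> L. (\<forall>e\<in>E. finite e \<and> card e = r) \<longrightarrow>
     (\<forall>T\<in>shade (r - 1) E. card (nbr E T) \<ge> t + 1) \<longrightarrow> card C + q = t + 1 \<longrightarrow> block E (r - 1) m C q \<phi> L \<longrightarrow>
     packs E (k + p) (\<lambda>i. expansion r (\<Gamma> i))"
proof -
  define lm where "lm = (\<Sum>i<k. l i)"
  define um where "um = (\<Sum>j<p. u j)"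
  define m' where "m' = (2 * lm + 1) + (2 * um + 4 * um * um)"
  define m where "m = m' * (k * vsum + (k + p - 1) * vsum + 1) + ((8 * k + 1) * k) * (lm * (18 * k + 1) + 1)"
  have lm: "l i \<le> lm" if "i < k" for i unfolding lm_def using that member_le_sum[of i "{..<k}" l] by simp
  have um: "u j \<le> um" if "j < p" for j unfolding um_def using that member_le_sum[of j "{..<p}" u] by simp
  have ml: "2 * l i + 1 \<le> m'" if "i < k" for i using lm[OF that] unfolding m'_def by simp
  have mu: "2 * u j + 4 * u j * u j \<le> m'" "u j + 1 \<le> m'" if "j < p" for j
  proof -
    have "u j * u j \<le> um * um" using um[OF that] by (intro mult_le_mono)
    then show "2 * u j + 4 * u j * u j \<le> m'" "u j + 1 \<le> m'" using um[OF that] unfolding m'_def by auto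
  qed
  have mm: "m' * (0 + (k + p - 1) * vsum + 1) \<le> m" "m' * (k * vsum + (k + p - 1) * vsum + 1) \<le> m"
  proof -
    have 1: "m' * (0 + (k + p - 1) * vsum + 1) \<le> m' * (k * vsum + (k + p - 1) * vsum + 1)" by (intro mult_le_mono) auto
    show 2: "m' * (k * vsum + (k + p - 1) * vsum + 1) \<le> m" unfolding m_def by (rule le_add1)
    show "m' * (0 + (k + p - 1) * vsum + 1) \<le> m" using 1 2 by (rule order_trans)
  qed
  have "m \<ge> 1" unfolding m_def m'_def by simp
  have d: "r - 1 \<ge> 2" and rd: "r - 1 + 1 = r" using r by auto
  show ?thesis
  proof (rule exI[of _ m], intro conjI allI impI)
    show "m \<ge> 1" by fact
    fix E :: "'a set set" and C q \<phi> L
    assume E: "\<forall>e\<in>E. finite e \<and> card e = r" and full: "\<forall>T\<in>shade (r - 1) E. card (nbr E T) \<ge> t + 1"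
      and Cq: "card C + q = t + 1" and "block E (r - 1) m C q \<phi> L"
    then interpret b: block E "r - 1" m C q \<phi> L by simp
    \<comment> \<open>\<open>c i\<close> is the number of constants spent on component
      \<open>i\<close>; only single components in short blocks then remain to be treated.\<close>
    have pack: "packs E (k + p) (\<lambda>i. expansion r (\<Gamma> i))"
      if c: "(\<Sum>i<k + p. c i) \<le> card C"
        and loc: "\<And>i \<psi> C'. i < k + p \<Longrightarrow> block E (r - 1) m' C q \<psi> L \<Longrightarrow> C' \<subseteq> C \<Longrightarrow> card C' = c i \<Longrightarrow>
          \<exists>U. spans E (expansion (r - 1 + 1) (\<Gamma> i)) U \<and> U \<subseteq> C' \<union> reach (r - 1) m' \<psi> L" for c :: "nat \<Rightarrow> nat"
    proof -
      obtain A where A: "\<forall>i<k + p. A i \<subseteq> C \<and> card (A i) = c i \<and> (\<forall>j<k + p. i \<noteq> j \<longrightarrow> A i \<inter> A j = {})"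
        using disjoint_subsets_of_card[OF b.finC c] by blast
      have "\<exists>U. \<forall>i<k + p. spans E (expansion r (\<Gamma> i)) (U i) \<and> finite (U i) \<and> U i \<inter> {} = {} \<and>
          (\<forall>j<k + p. i \<noteq> j \<longrightarrow> U i \<inter> U j = {})"
        by (rule b.pack_from_block[where A = A and m' = m' and w = 0 and z = vsum])
          (use A loc[unfolded rd] verts_bound mm(1) in auto)
      then show ?thesis unfolding packs_def by blast
    qed
    have star: "\<exists>U. spans E (expansion (r - 1 + 1) (\<Gamma> i)) U \<and> U \<subseteq> C' \<union> reach (r - 1) m' \<psi> L"
      if i: "i < k + p" "\<not> i < k" and bl: "block E (r - 1) m' C q \<psi> L" and C': "C' \<subseteq> C" "card C' = 1 \<or> q \<ge> 1" for i \<psi> C'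
    proof -
      have j: "i - k < p" using i by simp
      then have u1: "u (i - k) \<ge> 1" using u[of "i - k"] by simp
      show ?thesis
      proof (cases "q \<ge> 1")
        case True
        then show ?thesis using block.star_from_lists[OF bl True u1 mu(1)[OF j] d] i unfolding \<Gamma>_def by auto
      next
        case False
        then obtain c where "C' = {c}" using C' by (metis card_1_singletonE)
        then show ?thesis using block.star_with_constant[OF bl _ u1 mu(2)[OF j], of c] i C' d unfolding \<Gamma>_def by auto
      qed
    qed
    \<comment> \<open>Stars manage with lists once \<open>q \<ge> 1\<close>, so they receive
      constants only for \<open>q = 0\<close>. For \<open>q = 1\<close> the paths and cycles may be
      one constant short of their covers, and component 0 bears the loss.\<close>
    consider "q = 0" | "q = 1" | "q \<ge> 2" "card C \<ge> k" | "card C < k" by linarith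
    then show "packs E (k + p) (\<lambda>i. expansion r (\<Gamma> i))"
    proof cases
      case 1
      show ?thesis
      proof (rule pack[of "\<lambda>i. if i < k then (l i + 1) div 2 else 1"])
        show "(\<Sum>i<k + p. if i < k then (l i + 1) div 2 else 1) \<le> card C" unfolding sum_if_less using 1 Cq t by simp
        fix i \<psi> C' assume i: "i < k + p" and bl: "block E (r - 1) m' C q \<psi> L" and C': "C' \<subseteq> C" "card C' = (if i < k then (l i + 1) div 2 else 1)"
        show "\<exists>U. spans E (expansion (r - 1 + 1) (\<Gamma> i)) U \<and> U \<subseteq> C' \<union> reach (r - 1) m' \<psi> L"
        proof (cases "i < k")
          case True
          then show ?thesis using block.qgraph_with_cover[OF bl l[OF True] z[OF True] ml[OF True] d C'(1)] C'(2) unfolding \<Gamma>_def by simp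
        qed (use star[OF i _ bl C'(1)] C' in simp)
      qed
    next
      case 2
      define c where "c i = (if i < k then (if i = 0 then (l i + 1) div 2 - 1 else (l i + 1) div 2) else 0)" for i
      show ?thesis
      proof (rule pack[of c])
        have "(\<Sum>i<k. if i = 0 then (l i + 1) div 2 - 1 else (l i + 1) div 2) + 1 = (\<Sum>i<k. (l i + 1) div 2)"
        proof -
          obtain k' where k': "k = Suc k'" using k by (cases k) auto
          have "(l 0 + 1) div 2 \<ge> 1" using l[of 0] k by auto
          then show ?thesis unfolding k' sum.lessThan_Suc_shift by simp
        qed
        then show "(\<Sum>i<k + p. c i) \<le> card C" unfolding c_def sum_if_less using 2 Cq t by simp
        fix i \<psi> C' assume i: "i < k + p" and bl: "block E (r - 1) m' C q \<psi> L" and C': "C' \<subseteq> C" "card C' = c i"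
        show "\<exists>U. spans E (expansion (r - 1 + 1) (\<Gamma> i)) U \<and> U \<subseteq> C' \<union> reach (r - 1) m' \<psi> L"
        proof (cases "i < k")
          case True
          show ?thesis
          proof (cases "i = 0")
            case i0: True
            have "card C' = (l i + 1) div 2 - 1" using C' True i0 unfolding c_def by simp
            then show ?thesis using block.qgraph_with_almost_cover[OF bl l[OF True] z[OF True] ml[OF True] d _ C'(1)] 2 True unfolding \<Gamma>_def by simp
          next
            case False
            then have "card C' = (l i + 1) div 2" using C' True unfolding c_def by simp
            then show ?thesis using block.qgraph_with_cover[OF bl l[OF True] z[OF True] ml[OF True] d C'(1)] True unfolding \<Gamma>_def by simp
          qed
        qed (use star[OF i _ bl C'(1)] 2 in simp)
      qed
    next
      case 3
      show ?thesis
      proof (rule pack[of "\<lambda>i. if i < k then 1 else 0"])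
        show "(\<Sum>i<k + p. if i < k then 1 else 0) \<le> card C" unfolding sum_if_less using 3 by simp
        fix i \<psi> C' assume i: "i < k + p" and bl: "block E (r - 1) m' C q \<psi> L" and C': "C' \<subseteq> C" "card C' = (if i < k then 1 else 0)"
        show "\<exists>U. spans E (expansion (r - 1 + 1) (\<Gamma> i)) U \<and> U \<subseteq> C' \<union> reach (r - 1) m' \<psi> L"
        proof (cases "i < k")
          case True
          then show ?thesis using block.qgraph_with_one_constant[OF bl l[OF True] z[OF True] ml[OF True] d 3(1) C'(1)] C'(2) unfolding \<Gamma>_def by simp
        qed (use star[OF i _ bl C'(1)] 3 in simp)
      qed
    next
      case 4
      have q: "q \<ge> 2 * k + 1" "3 * k \<le> t + 1" using 4 Cq t sum_cov by linarith+
      have lists: "\<exists>U. spans E (expansion (r - 1 + 1) (\<Gamma> i)) U \<and> U \<subseteq> {} \<union> reach (r - 1) m' \<psi> L"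
        if i: "i < k + p" and bl: "block E (r - 1) m' C q \<psi> L" and par: "i < k \<Longrightarrow> z i = 0 \<Longrightarrow> odd (l i) \<Longrightarrow> r - 1 \<ge> 3" for i \<psi>
      proof (cases "i < k")
        case True
        have "q \<ge> 3" using q k by simp
        then show ?thesis using block.qgraph_from_lists[OF bl l[OF True] z[OF True] ml[OF True] d _ par[OF True]] True unfolding \<Gamma>_def by simp
      qed (use star[OF i _ bl, of "{}"] q in simp)
      \<comment> \<open>These cycles are packed first and together, because the vertices that close
        them cannot be moved into a clean window.\<close>
      define O1 where "O1 = {i. i < k \<and> z i = 0 \<and> odd (l i) \<and> r = 3}"
      have fO: "finite O1" "card O1 \<le> k"
        unfolding O1_def using card_mono[of "{..<k}" "{i. i < k \<and> z i = 0 \<and> odd (l i) \<and> r = 3}"] by auto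
      have "\<exists>UO. \<forall>i\<in>O1. spans E (expansion r (\<Gamma> i)) (UO i) \<and> (\<forall>j\<in>O1. i \<noteq> j \<longrightarrow> UO i \<inter> UO j = {})"
      proof (cases "O1 = {}")
        case False
        define k' where "k' = card O1"
        have k': "k' \<ge> 1" "k' \<le> k" unfolding k'_def using fO False by (auto simp: Suc_le_eq card_gt_0_iff)
        have r3: "r = 3" using False unfolding O1_def by auto
        obtain e where e: "bij_betw e {..<k'} O1" using ex_bij_betw_nat_finite[OF fO(1)] unfolding k'_def by (auto simp: atLeast0LessThan)
        have eO: "e i \<in> O1" if "i < k'" for i using bij_betwE[OF e] that by auto
        have "block E 2 m C q \<phi> L" using b.block_axioms r3 by simp
        then interpret b2: block2 E m C q \<phi> L unfolding block2_def .
        have "\<exists>U. \<forall>i<k'. spans E (expansion 3 (cycle_graph (l (e i)))) (U i) \<and> (\<forall>j<k'. i \<noteq> j \<longrightarrow> U i \<inter> U j = {})"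
        proof (rule b2.disjoint_odd_cycles)
          show "card (nbr E T) \<ge> t + 1" if "T \<in> shade 2 E" for T using full r3 that by simp
          show "k' \<ge> 1" "3 * k' \<le> t + 1" "2 * k' + 1 \<le> q" using k' q by auto
          show "l (e i) \<ge> 5 \<and> odd (l (e i)) \<and> l (e i) \<le> lm" if "i < k'" for i
            using eO[OF that] l lm unfolding O1_def by auto
          have "((8 * k' + 1) * k') * (lm * (18 * k' + 1) + 1) \<le> ((8 * k + 1) * k) * (lm * (18 * k + 1) + 1)"
            using k' by (intro mult_le_mono add_le_mono order_refl) auto
          then show "((8 * k' + 1) * k') * (lm * (18 * k' + 1) + 1) \<le> m" unfolding m_def by linarith
        qed
        then obtain U where U: "\<forall>i<k'. spans E (expansion 3 (cycle_graph (l (e i)))) (U i) \<and> (\<forall>j<k'. i \<noteq> j \<longrightarrow> U i \<inter> U j = {})" by blast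
        define f where "f = the_inv_into {..<k'} e"
        have f: "f i < k'" "e (f i) = i" if "i \<in> O1" for i
          using that e f_the_inv_into_f_bij_betw[OF e] the_inv_into_into[OF bij_betw_imp_inj_on[OF e], of i "{..<k'}"]
          unfolding f_def by (auto simp: bij_betw_def)
        show ?thesis
        proof (rule exI[of _ "\<lambda>i. U (f i)"], intro ballI conjI impI)
          fix i assume i: "i \<in> O1"
          have "cycle_graph (l i) = \<Gamma> i" using i cycle_graph_eq[of "l i"] l[of i] unfolding O1_def \<Gamma>_def by auto
          then show "spans E (expansion r (\<Gamma> i)) (U (f i))" using U f[OF i] r3 by auto
          fix j assume j: "j \<in> O1" "i \<noteq> j"
          then have "f i \<noteq> f j" using f[OF i] f[OF j(1)] by metis
          then show "U (f i) \<inter> U (f j) = {}" using U f(1)[OF i] f(1)[OF j(1)] by blast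
        qed
      qed simp
      then obtain UO where UO: "\<And>i. i \<in> O1 \<Longrightarrow> spans E (expansion r (\<Gamma> i)) (UO i)"
        "\<And>i j. i \<in> O1 \<Longrightarrow> j \<in> O1 \<Longrightarrow> i \<noteq> j \<Longrightarrow> UO i \<inter> UO j = {}" by blast
      define W0 where "W0 = (\<Union>i\<in>O1. UO i)"
      have O1k: "i < k + p" if "i \<in> O1" for i using that unfolding O1_def by simp
      have UOc: "finite (UO i)" "card (UO i) \<le> vsum" if "i \<in> O1" for i
        using spans_card[OF UO(1)[OF that]] verts_bound[OF O1k[OF that]] by auto
      have fW0: "finite W0" unfolding W0_def using fO UOc by blast
      have "card W0 \<le> (\<Sum>i\<in>O1. card (UO i))" unfolding W0_def using fO by (intro card_UN_le)
      also have "\<dots> \<le> card O1 * vsum" using sum_bounded_above[of O1 "\<lambda>i. card (UO i)" vsum] UOc by simp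
      also have "\<dots> \<le> k * vsum" using fO by simp
      finally have cW0: "card W0 \<le> k * vsum" .
      \<comment> \<open>Components already placed become empty hypergraphs, so that the packing can
        run over all indices while \<open>W0\<close> protects the cycles.\<close>
      define H where "H i = (if i \<in> O1 then ({}, {}) else expansion r (\<Gamma> i))" for i
      have "\<exists>U. \<forall>i<k + p. spans E (H i) (U i) \<and> finite (U i) \<and> U i \<inter> W0 = {} \<and> (\<forall>j<k + p. i \<noteq> j \<longrightarrow> U i \<inter> U j = {})"
      proof (rule b.pack_from_block[where A = "\<lambda>_. {}" and m' = m' and w = "k * vsum" and z = vsum])
        fix i \<psi> assume i: "i < k + p" and bl: "block E (r - 1) m' C q \<psi> L"
        show "\<exists>U. spans E (H i) U \<and> U \<subseteq> {} \<union> reach (r - 1) m' \<psi> L"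
        proof (cases "i \<in> O1")
          case True
          have "spans E ({}, {}) {}" unfolding spans_def hg_isomorphic_def by (intro exI[of _ "{}"]) (auto simp: bij_betw_def)
          then show ?thesis unfolding H_def using True by (intro exI[of _ "{}"]) auto
        next
          case False
          have "r - 1 \<ge> 3" if "i < k" "z i = 0" "odd (l i)" using False that r unfolding O1_def by auto
          then show ?thesis using lists[OF i bl] False rd unfolding H_def by simp
        qed
      qed (use verts_bound fW0 cW0 mm(2) in \<open>auto simp: H_def\<close>)
      then obtain U where U: "\<And>i. i < k + p \<Longrightarrow> spans E (H i) (U i)" "\<And>i. i < k + p \<Longrightarrow> U i \<inter> W0 = {}"
        "\<And>i j. i < k + p \<Longrightarrow> j < k + p \<Longrightarrow> i \<noteq> j \<Longrightarrow> U i \<inter> U j = {}" by blast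
      define UU where "UU i = (if i \<in> O1 then UO i else U i)" for i
      have UOW: "UO i \<subseteq> W0" if "i \<in> O1" for i unfolding W0_def using that by blast
      have "spans E (expansion r (\<Gamma> i)) (UU i)" if "i < k + p" for i
        using UO(1)[of i] U(1)[OF that] unfolding UU_def H_def by auto
      moreover have "UU i \<inter> UU j = {}" if ij: "i < k + p" "j < k + p" "i \<noteq> j" for i j
        using UO(2)[of i j] U(3)[OF ij] U(2)[OF ij(1)] U(2)[OF ij(2)] UOW[of i] UOW[of j] ij(3) unfolding UU_def by (cases "i \<in> O1"; cases "j \<in> O1") auto
      ultimately show ?thesis unfolding packs_def by blast
    qed
  qed
qed

lemma dense_packs:
  assumes "\<delta> > 0"
  shows "\<exists>n0. \<forall>(V :: 'a set) E. finite V \<longrightarrow> card V \<ge> n0 \<longrightarrow> (\<forall>e\<in>E. e \<subseteq> V \<and> card e = r) \<longrightarrow>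
     (\<forall>T\<in>shade (r - 1) E. card (nbr E T) \<ge> t + 1) \<longrightarrow>
     real (card (shade (r - 1) E)) \<ge> \<delta> * real (card V) ^ (r - 1) \<longrightarrow>
     packs E (k + p) (\<lambda>i. expansion r (\<Gamma> i))"
proof -
  obtain m where m: "m \<ge> 1" and pk: "\<forall>(E :: 'a set set) C q \<phi> L. (\<forall>e\<in>E. finite e \<and> card e = r) \<longrightarrow>
     (\<forall>T\<in>shade (r - 1) E. card (nbr E T) \<ge> t + 1) \<longrightarrow> card C + q = t + 1 \<longrightarrow> block E (r - 1) m C q \<phi> L \<longrightarrow>
     packs E (k + p) (\<lambda>i. expansion r (\<Gamma> i))"
    using block_packs by (elim exE conjE) (rule that)
  have d: "r - 1 \<ge> 1" using r by simp
  obtain n0 where n0: "\<forall>(V :: 'a set) E. finite V \<longrightarrow> card V \<ge> n0 \<longrightarrow> (\<forall>e\<in>E. e \<subseteq> V) \<longrightarrow>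
     (\<forall>T\<in>shade (r - 1) E. card (nbr E T) \<ge> t + 1) \<longrightarrow> real (card (shade (r - 1) E)) \<ge> \<delta> * real (card V) ^ (r - 1) \<longrightarrow>
     (\<exists>C q \<phi> L. card C + q = t + 1 \<and> block E (r - 1) m C q \<phi> L)"
    using block_exists[OF d m assms, of t] by (elim exE) (rule that)
  show ?thesis
  proof (rule exI[of _ n0], intro allI impI)
    fix V :: "'a set" and E
    assume V: "finite V" "card V \<ge> n0" and E: "\<forall>e\<in>E. e \<subseteq> V \<and> card e = r"
      and full: "\<forall>T\<in>shade (r - 1) E. card (nbr E T) \<ge> t + 1"
      and big: "real (card (shade (r - 1) E)) \<ge> \<delta> * real (card V) ^ (r - 1)"
    have "\<exists>C q \<phi> L. card C + q = t + 1 \<and> block E (r - 1) m C q \<phi> L"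
      by (rule n0[rule_format]) (use V E full big in auto)
    then obtain C q \<phi> L where "card C + q = t + 1" "block E (r - 1) m C q \<phi> L" by (elim exE conjE) (rule that)
    moreover have "\<forall>e\<in>E. finite e \<and> card e = r" using E V by (meson finite_subset)
    ultimately show "packs E (k + p) (\<lambda>i. expansion r (\<Gamma> i))" using pk full by blast
  qed
qed

end

section \<open>Counting cliques\<close>

text \<open>Vertex sets stand for copies: the edges of a copy are all \<open>r\<close>-subsets of
  its vertex set.\<close>

definition cliques :: "nat \<Rightarrow> nat \<Rightarrow> 'a hypergraph \<Rightarrow> 'a set set" where
  "cliques r s G = {S. S \<subseteq> verts G \<and> finite S \<and> card S = s \<and> (\<forall>e. e \<subseteq> S \<longrightarrow> card e = r \<longrightarrow> e \<in> hedges G)}"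

lemma bij_image_subsets:
  assumes "bij_betw f A S"
  shows "(\<lambda>e. f ` e) ` {e. e \<subseteq> A \<and> card e = r} = {e. e \<subseteq> S \<and> card e = r}"
proof (intro set_eqI iffI)
  fix e assume "e \<in> (\<lambda>e. f ` e) ` {e. e \<subseteq> A \<and> card e = r}"
  then obtain e' where e': "e' \<subseteq> A" "card e' = r" "e = f ` e'" by blast
  have "card (f ` e') = card e'" using assms e' by (intro card_image) (auto simp: bij_betw_def intro: inj_on_subset)
  then show "e \<in> {e. e \<subseteq> S \<and> card e = r}" using e' assms by (auto simp: bij_betw_def)
next
  fix e assume e: "e \<in> {e. e \<subseteq> S \<and> card e = r}"
  define e' where "e' = {a \<in> A. f a \<in> e}"
  have im: "f ` e' = e" unfolding e'_def using e assms by (auto simp: bij_betw_def)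
  have "card (f ` e') = card e'" unfolding e'_def using assms by (intro card_image) (auto simp: bij_betw_def intro: inj_on_subset)
  then show "e \<in> (\<lambda>e. f ` e) ` {e. e \<subseteq> A \<and> card e = r}" using im e unfolding e'_def by (intro image_eqI[of _ _ e']) (auto simp: e'_def)
qed

lemma num_copies_complete: "num_copies (complete_rgraph r s) G = card (cliques r s G)"
proof -
  let ?h = "\<lambda>S. (S, {e. e \<subseteq> S \<and> card e = r})"
  have "copies (complete_rgraph r s) G = ?h ` cliques r s G"
  proof (intro set_eqI iffI)
    fix G' assume "G' \<in> copies (complete_rgraph r s) G"
    then obtain f where sub: "subhypergraph G' G" and f: "bij_betw f {..<s} (verts G')"
      and he: "hedges G' = (\<lambda>e. f ` e) ` {e. e \<subseteq> {..<s} \<and> card e = r}"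
      unfolding copies_def hg_isomorphic_def complete_rgraph_def by auto
    have "hedges G' = {e. e \<subseteq> verts G' \<and> card e = r}" using bij_image_subsets[OF f] he by simp
    moreover have "finite (verts G')" "card (verts G') = s"
      using f bij_betw_finite[OF f] bij_betw_same_card[OF f] by auto
    ultimately have "verts G' \<in> cliques r s G" "G' = ?h (verts G')"
      using sub unfolding cliques_def subhypergraph_def by (auto simp: prod_eq_iff)
    then show "G' \<in> ?h ` cliques r s G" by blast
  next
    fix G' assume "G' \<in> ?h ` cliques r s G"
    then obtain S where S: "S \<in> cliques r s G" "G' = ?h S" by blast
    then have "finite S" "card S = s" unfolding cliques_def by auto
    then obtain f where f: "bij_betw f {..<s} S" using ex_bij_betw_nat_finite[of S] by (auto simp: atLeast0LessThan)
    have "hg_isomorphic (complete_rgraph r s) G'"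
      unfolding hg_isomorphic_def complete_rgraph_def S(2)
      by (intro exI[of _ f]) (simp add: f bij_image_subsets[OF f])
    moreover have "subhypergraph G' G" using S unfolding cliques_def subhypergraph_def by auto
    ultimately show "G' \<in> copies (complete_rgraph r s) G" unfolding copies_def by simp
  qed
  moreover have "inj_on ?h (cliques r s G)" by (auto simp: inj_on_def)
  ultimately show ?thesis unfolding num_copies_def by (simp add: card_image)
qed

section \<open>Cleaning a family of cliques\<close>

lemma finite_shade:
  assumes "finite K" "\<And>S. S \<in> K \<Longrightarrow> finite S" shows "finite (shade d K)"
proof (rule finite_subset)
  show "shade d K \<subseteq> Pow (\<Union>K)" unfolding shade_def by auto
qed (use assms in auto)

text \<open>A \<open>d\<close>-set in at most \<open>c\<close> members is removed together with
  these members and leaves the shadow for good. So each \<open>d\<close>-set of the original shadow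
  is charged at most \<open>c\<close>.\<close>

lemma full_subfamily:
  assumes "finite K" "\<And>S. S \<in> K \<Longrightarrow> finite S"
  shows "\<exists>K'\<subseteq>K. card K \<le> card K' + c * card (shade d K) \<and> (\<forall>T\<in>shade d K'. c < card {S \<in> K'. T \<subseteq> S})"
  using assms
proof (induction "card (shade d K)" arbitrary: K rule: less_induct)
  case less
  show ?case
  proof (cases "\<forall>T\<in>shade d K. c < card {S \<in> K. T \<subseteq> S}")
    case False
    then obtain T where T: "T \<in> shade d K" "card {S \<in> K. T \<subseteq> S} \<le> c" by (auto simp: not_less)
    define K1 where "K1 = K - {S \<in> K. T \<subseteq> S}"
    have sub: "shade d K1 \<subseteq> shade d K - {T}" unfolding shade_def K1_def by auto
    have fs: "finite (shade d K)" using finite_shade less.prems by blast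
    have "card (shade d K1) \<le> card (shade d K - {T})" using sub fs by (intro card_mono) auto
    also have "\<dots> = card (shade d K) - 1" using T fs by simp
    finally have c1: "card (shade d K1) \<le> card (shade d K) - 1" .
    have pos: "card (shade d K) > 0" using T fs by (auto simp: card_gt_0_iff)
    then have "card (shade d K1) < card (shade d K)" using c1 by linarith
    moreover have "finite K1" "\<And>S. S \<in> K1 \<Longrightarrow> finite S" using less.prems unfolding K1_def by auto
    ultimately obtain K' where K': "K' \<subseteq> K1" "card K1 \<le> card K' + c * card (shade d K1)"
      "\<forall>T\<in>shade d K'. c < card {S \<in> K'. T \<subseteq> S}" using less.hyps[of K1] by blast
    have "card K = card K1 + card {S \<in> K. T \<subseteq> S}" unfolding K1_def using less.prems(1)
      by (subst card_Diff_subset) (auto intro!: le_add_diff_inverse2[symmetric] card_mono)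
    also have "\<dots> \<le> card K' + (c * card (shade d K1) + c)" using K'(2) T(2) by linarith
    also have "c * card (shade d K1) + c = c * (card (shade d K1) + 1)" by simp
    also have "\<dots> \<le> c * card (shade d K)" using c1 pos by (intro mult_le_mono2) linarith
    finally have "card K \<le> card K' + c * card (shade d K)" by simp
    then show ?thesis using K' unfolding K1_def by (intro exI[of _ K']) auto
  qed (intro exI[of _ K], auto)
qed

lemma extend_to_card:
  assumes "finite S" "T \<subseteq> S" "card T \<le> n" "n \<le> card S"
  shows "\<exists>e. T \<subseteq> e \<and> e \<subseteq> S \<and> card e = n"
proof -
  have fT: "finite T" using assms finite_subset by blast
  have "n - card T \<le> card (S - T)" using assms fT by (simp add: card_Diff_subset)
  then obtain X where X: "X \<subseteq> S - T" "card X = n - card T" "finite X"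
    using obtain_subset_with_card_n[of "n - card T" "S - T"] assms(1) by (metis finite_Diff finite_subset)
  have "card (T \<union> X) = n" using X fT assms by (subst card_Un_disjoint) auto
  then show ?thesis using X assms by (intro exI[of _ "T \<union> X"]) auto
qed

text \<open>Lets a degree condition on sets below cliques be read in the \<open>r\<close>-graph
  formed by the edges of the cliques.\<close>

lemma shade_shade:
  assumes K: "\<And>S. S \<in> K \<Longrightarrow> finite S \<and> card S = s" and rs: "1 \<le> r" "r \<le> s"
  shows "shade (r - 1) (shade r K) = shade (r - 1) K"
proof
  show "shade (r - 1) (shade r K) \<subseteq> shade (r - 1) K" unfolding shade_def by blast
  show "shade (r - 1) K \<subseteq> shade (r - 1) (shade r K)"
  proof
    fix T assume "T \<in> shade (r - 1) K"
    then obtain S where S: "S \<in> K" "T \<subseteq> S" "card T = r - 1" "finite T" unfolding shade_def by auto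
    then obtain e where e: "T \<subseteq> e" "e \<subseteq> S" "card e = r" using extend_to_card[of S T r] K[OF S(1)] rs by auto
    have "finite e" using e K[OF S(1)] finite_subset by blast
    then have "e \<in> shade r K" unfolding shade_def using e S by auto
    then show "T \<in> shade (r - 1) (shade r K)" unfolding shade_def using S e by auto
  qed
qed

text \<open>A clique \<open>S\<close> over \<open>T\<close> is determined by \<open>S - T\<close>,
  an \<open>(s - r + 1)\<close>-set of extensions; with at most \<open>x\<close> extensions there
  would be too few such sets.\<close>

lemma degree_of_shade:
  assumes fK: "finite K" and K: "\<And>S. S \<in> K \<Longrightarrow> finite S \<and> card S = s" and rs: "1 \<le> r" "r \<le> s"
    and T: "T \<in> shade (r - 1) K" "(x choose (s - r + 1)) < card {S \<in> K. T \<subseteq> S}"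
  shows "x + 1 \<le> card (nbr (shade r K) T)"
proof (rule ccontr)
  assume "\<not> ?thesis"
  then have le: "card (nbr (shade r K) T) \<le> x" by simp
  have T': "card T = r - 1" "finite T" using T unfolding shade_def by auto
  have fE: "finite (shade r K)" using finite_shade[OF fK] K by blast
  have fN: "finite (nbr (shade r K) T)"
  proof (rule finite_subset)
    show "nbr (shade r K) T \<subseteq> \<Union>(shade r K)" unfolding nbr_def by blast
    show "finite (\<Union>(shade r K))" using fE by (auto simp: shade_def)
  qed
  have "card {S \<in> K. T \<subseteq> S} \<le> card {X. X \<subseteq> nbr (shade r K) T \<and> card X = s - r + 1}"
  proof (rule card_inj_on_le[of "\<lambda>S. S - T"])
    show "inj_on (\<lambda>S. S - T) {S \<in> K. T \<subseteq> S}" by (auto simp: inj_on_def)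
    show "finite {X. X \<subseteq> nbr (shade r K) T \<and> card X = s - r + 1}" using fN by simp
    show "(\<lambda>S. S - T) ` {S \<in> K. T \<subseteq> S} \<subseteq> {X. X \<subseteq> nbr (shade r K) T \<and> card X = s - r + 1}"
    proof (rule image_subsetI)
      fix S assume "S \<in> {S \<in> K. T \<subseteq> S}"
      then have S: "S \<in> K" "T \<subseteq> S" by auto
      have "card (S - T) = s - r + 1" using S K[OF S(1)] T' rs by (simp add: card_Diff_subset)
      moreover have "y \<in> nbr (shade r K) T" if "y \<in> S - T" for y
        using that S T' rs unfolding nbr_def shade_def by auto
      ultimately show "S - T \<in> {X. X \<subseteq> nbr (shade r K) T \<and> card X = s - r + 1}" by auto
    qed
  qed
  also have "\<dots> = card (nbr (shade r K) T) choose (s - r + 1)" using fN by (rule n_subsets)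
  also have "\<dots> \<le> x choose (s - r + 1)" using le by (rule binomial_right_mono)
  finally show False using T(2) by simp
qed

lemma card_shade_le:
  assumes "finite V" "\<And>S. S \<in> K \<Longrightarrow> S \<subseteq> V"
  shows "real (card (shade d K)) \<le> real (card V) ^ d / fact d"
proof -
  have "card (shade d K) \<le> card {T. T \<subseteq> V \<and> card T = d}"
    using assms by (intro card_mono) (auto simp: shade_def)
  also have "\<dots> = card V choose d" using assms(1) by (rule n_subsets)
  finally have "real (card (shade d K)) * fact d \<le> real ((card V choose d) * fact d)" by (simp add: mult_right_mono)
  also have "\<dots> \<le> real (card V ^ d)" using binomial_fact_pow[of "card V" d] by (simp only: of_nat_le_iff)
  finally show ?thesis by (simp add: field_simps)
qed

lemma packs_mono: "packs E n H \<Longrightarrow> E \<subseteq> E' \<Longrightarrow> packs E' n H"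
  unfolding packs_def spans_def by (meson order_trans)

context components
begin

lemma clique_bound:
  assumes s: "s \<ge> r" and \<epsilon>: "\<epsilon> > 0"
  shows "\<exists>n0. \<forall>G :: 'a hypergraph. is_rgraph r G \<longrightarrow> card (verts G) \<ge> n0 \<longrightarrow>
     \<not> packs (hedges G) (k + p) (\<lambda>i. expansion r (\<Gamma> i)) \<longrightarrow>
     real (card (cliques r s G)) \<le> (real (t choose (s - r + 1)) / fact (r - 1) + \<epsilon>) * real (card (verts G)) ^ (r - 1)"
proof -
  define j where "j = s - r + 1"
  obtain N where N: "\<forall>E :: 'a set set. (\<forall>e\<in>E. finite e \<and> card e = r) \<longrightarrow> E \<noteq> {} \<longrightarrow>
     (\<forall>T\<in>shade (r - 1) E. card (nbr E T) \<ge> N) \<longrightarrow> packs E (k + p) (\<lambda>i. expansion r (\<Gamma> i))"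
    using full_packs by (elim exE) (rule that)
  \<comment> \<open>Exceeding this threshold forces more than \<open>N + j\<close> extensions. The
    summand \<open>j\<close> keeps the coefficient positive for the division in
    \<open>\<delta>\<close>.\<close>
  define c2 where "c2 = (N + j) choose j"
  have c2: "c2 > 0" unfolding c2_def by simp
  define \<delta> where "\<delta> = \<epsilon> / real c2"
  have "\<delta> > 0" unfolding \<delta>_def using \<epsilon> c2 by simp
  obtain n0 where n0: "\<forall>(V :: 'a set) E. finite V \<longrightarrow> card V \<ge> n0 \<longrightarrow> (\<forall>e\<in>E. e \<subseteq> V \<and> card e = r) \<longrightarrow>
     (\<forall>T\<in>shade (r - 1) E. card (nbr E T) \<ge> t + 1) \<longrightarrow>
     real (card (shade (r - 1) E)) \<ge> \<delta> * real (card V) ^ (r - 1) \<longrightarrow>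
     packs E (k + p) (\<lambda>i. expansion r (\<Gamma> i))"
    using dense_packs[OF \<open>\<delta> > 0\<close>] by (elim exE) (rule that)
  have r1: "1 \<le> r" using r by simp
  show ?thesis
  proof (rule exI[of _ n0], intro allI impI)
    fix G :: "'a hypergraph"
    assume G: "is_rgraph r G" and n: "card (verts G) \<ge> n0" and np: "\<not> packs (hedges G) (k + p) (\<lambda>i. expansion r (\<Gamma> i))"
    define V where "V = verts G"
    have fV: "finite V" using G unfolding is_rgraph_def V_def by blast
    define K where "K = cliques r s G"
    have KV: "S \<subseteq> V" "finite S \<and> card S = s" "\<And>e. e \<subseteq> S \<Longrightarrow> card e = r \<Longrightarrow> e \<in> hedges G" if "S \<in> K" for S
      using that unfolding K_def cliques_def V_def by auto
    have "K \<subseteq> Pow V" using KV(1) by blast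
    then have fK: "finite K" using fV finite_subset by blast
    have shE: "shade r K1 \<subseteq> hedges G" if "K1 \<subseteq> K" for K1
      using KV(3) that unfolding shade_def by blast
    obtain K' where K': "K' \<subseteq> K" "card K \<le> card K' + (t choose j) * card (shade (r - 1) K)"
      "\<forall>T\<in>shade (r - 1) K'. (t choose j) < card {S \<in> K'. T \<subseteq> S}"
      using full_subfamily[OF fK, of "t choose j" "r - 1"] KV(2) by blast
    have fK': "finite K'" using K' fK finite_subset by blast
    have K's: "\<And>S. S \<in> K' \<Longrightarrow> finite S \<and> card S = s" using K' KV(2) by blast
    obtain K2 where K2: "K2 \<subseteq> K'" "card K' \<le> card K2 + c2 * card (shade (r - 1) K')"
      "\<forall>T\<in>shade (r - 1) K2. c2 < card {S \<in> K2. T \<subseteq> S}"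
      using full_subfamily[OF fK', of c2 "r - 1"] K's by blast
    have fK2: "finite K2" using K2 fK' finite_subset by blast
    have K2s: "\<And>S. S \<in> K2 \<Longrightarrow> finite S \<and> card S = s" using K2 K's by blast
    \<comment> \<open>A surviving clique would give degrees of at least \<open>N\<close> everywhere
      and hence an embedding. So the second round discards all of \<open>K'\<close>, which bounds
      \<open>card K'\<close> by its shadow.\<close>
    have "K2 = {}"
    proof (rule ccontr)
      assume "K2 \<noteq> {}"
      then obtain S where S: "S \<in> K2" by blast
      have "shade r K2 \<noteq> {}"
      proof -
        obtain e where e: "e \<subseteq> S" "card e = r" using obtain_subset_with_card_n[of r S] K2s[OF S] s by auto
        then have "finite e" using K2s[OF S] finite_subset by blast
        then have "e \<in> shade r K2" unfolding shade_def using e S by auto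
        then show ?thesis by blast
      qed
      moreover have "\<forall>e\<in>shade r K2. finite e \<and> card e = r" unfolding shade_def by auto
      moreover have "card (nbr (shade r K2) T) \<ge> N" if "T \<in> shade (r - 1) (shade r K2)" for T
      proof -
        have T: "T \<in> shade (r - 1) K2" using that shade_shade[OF K2s r1 s] by simp
        have "N + j + 1 \<le> card (nbr (shade r K2) T)"
          using degree_of_shade[OF fK2 K2s r1 s T, of "N + j"] K2(3) T unfolding c2_def j_def by blast
        then show ?thesis by simp
      qed
      ultimately have "packs (shade r K2) (k + p) (\<lambda>i. expansion r (\<Gamma> i))" using N by blast
      then show False using np packs_mono shE K2(1) K'(1) by (meson order_trans)
    qed
    then have cK': "card K' \<le> c2 * card (shade (r - 1) K')" using K2(2) by simp
    \<comment> \<open>Otherwise the shadow of \<open>K'\<close> has density at least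
      \<open>\<delta>\<close>, and the degrees \<open>t + 1\<close> from the first round suffice for
      an embedding.\<close>
    have K'small: "real (card K') \<le> \<epsilon> * real (card V) ^ (r - 1)"
    proof (rule ccontr)
      assume "\<not> ?thesis"
      then have "\<epsilon> * real (card V) ^ (r - 1) \<le> real (card K')" by simp
      also have "\<dots> \<le> real c2 * real (card (shade (r - 1) K'))" using cK' by (metis of_nat_le_iff of_nat_mult)
      finally have "\<delta> * real (card V) ^ (r - 1) \<le> real (card (shade (r - 1) K'))"
        unfolding \<delta>_def using c2 by (simp add: field_simps)
      then have big: "\<delta> * real (card V) ^ (r - 1) \<le> real (card (shade (r - 1) (shade r K')))"
        using shade_shade[OF K's r1 s] by simp
      have "packs (shade r K') (k + p) (\<lambda>i. expansion r (\<Gamma> i))"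
      proof (rule n0[rule_format, OF fV _ _ _ big])
        show "n0 \<le> card V" using n unfolding V_def .
        show "e \<subseteq> V \<and> card e = r" if "e \<in> shade r K'" for e using that KV(1) K'(1) unfolding shade_def by blast
        show "t + 1 \<le> card (nbr (shade r K') T)" if "T \<in> shade (r - 1) (shade r K')" for T
        proof -
          have T: "T \<in> shade (r - 1) K'" using that shade_shade[OF K's r1 s] by simp
          show ?thesis using degree_of_shade[OF fK' K's r1 s T, of t] K'(3) T unfolding j_def by blast
        qed
      qed
      then show False using np packs_mono shE[OF K'(1)] by blast
    qed
    have "real (card (shade (r - 1) K)) \<le> real (card V) ^ (r - 1) / fact (r - 1)"
      using card_shade_le[OF fV] KV(1) by blast
    then have "real (t choose j) * real (card (shade (r - 1) K)) \<le> real (t choose j) * (real (card V) ^ (r - 1) / fact (r - 1))"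
      by (intro mult_left_mono) auto
    moreover have "real (card K) \<le> real (card K') + real (t choose j) * real (card (shade (r - 1) K))"
      using K'(2) by (metis of_nat_add of_nat_le_iff of_nat_mult)
    ultimately have "real (card K) \<le> \<epsilon> * real (card V) ^ (r - 1) + real (t choose j) * (real (card V) ^ (r - 1) / fact (r - 1))"
      using K'small by linarith
    then show "real (card (cliques r s G)) \<le> (real (t choose (s - r + 1)) / fact (r - 1) + \<epsilon>) * real (card (verts G)) ^ (r - 1)"
      unfolding K_def V_def j_def by (simp add: algebra_simps)
  qed
qed

end

section \<open>The extremal construction\<close>

lemma expansion_covered:
  assumes "verts \<Gamma> \<subseteq> \<Union>(hedges \<Gamma>)"
  shows "verts (expansion r \<Gamma>) \<subseteq> \<Union>(hedges (expansion r \<Gamma>))"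
proof
  let ?X = "\<lambda>e. Inl ` e \<union> Inr ` ({e} \<times> {..<r - 2})"
  fix x assume "x \<in> verts (expansion r \<Gamma>)"
  then consider v where "x = Inl v" "v \<in> verts \<Gamma>" | e j where "x = Inr (e, j)" "e \<in> hedges \<Gamma>" "j < r - 2"
    unfolding expansion_def by auto
  then obtain e where "e \<in> hedges \<Gamma>" "x \<in> ?X e"
  proof cases
    case 1
    then obtain e where "e \<in> hedges \<Gamma>" "v \<in> e" using assms by blast
    then show ?thesis using 1 that[of e] by simp
  next
    case 2
    then show ?thesis using that[of e] by simp
  qed
  then show "x \<in> \<Union>(hedges (expansion r \<Gamma>))" unfolding expansion_def by auto
qed

lemma expansion_edge:
  assumes "\<And>e. e \<in> hedges \<Gamma> \<Longrightarrow> e \<subseteq> verts \<Gamma>" "e \<in> hedges (expansion r \<Gamma>)"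
  shows "e \<subseteq> verts (expansion r \<Gamma>)"
proof -
  obtain e' where e': "e' \<in> hedges \<Gamma>" "e = Inl ` e' \<union> Inr ` ({e'} \<times> {..<r - 2})"
    using assms(2) unfolding expansion_def by auto
  then show ?thesis using assms(1)[OF e'(1)] unfolding expansion_def by auto
qed

lemma disjoint_union_covered:
  assumes "\<And>i. i < length Hs \<Longrightarrow> verts (Hs ! i) \<subseteq> \<Union>(hedges (Hs ! i))"
  shows "verts (disjoint_union Hs) \<subseteq> \<Union>(hedges (disjoint_union Hs))"
proof
  fix a assume "a \<in> verts (disjoint_union Hs)"
  then obtain i x where i: "i < length Hs" "x \<in> verts (Hs ! i)" "a = (i, x)" unfolding disjoint_union_def by auto
  then obtain e where e: "e \<in> hedges (Hs ! i)" "x \<in> e" using assms[OF i(1)] by blast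
  have "Pair i ` e \<in> hedges (disjoint_union Hs)" unfolding disjoint_union_def using i e by auto
  moreover have "a \<in> Pair i ` e" using i e by blast
  ultimately show "a \<in> \<Union>(hedges (disjoint_union Hs))" by blast
qed

text \<open>\<open>spans\<close> constrains only edges. Without isolated vertices the whole copy
  lies inside edges and thus inside the vertex set of \<open>G\<close>.\<close>

lemma spans_not_free:
  assumes "spans (hedges G) F U" "verts F \<subseteq> \<Union>(hedges F)" "is_rgraph r G"
  shows "\<not> hg_free F G"
proof -
  obtain f E' where f: "E' \<subseteq> hedges G" "bij_betw f (verts F) U" "E' = (\<lambda>e. f ` e) ` hedges F"
    using assms(1) unfolding spans_def hg_isomorphic_def by auto
  have "U = f ` verts F" using f by (simp add: bij_betw_def)
  also have "\<dots> \<subseteq> \<Union>E'" using assms(2) unfolding f(3) by blast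
  also have "\<dots> \<subseteq> verts G" using f(1) assms(3) unfolding is_rgraph_def by blast
  finally have "(U, E') \<in> copies F G"
    using f unfolding copies_def subhypergraph_def hg_isomorphic_def by auto
  then show ?thesis unfolding hg_free_def by blast
qed

section \<open>Cover numbers and freeness of the construction\<close>

context components
begin

abbreviation forbidden :: "(nat \<times> (nat + nat set \<times> nat)) hypergraph" where
  "forbidden \<equiv> disjoint_union (map (\<lambda>i. expansion r (\<Gamma> i)) [0..<k + p])"

lemma \<Gamma>_covered: "i < k + p \<Longrightarrow> verts (\<Gamma> i) \<subseteq> \<Union>(hedges (\<Gamma> i))"
proof (cases "i < k")
  case True
  have "v \<in> \<Union>(hedges (qgraph (l i) (z i)))" if v: "v \<in> verts (qgraph (l i) (z i))" for v
  proof (cases "v < l i")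
    case True
    then show ?thesis unfolding qgraph_def qedge_def by auto
  next
    case False
    then have "v = z i" "z i = l i" using v z[OF True] l[OF True] unfolding qgraph_def by auto
    then have "v \<in> qedge (l i) (z i) (l i - 1)" using l[OF True] unfolding qedge_def qnext_def by auto
    moreover have "qedge (l i) (z i) (l i - 1) \<in> hedges (qgraph (l i) (z i))" using l[OF True] unfolding qgraph_def by auto
    ultimately show ?thesis by blast
  qed
  then show ?thesis using True unfolding \<Gamma>_def by auto
next
  case False
  assume "i < k + p"
  then have "u (i - k) \<ge> 2" using False u by simp
  then show ?thesis using False unfolding \<Gamma>_def by (force simp: star_graph_simps)
qed

lemma packs_not_free:
  assumes "packs (hedges G) (k + p) (\<lambda>i. expansion r (\<Gamma> i))" "is_rgraph r G"
  shows "\<not> hg_free forbidden G"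
proof -
  obtain U where U: "\<forall>i<k + p. spans (hedges G) (expansion r (\<Gamma> i)) (U i) \<and> (\<forall>j<k + p. i \<noteq> j \<longrightarrow> U i \<inter> U j = {})"
    using assms unfolding packs_def by (elim exE) (rule that)
  have ev: "e \<subseteq> verts (expansion r (\<Gamma> i))" if "i < k + p" "e \<in> hedges (expansion r (\<Gamma> i))" for i e
    using that \<Gamma>_edge[OF that(1)] expansion_edge by blast
  have "spans (hedges G) forbidden (\<Union>i<length (map (\<lambda>i. expansion r (\<Gamma> i)) [0..<k + p]). U i)"
    using U ev by (intro spans_disjoint_union) auto
  moreover have "verts forbidden \<subseteq> \<Union>(hedges forbidden)"
    using \<Gamma>_covered by (intro disjoint_union_covered) (auto intro!: expansion_covered)
  ultimately show ?thesis using spans_not_free assms(2) by blast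
qed

text \<open>A vertex of an expanded path or cycle lies in at most two edges, so a cover needs half
  the number of edges, rounded up; for a star it has to be nonempty.\<close>

lemma cover_component:
  assumes i: "i < k + p" and X: "finite X" "\<And>e. e \<in> hedges (expansion r (\<Gamma> i)) \<Longrightarrow> e \<inter> X \<noteq> {}"
  shows "card X \<ge> (if i < k then (l i + 1) div 2 else 1)"
proof (cases "i < k")
  case True
  note li = l[OF True] and zi = z[OF True]
  define EE where "EE j = Inl ` qedge (l i) (z i) j \<union> Inr ` ({qedge (l i) (z i) j} \<times> {..<r - 2})" for j
  have EEh: "EE j \<in> hedges (expansion r (\<Gamma> i))" if "j < l i" for j
    using that True unfolding EE_def expansion_def \<Gamma>_def qgraph_def by auto
  have two: "card {j. j < l i \<and> x \<in> EE j} \<le> 2" for x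
  proof (cases x)
    case (Inl v)
    \<comment> \<open>A graph vertex starts the edge with its own number and ends the previous one,
      except that \<open>z i\<close> ends the last edge.\<close>
    have "{j. j < l i \<and> x \<in> EE j} \<subseteq> {v, if v = z i then l i - 1 else v - 1}"
      unfolding Inl EE_def qedge_def qnext_def using zi by (auto split: if_splits)
    then have "card {j. j < l i \<and> x \<in> EE j} \<le> card {v, if v = z i then l i - 1 else v - 1}" by (intro card_mono) auto
    also have "\<dots> \<le> 2" by (simp add: card_insert_if)
    finally show ?thesis .
  next
    case (Inr y)
    have "{j. j < l i \<and> x \<in> EE j} \<subseteq> {the_inv_into {..<l i} (qedge (l i) (z i)) (fst y)}"
    proof
      fix j assume "j \<in> {j. j < l i \<and> x \<in> EE j}"
      then have "j < l i" "fst y = qedge (l i) (z i) j" unfolding Inr EE_def by auto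
      then show "j \<in> {the_inv_into {..<l i} (qedge (l i) (z i)) (fst y)}"
        using the_inv_into_f_f[OF qedge_inj[OF li zi], of j] by simp
    qed
    then have "card {j. j < l i \<and> x \<in> EE j} \<le> card {the_inv_into {..<l i} (qedge (l i) (z i)) (fst y)}" by (intro card_mono) auto
    then show ?thesis by simp
  qed
  have "{..<l i} \<subseteq> (\<Union>x\<in>X. {j. j < l i \<and> x \<in> EE j})" using X(2)[OF EEh] by fastforce
  then have "card {..<l i} \<le> card (\<Union>x\<in>X. {j. j < l i \<and> x \<in> EE j})" using X(1) by (intro card_mono) auto
  also have "\<dots> \<le> (\<Sum>x\<in>X. card {j. j < l i \<and> x \<in> EE j})" using X(1) by (rule card_UN_le)
  also have "\<dots> \<le> card X * 2" using sum_bounded_above[of X "\<lambda>x. card {j. j < l i \<and> x \<in> EE j}" 2] two by simp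
  finally show ?thesis using True by simp
next
  case False
  then have "i - k < p" using i by simp
  then have "u (i - k) \<ge> 1" using u[of "i - k"] by simp
  then have "hedges (expansion r (\<Gamma> i)) \<noteq> {}" using False unfolding \<Gamma>_def expansion_def by (auto simp: star_graph_simps)
  then have "X \<noteq> {}" using X(2) by blast
  then show ?thesis using X(1) False by (simp add: Suc_le_eq card_gt_0_iff)
qed

text \<open>In a copy the vertices sent below \<open>t\<close> would cover every edge. Split over
  the disjoint components they number at least \<open>t + 1\<close>.\<close>

lemma S_graph_free: "hg_free forbidden (S_graph r n t)"
  unfolding hg_free_def
proof (rule equals0I)
  fix G assume "G \<in> copies forbidden (S_graph r n t)"
  then obtain f where f: "bij_betw f (verts forbidden) (verts G)" "hedges G = (\<lambda>e. f ` e) ` hedges forbidden"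
    and sub: "hedges G \<subseteq> hedges (S_graph r n t)"
    unfolding copies_def subhypergraph_def hg_isomorphic_def by auto
  define X where "X i = {x \<in> verts (expansion r (\<Gamma> i)). f (i, x) < t}" for i
  have fX: "finite (X i)" for i unfolding X_def using finite_expansion[OF finite_\<Gamma>] by simp
  have inV: "(i, x) \<in> verts forbidden" if "i < k + p" "x \<in> verts (expansion r (\<Gamma> i))" for i x
    using that unfolding disjoint_union_def by auto
  have "card (X i) \<ge> (if i < k then (l i + 1) div 2 else 1)" if i: "i < k + p" for i
  proof (rule cover_component[OF i fX])
    fix e assume e: "e \<in> hedges (expansion r (\<Gamma> i))"
    have "Pair i ` e \<in> hedges forbidden" unfolding disjoint_union_def using i e by auto
    then have "f ` Pair i ` e \<in> hedges (S_graph r n t)" using f(2) sub by blast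
    then obtain x where "x \<in> e" "f (i, x) < t" unfolding S_graph_def by auto
    moreover have "e \<subseteq> verts (expansion r (\<Gamma> i))" using e \<Gamma>_edge[OF i] expansion_edge by blast
    ultimately show "e \<inter> X i \<noteq> {}" unfolding X_def by blast
  qed
  then have "(\<Sum>i<k + p. if i < k then (l i + 1) div 2 else 1) \<le> (\<Sum>i<k + p. card (X i))" by (intro sum_mono) auto
  also have "\<dots> = card (SIGMA i:{..<k + p}. X i)" using fX by simp
  also have "\<dots> \<le> card {..<t}"
  proof (rule card_inj_on_le[of f])
    have "(SIGMA i:{..<k + p}. X i) \<subseteq> verts forbidden" using inV unfolding X_def by auto
    then show "inj_on f (SIGMA i:{..<k + p}. X i)" using f(1) by (auto simp: bij_betw_def intro: inj_on_subset)
    show "f ` (SIGMA i:{..<k + p}. X i) \<subseteq> {..<t}" unfolding X_def by auto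
  qed simp
  finally show False unfolding sum_if_less using t by simp
qed

end

text \<open>A set with \<open>s - r + 1\<close> vertices below \<open>t\<close> and
  \<open>r - 1\<close> others is a clique, as no \<open>r\<close>-subset fits into the latter.
  Cliques with more vertices below \<open>t\<close> are ignored, since the matching upper bound
  comes from \<open>clique_bound\<close>.\<close>

lemma S_graph_cliques:
  assumes rs: "1 \<le> r" "r \<le> s" and n: "t \<le> n"
  shows "(t choose (s - r + 1)) * ((n - t) choose (r - 1)) \<le> card (cliques r s (S_graph r n t))"
proof -
  define \<A> where "\<A> = {A. A \<subseteq> {..<t} \<and> card A = s - r + 1}"
  define \<B> where "\<B> = {B. B \<subseteq> {t..<n} \<and> card B = r - 1}"
  have c: "card \<A> = t choose (s - r + 1)" "card \<B> = (n - t) choose (r - 1)"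
    unfolding \<A>_def \<B>_def by (simp_all add: n_subsets)
  have "card (\<A> \<times> \<B>) \<le> card (cliques r s (S_graph r n t))"
  proof (rule card_inj_on_le[of "\<lambda>(A, B). A \<union> B"])
    show "inj_on (\<lambda>(A, B). A \<union> B) (\<A> \<times> \<B>)"
    proof (rule inj_onI, clarify)
      fix A B A' B' assume AB: "A \<in> \<A>" "B \<in> \<B>" "A' \<in> \<A>" "B' \<in> \<B>" "A \<union> B = A' \<union> B'"
      have "A = (A \<union> B) \<inter> {..<t}" "A' = (A' \<union> B') \<inter> {..<t}" "B = (A \<union> B) - {..<t}" "B' = (A' \<union> B') - {..<t}"
        using AB(1-4) unfolding \<A>_def \<B>_def by force+
      then show "A = A' \<and> B = B'" using AB(5) by metis
    qed
    have "cliques r s (S_graph r n t) \<subseteq> Pow {..<n}" unfolding cliques_def S_graph_def by auto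
    then show "finite (cliques r s (S_graph r n t))" using finite_subset by blast
    show "(\<lambda>(A, B). A \<union> B) ` (\<A> \<times> \<B>) \<subseteq> cliques r s (S_graph r n t)"
    proof (rule image_subsetI, clarify)
      fix A B assume "A \<in> \<A>" "B \<in> \<B>"
      then have A: "A \<subseteq> {..<t}" "card A = s - r + 1" and B: "B \<subseteq> {t..<n}" "card B = r - 1" unfolding \<A>_def \<B>_def by auto
      have fin: "finite A" "finite B" using A B finite_subset by blast+
      have "A \<inter> B = {}" using A B by fastforce
      then have "card (A \<union> B) = s" using fin A B rs by (simp add: card_Un_disjoint)
      moreover have "A \<union> B \<subseteq> {..<n}" using A B n by fastforce
      moreover have "e \<inter> {..<t} \<noteq> {}" if e: "e \<subseteq> A \<union> B" "card e = r" for e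
      proof
        assume "e \<inter> {..<t} = {}"
        then have "e \<subseteq> B" using e A by blast
        then have "card e \<le> r - 1" using card_mono[OF fin(2)] B by metis
        then show False using e rs by simp
      qed
      ultimately show "A \<union> B \<in> cliques r s (S_graph r n t)"
        unfolding cliques_def S_graph_def using fin by auto
    qed
  qed
  then show ?thesis using c by (simp add: card_cartesian_product)
qed

text \<open>Each factor of the falling factorial is at least \<open>n - (t + d)\<close>, and
  Bernoulli's inequality makes the relative error linear in \<open>1 / n\<close>.\<close>

lemma binomial_lower:
  assumes "t + d \<le> n" "n > 0"
  shows "real n ^ d / fact d * (1 - real d * real (t + d) / real n) \<le> real ((n - t) choose d)"
proof -
  have "real n ^ d * (1 - real d * real (t + d) / real n) \<le> (real n - real (t + d)) ^ d"
  proof -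
    define x where "x = real (t + d) / real n"
    have "x \<le> 1" unfolding x_def using assms by simp
    then have "1 - real d * x \<le> (1 - x) ^ d" using Bernoulli_inequality[of "- x" d] by simp
    then have "real n ^ d * (1 - real d * x) \<le> real n ^ d * (1 - x) ^ d" by (intro mult_left_mono) auto
    also have "\<dots> = (real n * (1 - x)) ^ d" by (simp add: power_mult_distrib)
    also have "real n * (1 - x) = real n - real (t + d)" unfolding x_def using assms by (simp add: right_diff_distrib)
    finally have "real n ^ d * (1 - real d * x) \<le> (real n - real (t + d)) ^ d" .
    moreover have "real d * x = real d * real (t + d) / real n" unfolding x_def by simp
    ultimately show ?thesis by (simp only:)
  qed
  also have "(real n - real (t + d)) ^ d = (\<Prod>i<d. real n - real (t + d))" by simp
  also have "\<dots> \<le> (\<Prod>i<d. real (n - t) - real i)"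
    using assms by (intro prod_mono) (auto simp: of_nat_diff)
  also have "\<dots> = real ((n - t) choose d) * fact d"
    by (simp add: binomial_gbinomial gbinomial_prod_rev lessThan_atLeast0)
  finally show ?thesis by (simp add: field_simps)
qed

section \<open>Asymptotics\<close>

lemma smallo_from_bounds:
  fixes f :: "nat \<Rightarrow> real" and a :: real
  assumes up: "\<And>\<epsilon>. \<epsilon> > 0 \<Longrightarrow> eventually (\<lambda>n. f n \<le> (a + \<epsilon>) * real n ^ d) at_top"
    and lo: "\<And>\<epsilon>. \<epsilon> > 0 \<Longrightarrow> eventually (\<lambda>n. (a - \<epsilon>) * real n ^ d \<le> f n) at_top"
  shows "(\<lambda>n. f n - a * real n ^ d) \<in> o[at_top](\<lambda>n. real n ^ d)"
proof (rule landau_o.smallI)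
  fix c :: real assume c: "c > 0"
  show "eventually (\<lambda>n. norm (f n - a * real n ^ d) \<le> c * norm (real n ^ d)) at_top"
    using up[OF c] lo[OF c]
  proof eventually_elim
    case (elim n)
    then show ?case by (simp add: abs_le_iff algebra_simps)
  qed
qed

context components
begin

lemma ex_num_bounds:
  assumes s: "s \<ge> r"
  defines "j \<equiv> s - r + 1"
  shows "num_copies (complete_rgraph r s) (S_graph r n t) \<le> ex_num r n (complete_rgraph r s) forbidden"
    and "\<epsilon> > 0 \<Longrightarrow> eventually (\<lambda>n. real (ex_num r n (complete_rgraph r s) forbidden)
        \<le> (real (t choose j) / fact (r - 1) + \<epsilon>) * real n ^ (r - 1)) at_top"
    and "\<epsilon> > 0 \<Longrightarrow> eventually (\<lambda>n. (real (t choose j) / fact (r - 1) - \<epsilon>) * real n ^ (r - 1)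
        \<le> real (num_copies (complete_rgraph r s) (S_graph r n t))) at_top"
proof -
  let ?K = "complete_rgraph r s"
  have "is_rgraph r (S_graph r n t)" "card (verts (S_graph r n t)) = n" for n
    unfolding is_rgraph_def S_graph_def by auto
  then have S: "num_copies ?K (S_graph r n t) \<in> ex_counts r n ?K forbidden" for n
    unfolding ex_counts_def using S_graph_free[of n]
    by (intro CollectI exI[of _ "S_graph r n t"]) auto
  show "num_copies ?K (S_graph r n t) \<le> ex_num r n ?K forbidden"
    unfolding ex_num_def using finite_ex_counts S by (rule Max_ge)
  have in_ex: "ex_num r n ?K forbidden \<in> ex_counts r n ?K forbidden" for n
    unfolding ex_num_def using S by (intro Max_in finite_ex_counts) auto
  show "eventually (\<lambda>n. real (ex_num r n ?K forbidden) \<le> (real (t choose j) / fact (r - 1) + \<epsilon>) * real n ^ (r - 1)) at_top" if \<epsilon>: "\<epsilon> > 0"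
  proof -
    obtain n0 where n0: "\<forall>G :: nat hypergraph. is_rgraph r G \<longrightarrow> card (verts G) \<ge> n0 \<longrightarrow>
     \<not> packs (hedges G) (k + p) (\<lambda>i. expansion r (\<Gamma> i)) \<longrightarrow>
     real (card (cliques r s G)) \<le> (real (t choose (s - r + 1)) / fact (r - 1) + \<epsilon>) * real (card (verts G)) ^ (r - 1)"
      using clique_bound[OF s \<epsilon>] by (elim exE) (rule that)
    show ?thesis
    proof (rule eventually_at_top_linorderI[of n0])
      fix n assume n: "n \<ge> n0"
      obtain G :: "nat hypergraph" where G: "is_rgraph r G" "card (verts G) = n" "hg_free forbidden G"
        and eq: "ex_num r n ?K forbidden = num_copies ?K G"
        using in_ex[of n] unfolding ex_counts_def by blast
      have "\<not> packs (hedges G) (k + p) (\<lambda>i. expansion r (\<Gamma> i))" using packs_not_free G by blast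
      then have "real (card (cliques r s G)) \<le> (real (t choose (s - r + 1)) / fact (r - 1) + \<epsilon>) * real n ^ (r - 1)"
        using n0[rule_format, of G] G n by simp
      then show "real (ex_num r n ?K forbidden) \<le> (real (t choose j) / fact (r - 1) + \<epsilon>) * real n ^ (r - 1)"
        unfolding eq num_copies_complete j_def .
    qed
  qed
  show "eventually (\<lambda>n. (real (t choose j) / fact (r - 1) - \<epsilon>) * real n ^ (r - 1) \<le> real (num_copies ?K (S_graph r n t))) at_top" if \<epsilon>: "\<epsilon> > 0"
  proof -
    define d where "d = r - 1"
    define a where "a = real (t choose j) / fact d"
    define w where "w = a * real d * real (t + d)"
    have a0: "a \<ge> 0" unfolding a_def by simp
    show ?thesis
    \<comment> \<open>From \<open>w / \<epsilon>\<close> on the error \<open>w / n\<close> is at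
      most \<open>\<epsilon>\<close>; the other summands provide the assumptions of
      \<open>binomial_lower\<close>.\<close>
    proof (rule eventually_at_top_linorderI[of "t + d + nat \<lceil>w / \<epsilon>\<rceil> + 1"])
      fix n assume n: "n \<ge> t + d + nat \<lceil>w / \<epsilon>\<rceil> + 1"
      then have "real n \<ge> w / \<epsilon>" by linarith
      then have "w / real n \<le> \<epsilon>" using \<epsilon> n by (simp add: field_simps)
      have r1: "1 \<le> r" and nt: "t \<le> n" using r n by auto
      have "(a - \<epsilon>) * real n ^ d \<le> (a - w / real n) * real n ^ d"
        using \<open>w / real n \<le> \<epsilon>\<close> by (intro mult_right_mono) auto
      also have "\<dots> = real (t choose j) * (real n ^ d / fact d * (1 - real d * real (t + d) / real n))"
      proof -
        define x where "x = real d * real (t + d) / real n"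
        have "w / real n = a * x" unfolding w_def x_def by simp
        then show ?thesis unfolding x_def[symmetric] a_def by (simp add: algebra_simps diff_divide_distrib)
      qed
      also have "\<dots> \<le> real (t choose j) * real ((n - t) choose d)"
        using n by (intro mult_left_mono binomial_lower) auto
      also have "\<dots> = real ((t choose j) * ((n - t) choose d))" by simp
      also have "\<dots> \<le> real (card (cliques r s (S_graph r n t)))"
        unfolding of_nat_le_iff j_def d_def by (rule S_graph_cliques[OF r1 s nt])
      finally show "(real (t choose j) / fact (r - 1) - \<epsilon>) * real n ^ (r - 1) \<le> real (num_copies ?K (S_graph r n t))"
        unfolding num_copies_complete a_def d_def .
    qed
  qed
qed

lemma clique_asymptotics:
  assumes s: "s \<ge> r"
  shows "(s \<le> t + r - 1 \<longrightarrow>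
       (\<lambda>n. real (ex_num r n (complete_rgraph r s) forbidden)) \<sim>[at_top]
         (\<lambda>n. real (num_copies (complete_rgraph r s) (S_graph r n t))) \<and>
       (\<lambda>n. real (ex_num r n (complete_rgraph r s) forbidden)
              - real (t choose (s - r + 1)) * (real n ^ (r - 1) / fact (r - 1)))
         \<in> o[at_top](\<lambda>n. real n ^ (r - 1)) \<and>
       (\<lambda>n. real (num_copies (complete_rgraph r s) (S_graph r n t))
              - real (t choose (s - r + 1)) * (real n ^ (r - 1) / fact (r - 1)))
         \<in> o[at_top](\<lambda>n. real n ^ (r - 1))) \<and>
     (s \<ge> t + r \<longrightarrow>
       (\<lambda>n. real (ex_num r n (complete_rgraph r s) forbidden)) \<in> o[at_top](\<lambda>n. real n ^ (r - 1)))"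
proof -
  define f where "f n = real (ex_num r n (complete_rgraph r s) forbidden)" for n
  define g where "g n = real (num_copies (complete_rgraph r s) (S_graph r n t))" for n
  define a :: real where "a = real (t choose (s - r + 1)) / fact (r - 1)"
  have gf: "g n \<le> f n" for n unfolding f_def g_def using ex_num_bounds(1)[OF s] by simp
  have up: "eventually (\<lambda>n. f n \<le> (a + \<epsilon>) * real n ^ (r - 1)) at_top" if "\<epsilon> > 0" for \<epsilon>
    unfolding f_def a_def using ex_num_bounds(2)[OF s that] .
  have lo: "eventually (\<lambda>n. (a - \<epsilon>) * real n ^ (r - 1) \<le> g n) at_top" if "\<epsilon> > 0" for \<epsilon>
    unfolding g_def a_def using ex_num_bounds(3)[OF s that] .
  \<comment> \<open>The upper bound was proved for \<open>f\<close> and the lower bound for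
    \<open>g\<close>; as \<open>g n \<le> f n\<close>, each passes to the other function.\<close>
  have up': "eventually (\<lambda>n. g n \<le> (a + \<epsilon>) * real n ^ (r - 1)) at_top" if "\<epsilon> > 0" for \<epsilon>
    using up[OF that] by eventually_elim (use gf order_trans in blast)
  have lo': "eventually (\<lambda>n. (a - \<epsilon>) * real n ^ (r - 1) \<le> f n) at_top" if "\<epsilon> > 0" for \<epsilon>
    using lo[OF that] by eventually_elim (use gf order_trans in blast)
  have fo: "(\<lambda>n. f n - a * real n ^ (r - 1)) \<in> o[at_top](\<lambda>n. real n ^ (r - 1))"
    by (rule smallo_from_bounds[OF up lo'])
  have go: "(\<lambda>n. g n - a * real n ^ (r - 1)) \<in> o[at_top](\<lambda>n. real n ^ (r - 1))"
    by (rule smallo_from_bounds[OF up' lo])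
  have aeq: "a * real n ^ (r - 1) = real (t choose (s - r + 1)) * (real n ^ (r - 1) / fact (r - 1))" for n
    unfolding a_def by simp
  have eqv: "f \<sim>[at_top] g" if st: "s \<le> t + r - 1"
  proof -
    \<comment> \<open>Up to here the binomial coefficient is nonzero and gives the asymptotics;
      beyond, it vanishes and leaves the second part.\<close>
    have "s - r + 1 \<le> t" using st s r by simp
    then have a: "a \<noteq> 0" unfolding a_def by simp
    have "f \<sim>[at_top] (\<lambda>n. a * real n ^ (r - 1))" "g \<sim>[at_top] (\<lambda>n. a * real n ^ (r - 1))"
      using fo go a by (auto intro!: smallo_imp_asymp_equiv)
    then show ?thesis using asymp_equiv_trans asymp_equiv_sym by blast
  qed
  have small: "f \<in> o[at_top](\<lambda>n. real n ^ (r - 1))" if "s \<ge> t + r"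
  proof -
    have "a = 0" unfolding a_def using that by simp
    then show ?thesis using fo by simp
  qed
  show ?thesis using eqv fo go small unfolding f_def[symmetric] g_def[symmetric] aeq[symmetric] by auto
qed

end

theorem theorem6p2:
  fixes r k p s t :: nat
    and l u :: "nat \<Rightarrow> nat"
    and Q :: "nat \<Rightarrow> (nat + nat set \<times> nat) hypergraph"
    and F :: "(nat \<times> (nat + nat set \<times> nat)) hypergraph"
  assumes "r \<ge> 3" and "k \<ge> 1"
    and "\<forall>i\<in>{1..k}. l i \<ge> 5"
    and "\<forall>j\<in>{1..p}. u j \<ge> 2"
    and "s \<ge> r"
    and "t = (\<Sum>i=1..k. (l i + 1) div 2) + p - 1"
    and "\<forall>i\<in>{1..k}. Q i \<in> {expansion r (path_graph (l i)), expansion r (cycle_graph (l i))}"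
    and "F = disjoint_union (map Q [1..<k+1] @ map (\<lambda>j. expansion r (star_graph (u j))) [1..<p+1])"
  shows
    "(s \<le> t + r - 1 \<longrightarrow>
       (\<lambda>n. real (ex_num r n (complete_rgraph r s) F)) \<sim>[at_top]
         (\<lambda>n. real (num_copies (complete_rgraph r s) (S_graph r n t))) \<and>
       (\<lambda>n. real (ex_num r n (complete_rgraph r s) F)
              - real (t choose (s - r + 1)) * (real n ^ (r - 1) / fact (r - 1)))
         \<in> o[at_top](\<lambda>n. real n ^ (r - 1)) \<and>
       (\<lambda>n. real (num_copies (complete_rgraph r s) (S_graph r n t))
              - real (t choose (s - r + 1)) * (real n ^ (r - 1) / fact (r - 1)))
         \<in> o[at_top](\<lambda>n. real n ^ (r - 1))) \<and>
     (s \<ge> t + r \<longrightarrow>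
       (\<lambda>n. real (ex_num r n (complete_rgraph r s) F)) \<in> o[at_top](\<lambda>n. real n ^ (r - 1)))"
proof -
  define l' where "l' i = l (Suc i)" for i
  define u' where "u' j = u (Suc j)" for j
  \<comment> \<open>The equality test reads off which alternative \<open>Q\<close> takes; the shift
    passes to indices starting at 0.\<close>
  define z' where "z' i = (if Q (Suc i) = expansion r (path_graph (l (Suc i))) then l (Suc i) else 0)" for i
  have sumeq: "(\<Sum>i=1..k. (l i + 1) div 2) = (\<Sum>i<k. (l' i + 1) div 2)"
    unfolding l'_def using sum.atLeast1_atMost_eq[of "\<lambda>i. (l i + 1) div 2" k] by simp
  \<comment> \<open>Guards the truncated subtraction in the definition of \<open>t\<close>.\<close>
  have pos: "(\<Sum>i<k. (l' i + 1) div 2) \<ge> 1"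
  proof -
    have "(l' 0 + 1) div 2 \<le> (\<Sum>i<k. (l' i + 1) div 2)" using assms(2) by (intro member_le_sum) auto
    moreover have "l 1 \<ge> 5" using assms(2,3) by simp
    ultimately show ?thesis unfolding l'_def by simp
  qed
  interpret c: components r k p t l' z' u'
  proof
    show "t + 1 = (\<Sum>i<k. (l' i + 1) div 2) + p" using assms(6) sumeq pos by simp
  qed (use assms in \<open>auto simp: l'_def u'_def z'_def\<close>)
  have "map Q [1..<k+1] @ map (\<lambda>j. expansion r (star_graph (u j))) [1..<p+1] = map (\<lambda>i. expansion r (c.\<Gamma> i)) [0..<k + p]"
  proof (rule nth_equalityI)
    fix i assume "i < length (map Q [1..<k+1] @ map (\<lambda>j. expansion r (star_graph (u j))) [1..<p+1])"
    then have i: "i < k + p" by (simp del: upt_Suc)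
    show "(map Q [1..<k+1] @ map (\<lambda>j. expansion r (star_graph (u j))) [1..<p+1]) ! i = map (\<lambda>i. expansion r (c.\<Gamma> i)) [0..<k + p] ! i"
    proof (cases "i < k")
      case True
      have "Q (Suc i) = expansion r (path_graph (l (Suc i))) \<or> Q (Suc i) = expansion r (cycle_graph (l (Suc i)))" "l (Suc i) \<ge> 5"
        using assms(3,7) True by auto
      then have "Q (Suc i) = expansion r (c.\<Gamma> i)"
        unfolding c.\<Gamma>_def l'_def z'_def using True path_graph_eq cycle_graph_eq[of "l (Suc i)"] by auto
      then show ?thesis using True i by (simp add: nth_append del: upt_Suc)
    next
      case False
      then have "i - k < p" using i by simp
      then show ?thesis using False i unfolding c.\<Gamma>_def u'_def by (simp add: nth_append Suc_diff_le del: upt_Suc)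
    qed
  qed (simp del: upt_Suc)
  then have "F = c.forbidden" using assms(8) by simp
  then show ?thesis using c.clique_asymptotics[OF assms(5)] by simp
qed

end
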